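(* Let $k\ge0$, let $\sigma\ge k+1.5$, and take the stabilisation parameters $\lambda_{i,y}=\lambda_{x,j}=\sqrt\varepsilon$ for all $i,j=0,1,\dots,N$. Let $\mathbf w=(u,p,q)$ with $p=\varepsilon u_x$, $q=\varepsilon u_y$, where $u$ solves the problem and satisfies the regularity assumption, and let $\mathbf W=(U,P,Q)\in\mathcal V_N^3$ be the LDG solution on the layer-adapted mesh. Then there is $C>0$ independent of $\varepsilon$ and $N$ such that $$|||\mathbf w-\mathbf W|||_{b}\le CN^{-k}(\max|\psi'|)^{k+1/2}.$$
   Context: Problem: $0<\varepsilon\ll1$, $\Omega=(0,1)^2$, $b$ smooth on $\overline\Omega$ with $b\ge2\beta^2>0$ for a constant $\beta>0$, $f$ given, and $u$ solves $-\varepsilon\Delta u+bu=f$ in $\Omega$, $u=0$ on $\partial\Omega$. Standing regularity assumption: $u=S+\sum_{m=1}^4W_m+\sum_{m=1}^4Z_m$ where, for all $0\le i,j\le k+2$ and a constant $C$ independent of $\varepsilon$: $|\partial_x^i\partial_y^jS|\le C$; $|\partial_x^i\partial_y^jW_1|\le C\varepsilon^{-i/2}e^{-\beta x/\sqrt\varepsilon}$, $|\partial_x^i\partial_y^jW_2|\le C\varepsilon^{-j/2}e^{-\beta y/\sqrt\varepsilon}$, $|\partial_x^i\partial_y^jW_3|\le C\varepsilon^{-i/2}e^{-\beta (1-x)/\sqrt\varepsilon}$, $|\partial_x^i\partial_y^jW_4|\le C\varepsilon^{-j/2}e^{-\beta (1-y)/\sqrt\varepsilon}$; $|\partial_x^i\partial_y^jZ_m|\le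 C\varepsilon^{-(i+j)/2}e^{-\beta(d_m(x)+d'_m(y))/\sqrt\varepsilon}$ with $(d_m,d'_m)$ the distances to the corresponding corner, e.g. $Z_1$: $e^{-\beta(x+y)/\sqrt\varepsilon}$ (and $Z_2,Z_3,Z_4$ analogously for the corners $(1,0),(1,1),(0,1)$). Mesh: $N\ge4$ a multiple of $4$, $\sqrt\varepsilon\le N^{-1}$, $\varepsilon$ small so that $\tau:=\frac{\sigma\sqrt\varepsilon}{\beta}\varphi(1/4)\le1/4$. $\varphi$ is one of: S-mesh $\varphi(t)=4t\ln N$; BS-mesh $\varphi(t)=-\ln[1-4(1-N^{-1})t]$; B-type mesh $\varphi(t)=-\ln[1-4(1-\sqrt\varepsilon)t]$. Mesh points $x_i=\frac{\sigma\sqrt\varepsilon}{\beta}\varphi(i/N)$ ($0\le i\le N/4$), $x_i=\tau+2(1-2\tau)(i/N-1/4)$ ($N/4<i<3N/4$), $x_i=1-\frac{\sigma\sqrt\varepsilon}{\beta}\varphi(1-i/N)$ ($3N/4\le i\le N$), and $y_j=x_j$; tensor-product mesh with elements $K_{ij}=I_i\times J_j$, $I_i=(x_{i-1},x_i)$, $J_j=(y_{j-1},y_j)$. $\psi=e^{-\varphi}$, $\max|\psi'|=\max_{[0,1/4]}|\psi'|$. LDG method: $\mathcal V_N=\{v\in L^2(\Omega):v|_{K_{ij}}\in\mathcal Q^k(K_{ij})\}$ ($\mathcal Q^k$ = polynomials of degree $\le k$ in each variable). Traces $v^\pm_{i,y}=\lim_{x\to x_i^\pm}v(x,y)$, $v^\pm_{x,j}=\lim_{y\to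 y_j^\pm}v(x,y)$; jumps $[\![v]\!]_{i,y}=v^+_{i,y}-v^-_{i,y}$ ($1\le i\le N-1$), $[\![v]\!]_{0,y}=v^+_{0,y}$, $[\![v]\!]_{N,y}=-v^-_{N,y}$, and analogously $[\![v]\!]_{x,j}$. $(\cdot,\cdot)$ is the broken $L^2(\Omega)$ inner product (derivatives taken elementwise), $\langle\cdot,\cdot\rangle_{J_j}$, $\langle\cdot,\cdot\rangle_{I_i}$ are $L^2$ inner products on edges. For $\mathbf W=(U,P,Q)$, $\mathbf z=(v,s,r)$ define $B(\mathbf W;\mathbf z)=T_1+T_2+T_3+T_4$ with $T_1=\varepsilon^{-1}(P,s)+\varepsilon^{-1}(Q,r)+(bU,v)$; $T_2=(U,s_x)+\sum_{j=1}^N\sum_{i=1}^{N-1}\langle U^-_{i,y},[\![s]\!]_{i,y}\rangle_{J_j}+(U,r_y)+\sum_{i=1}^N\sum_{j=1}^{N-1}\langle U^-_{x,j},[\![r]\!]_{x,j}\rangle_{I_i}$; $T_3=(P,v_x)+\sum_{j=1}^N[\sum_{i=0}^{N-1}\langle P^+_{i,y},[\![v]\!]_{i,y}\rangle_{J_j}-\langle P^-_{N,y},v^-_{N,y}\rangle_{J_j}]+(Q,v_y)+\sum_{i=1}^N[\sum_{j=0}^{N-1}\langle Q^+_{x,j},[\![v]\!]_{x,j}\rangle_{I_i}-\langle Q^-_{x,N},v^-_{x,N}\rangle_{I_i}]$; $T_4=\sum_{j=1}^N\sum_{i=0}^N\langle\lambda_{i,y}[\![U]\!]_{i,y},[\![v]\!]_{i,y}\rangle_{J_j}+\sum_{i=1}^N\sum_{j=0}^N\langle\lambda_{x,j}[\![U]\!]_{x,j},[\![v]\!]_{x,j}\rangle_{I_i}$,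 with stabilisation parameters $\lambda\ge0$. The LDG solution $\mathbf W\in\mathcal V_N^3$ satisfies $B(\mathbf W;\mathbf z)=(f,v)$ for all $\mathbf z=(v,s,r)\in\mathcal V_N^3$. Balanced norm: $|||\mathbf w|||_b^2=\varepsilon^{-3/2}\|p\|^2+\varepsilon^{-3/2}\|q\|^2+\|b^{1/2}u\|^2+\sum_{j=1}^N\sum_{i=0}^N\int_{J_j}[\![u]\!]_{i,y}^2dy+\sum_{i=1}^N\sum_{j=0}^N\int_{I_i}[\![u]\!]_{x,j}^2dx$. *)

theory Defs
  imports "HOL-Analysis.Analysis"
begin

definition dI :: "(real \<Rightarrow> real) \<Rightarrow> real \<Rightarrow> real" where
  "dI g x = (SOME D. (g has_real_derivative D) (at x within {0..1}))"

definition pdy :: "nat \<Rightarrow> (real \<Rightarrow> real \<Rightarrow> real) \<Rightarrow> real \<Rightarrow> real \<Rightarrow> real" where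
  "pdy j g x y = (dI ^^ j) (\<lambda>t. g x t) y"

definition pd :: "nat \<Rightarrow> nat \<Rightarrow> (real \<Rightarrow> real \<Rightarrow> real) \<Rightarrow> real \<Rightarrow> real \<Rightarrow> real" where
  "pd i j g x y = (dI ^^ i) (\<lambda>s. pdy j g s y) x"

abbreviation sq :: "(real \<times> real) set" where
  "sq \<equiv> cbox (0,0) (1,1)"

definition Ck_sq :: "nat \<Rightarrow> (real \<Rightarrow> real \<Rightarrow> real) \<Rightarrow> bool" where
  "Ck_sq m g \<longleftrightarrow>
     (\<forall>i j. i \<le> m \<longrightarrow> j \<le> m \<longrightarrow>
        continuous_on sq (\<lambda>z. pd i j g (fst z) (snd z)) \<and>
        (\<forall>x\<in>{0..1}. \<forall>y\<in>{0..1}.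
           (j < m \<longrightarrow> ((\<lambda>t. pdy j g x t) has_real_derivative pdy (Suc j) g x y) (at y within {0..1})) \<and>
           (i < m \<longrightarrow> ((\<lambda>s. pd i j g s y) has_real_derivative pd (Suc i) j g x y) (at x within {0..1}))))"

definition smooth_sq :: "(real \<Rightarrow> real \<Rightarrow> real) \<Rightarrow> bool" where
  "smooth_sq g \<longleftrightarrow> (\<forall>m. Ck_sq m g)"

definition solves :: "real \<Rightarrow> (real \<Rightarrow> real \<Rightarrow> real) \<Rightarrow> (real \<Rightarrow> real \<Rightarrow> real) \<Rightarrow> (real \<Rightarrow> real \<Rightarrow> real) \<Rightarrow> bool" where
  "solves eps b f u \<longleftrightarrow>
     (\<forall>x\<in>{0<..<1}. \<forall>y\<in>{0<..<1}. - eps * (pd 2 0 u x y + pd 0 2 u x y) + b x y * u x y = f x y) \<and>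
     (\<forall>x\<in>{0..1}. \<forall>y\<in>{0..1}. (x = 0 \<or> x = 1 \<or> y = 0 \<or> y = 1) \<longrightarrow> u x y = 0)"

definition reg_decomp :: "nat \<Rightarrow> real \<Rightarrow> real \<Rightarrow> real \<Rightarrow> (real \<Rightarrow> real \<Rightarrow> real) \<Rightarrow> bool" where
  "reg_decomp k beta Cr eps u \<longleftrightarrow>
    (\<exists>S W1 W2 W3 W4 Z1 Z2 Z3 Z4.
      (\<forall>g\<in>{S, W1, W2, W3, W4, Z1, Z2, Z3, Z4}. Ck_sq (k + 2) g) \<and>
      (\<forall>x\<in>{0..1}. \<forall>y\<in>{0..1}.
          u x y = S x y + W1 x y + W2 x y + W3 x y + W4 x y + Z1 x y + Z2 x y + Z3 x y + Z4 x y) \<and>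
      (\<forall>i j. i \<le> k + 2 \<longrightarrow> j \<le> k + 2 \<longrightarrow> (\<forall>x\<in>{0..1}. \<forall>y\<in>{0..1}.
          \<bar>pd i j S x y\<bar> \<le> Cr \<and>
          \<bar>pd i j W1 x y\<bar> \<le> Cr * eps powr (- real i / 2) * exp (- beta * x / sqrt eps) \<and>
          \<bar>pd i j W2 x y\<bar> \<le> Cr * eps powr (- real j / 2) * exp (- beta * y / sqrt eps) \<and>
          \<bar>pd i j W3 x y\<bar> \<le> Cr * eps powr (- real i / 2) * exp (- beta * (1 - x) / sqrt eps) \<and>
          \<bar>pd i j W4 x y\<bar> \<le> Cr * eps powr (- real j / 2) * exp (- beta * (1 - y) / sqrt eps) \<and>
          \<bar>pd i j Z1 x y\<bar> \<le> Cr * eps powr (- real (i + j) / 2) * exp (- beta * (x + y) / sqrt eps) \<and>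
          \<bar>pd i j Z2 x y\<bar> \<le> Cr * eps powr (- real (i + j) / 2) * exp (- beta * ((1 - x) + y) / sqrt eps) \<and>
          \<bar>pd i j Z3 x y\<bar> \<le> Cr * eps powr (- real (i + j) / 2) * exp (- beta * ((1 - x) + (1 - y)) / sqrt eps) \<and>
          \<bar>pd i j Z4 x y\<bar> \<le> Cr * eps powr (- real (i + j) / 2) * exp (- beta * (x + (1 - y)) / sqrt eps))))"

datatype mesh_kind = S_mesh | BS_mesh | B_mesh

definition phi :: "mesh_kind \<Rightarrow> nat \<Rightarrow> real \<Rightarrow> real \<Rightarrow> real" where
  "phi kind N eps t = (case kind of
      S_mesh \<Rightarrow> 4 * t * ln (real N)
    | BS_mesh \<Rightarrow> - ln (1 - 4 * (1 - 1 / real N) * t)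
    | B_mesh \<Rightarrow> - ln (1 - 4 * (1 - sqrt eps) * t))"

definition psi :: "mesh_kind \<Rightarrow> nat \<Rightarrow> real \<Rightarrow> real \<Rightarrow> real" where
  "psi kind N eps t = exp (- phi kind N eps t)"

definition max_dpsi :: "mesh_kind \<Rightarrow> nat \<Rightarrow> real \<Rightarrow> real" where
  "max_dpsi kind N eps = Sup ((\<lambda>t. \<bar>deriv (psi kind N eps) t\<bar>) ` {0..1/4})"

definition tau :: "mesh_kind \<Rightarrow> real \<Rightarrow> real \<Rightarrow> real \<Rightarrow> nat \<Rightarrow> real" where
  "tau kind sg beta eps N = sg * sqrt eps / beta * phi kind N eps (1/4)"

text \<open>mesh points x_i (and y_j = x_j)\<close>
definition mesh_pt :: "mesh_kind \<Rightarrow> real \<Rightarrow> real \<Rightarrow> real \<Rightarrow> nat \<Rightarrow> nat \<Rightarrow> real" where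
  "mesh_pt kind sg beta eps N i =
     (let t = real i / real N; \<tau> = tau kind sg beta eps N in
      if 4 * i \<le> N then sg * sqrt eps / beta * phi kind N eps t
      else if 4 * i < 3 * N then \<tau> + 2 * (1 - 2 * \<tau>) * (t - 1/4)
      else 1 - sg * sqrt eps / beta * phi kind N eps (1 - t))"

text \<open>A broken function v is represented elementwise: v i j x y is the function on
K_ij = I_i \<times> J_j (1 \<le> i,j \<le> N), I_i = (x_(i-1), x_i). Values of v i j outside K_ij
only serve to define traces (one-sided limits) of polynomials.\<close>
type_synonym dgfun = "nat \<Rightarrow> nat \<Rightarrow> real \<Rightarrow> real \<Rightarrow> real"

definition Qk :: "nat \<Rightarrow> (real \<Rightarrow> real \<Rightarrow> real) \<Rightarrow> bool" where
  "Qk k g \<longleftrightarrow> (\<exists>c. \<forall>x y. g x y = (\<Sum>a\<le>k. \<Sum>b\<le>k. c a b * x ^ a * y ^ b))"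

definition VN :: "nat \<Rightarrow> nat \<Rightarrow> dgfun \<Rightarrow> bool" where
  "VN k N v \<longleftrightarrow> (\<forall>i\<in>{1..N}. \<forall>j\<in>{1..N}. Qk k (v i j))"

definition ip :: "nat \<Rightarrow> (nat \<Rightarrow> real) \<Rightarrow> dgfun \<Rightarrow> dgfun \<Rightarrow> real" where
  "ip N xs v w = (\<Sum>i\<in>{1..N}. \<Sum>j\<in>{1..N}.
      integral (cbox (xs (i - 1), xs (j - 1)) (xs i, xs j)) (\<lambda>z. v i j (fst z) (snd z) * w i j (fst z) (snd z)))"

definition dx :: "dgfun \<Rightarrow> dgfun" where
  "dx v = (\<lambda>i j x y. deriv (\<lambda>s. v i j s y) x)"

definition dy :: "dgfun \<Rightarrow> dgfun" where
  "dy v = (\<lambda>i j x y. deriv (\<lambda>t. v i j x t) y)"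

definition jumpV :: "nat \<Rightarrow> (nat \<Rightarrow> real) \<Rightarrow> dgfun \<Rightarrow> nat \<Rightarrow> nat \<Rightarrow> real \<Rightarrow> real" where
  "jumpV N xs v i j y =
     (if i = 0 then v 1 j (xs 0) y
      else if i = N then - v N j (xs N) y
      else v (Suc i) j (xs i) y - v i j (xs i) y)"

definition jumpH :: "nat \<Rightarrow> (nat \<Rightarrow> real) \<Rightarrow> dgfun \<Rightarrow> nat \<Rightarrow> nat \<Rightarrow> real \<Rightarrow> real" where
  "jumpH N xs v i j x =
     (if j = 0 then v i 1 x (xs 0)
      else if j = N then - v i N x (xs N)
      else v i (Suc j) x (xs j) - v i j x (xs j))"

text \<open>integral over J_j (resp. I_i); since y_j = x_j both are over [xs(j-1), xs j]\<close>
definition eint :: "(nat \<Rightarrow> real) \<Rightarrow> nat \<Rightarrow> (real \<Rightarrow> real) \<Rightarrow> real" where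
  "eint xs j g = integral {xs (j - 1)..xs j} g"

definition ldgB :: "real \<Rightarrow> real \<Rightarrow> (real \<Rightarrow> real \<Rightarrow> real) \<Rightarrow> nat \<Rightarrow> (nat \<Rightarrow> real) \<Rightarrow>
    dgfun \<Rightarrow> dgfun \<Rightarrow> dgfun \<Rightarrow> dgfun \<Rightarrow> dgfun \<Rightarrow> dgfun \<Rightarrow> real" where
  "ldgB eps lam b N xs U P Q v s r =
     (let T1 = ip N xs P s / eps + ip N xs Q r / eps + ip N xs (\<lambda>i j x y. b x y * U i j x y) v;
          T2 = ip N xs U (dx s)
             + (\<Sum>j\<in>{1..N}. \<Sum>i\<in>{1..N-1}. eint xs j (\<lambda>y. U i j (xs i) y * jumpV N xs s i j y))
             + ip N xs U (dy r)
             + (\<Sum>i\<in>{1..N}. \<Sum>j\<in>{1..N-1}. eint xs i (\<lambda>x. U i j x (xs j) * jumpH N xs r i j x));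
          T3 = ip N xs P (dx v)
             + (\<Sum>j\<in>{1..N}. (\<Sum>i\<in>{0..N-1}. eint xs j (\<lambda>y. P (Suc i) j (xs i) y * jumpV N xs v i j y))
                              - eint xs j (\<lambda>y. P N j (xs N) y * v N j (xs N) y))
             + ip N xs Q (dy v)
             + (\<Sum>i\<in>{1..N}. (\<Sum>j\<in>{0..N-1}. eint xs i (\<lambda>x. Q i (Suc j) x (xs j) * jumpH N xs v i j x))
                              - eint xs i (\<lambda>x. Q i N x (xs N) * v i N x (xs N)));
          T4 = (\<Sum>j\<in>{1..N}. \<Sum>i\<in>{0..N}. eint xs j (\<lambda>y. lam * jumpV N xs U i j y * jumpV N xs v i j y))
             + (\<Sum>i\<in>{1..N}. \<Sum>j\<in>{0..N}. eint xs i (\<lambda>x. lam * jumpH N xs U i j x * jumpH N xs v i j x))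
      in T1 + T2 + T3 + T4)"

definition ldg_solution :: "nat \<Rightarrow> real \<Rightarrow> real \<Rightarrow> (real \<Rightarrow> real \<Rightarrow> real) \<Rightarrow> (real \<Rightarrow> real \<Rightarrow> real) \<Rightarrow>
    nat \<Rightarrow> (nat \<Rightarrow> real) \<Rightarrow> dgfun \<Rightarrow> dgfun \<Rightarrow> dgfun \<Rightarrow> bool" where
  "ldg_solution k eps lam b f N xs U P Q \<longleftrightarrow>
     VN k N U \<and> VN k N P \<and> VN k N Q \<and>
     (\<forall>v s r. VN k N v \<longrightarrow> VN k N s \<longrightarrow> VN k N r \<longrightarrow>
        ldgB eps lam b N xs U P Q v s r = ip N xs (\<lambda>i j x y. f x y) v)"

definition bal_err :: "real \<Rightarrow> (real \<Rightarrow> real \<Rightarrow> real) \<Rightarrow> nat \<Rightarrow> (nat \<Rightarrow> real) \<Rightarrow>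
    (real \<Rightarrow> real \<Rightarrow> real) \<Rightarrow> dgfun \<Rightarrow> dgfun \<Rightarrow> dgfun \<Rightarrow> real" where
  "bal_err eps b N xs u U P Q =
     (let eu = (\<lambda>i j x y. u x y - U i j x y);
          ep = (\<lambda>i j x y. eps * pd 1 0 u x y - P i j x y);
          eq = (\<lambda>i j x y. eps * pd 0 1 u x y - Q i j x y)
      in sqrt (eps powr (-3/2) * ip N xs ep ep + eps powr (-3/2) * ip N xs eq eq
               + ip N xs (\<lambda>i j x y. b x y * eu i j x y) eu
               + (\<Sum>j\<in>{1..N}. \<Sum>i\<in>{0..N}. eint xs j (\<lambda>y. (jumpV N xs eu i j y)\<^sup>2))
               + (\<Sum>i\<in>{1..N}. \<Sum>j\<in>{0..N}. eint xs i (\<lambda>x. (jumpH N xs eu i j x)\<^sup>2))))"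

end

theory Submission
  imports Defs "HOL-Computational_Algebra.Polynomial"
begin

text \<open>Compare the LDG solution \<open>W\<close> with the elementwise projection \<open>\<pi> w\<close> of the exact triple that takes the
  \<open>b\<close>-weighted \<open>L\<^sup>2\<close>-projection of \<open>u\<close> and plain \<open>L\<^sup>2\<close>-projections of \<open>p\<close> and \<open>q\<close>. By Galerkin orthogonality the
  discrete error \<open>\<xi> = W - \<pi> w\<close> satisfies \<open>B(\<xi>; \<xi>) = B(w - \<pi> w; \<xi>)\<close>, whose left side is the energy norm. The weights make
  all volume terms on the right vanish except \<open>(u - \<pi> u, s_x)\<close>; this one and the edge terms are handled by
  inverse inequalities and by the mesh width, which is at least of order \<open>sqrt eps * max_dpsi / N\<close>. The result carries an
  additional factor \<open>sqrt eps\<close> in the squared energy norm, which is exactly what separates it from the balanced norm.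
  Both kinds of projection are stable in the maximum norm, so only the best approximation matters: each
  component is replaced by its Taylor polynomial where the mesh resolves the layer and by zero where the
  layer function has already decayed.\<close>

text \<open>Two obstacles shape the argument. With an unweighted projection of \<open>u\<close> the
  reaction term \<open>(b (u - \<pi> u), v)\<close> would survive and could be bounded only without
  a factor \<open>sqrt eps\<close>; passing to the balanced norm would then cost
  \<open>1 / sqrt eps\<close>. The weight \<open>b\<close> removes exactly this term. The price is
  the flux term with \<open>s_x\<close>: Young's inequality with weight \<open>1 / eps\<close> and
  the inverse inequality bound it by \<open>eps * kap^2 * N / h\<close>, up to a constant, where
  \<open>kap = (M / N) ^ (k + 1)\<close> is the size of the maximum-norm error, \<open>M\<close>
  stands for \<open>max_dpsi\<close> and \<open>h\<close> for the smallest width. Inserting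
  \<open>h\<close> of order \<open>sqrt eps * M / N\<close> gives
  \<open>sqrt eps * kap^2 * N^2 / M\<close>, and \<open>kap^2 * N^2 / M = N^(-2k) * M^(2k+1)\<close>
  is the square of the rate. The second obstacle is the projection error of \<open>p\<close> and
  \<open>q\<close>, weighted by \<open>eps^(-3/2)\<close>: its maximum-norm bound
  \<open>sqrt eps * kap\<close> yields only \<open>eps * kap^2\<close> after squaring. For a layer
  component the missing \<open>sqrt eps\<close> comes from the thinness of the layer: either the
  cell has width of order \<open>sqrt eps\<close> across the layer, or the integral of the squared
  exponential supplies this factor.\<close>

lemma square_add_le: "((x::real) + y)\<^sup>2 \<le> 2 * x\<^sup>2 + 2 * y\<^sup>2"
  using zero_le_power2[of "x - y"] by (simp add: power2_eq_square algebra_simps)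

lemma square_diff_le: "((x::real) - y)\<^sup>2 \<le> 2 * x\<^sup>2 + 2 * y\<^sup>2"
  using square_add_le[of x "- y"] by simp

text \<open>Completing a square. The weight \<open>g\<close> stays free so that the second term can
  be absorbed by whatever multiple of the energy is available.\<close>

lemma young:
  fixes x y g :: real
  assumes "g > 0"
  shows "\<bar>x * y\<bar> \<le> x\<^sup>2 / (4 * g) + g * y\<^sup>2"
proof -
  have "0 \<le> (\<bar>x\<bar> - 2 * g * \<bar>y\<bar>)\<^sup>2 / (4 * g)" using assms by simp
  also have "\<dots> = x\<^sup>2 / (4 * g) + g * y\<^sup>2 - \<bar>x * y\<bar>"
    using assms by (simp add: power2_diff power_mult_distrib abs_mult field_simps power2_eq_square)
  finally show ?thesis by simp
qed

section \<open>Orthogonal projections onto finite-dimensional spaces\<close>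

text \<open>Only semi-definiteness is required: when \<open>V\<close> consists of the functions
  continuous on a box, every function that vanishes on the box is a null vector of the integral
  form, whatever its values elsewhere.\<close>

locale semi_inner =
  fixes V :: "('a \<Rightarrow> real) set" and B :: "('a \<Rightarrow> real) \<Rightarrow> ('a \<Rightarrow> real) \<Rightarrow> real"
  assumes closed: "f \<in> V \<Longrightarrow> g \<in> V \<Longrightarrow> (\<lambda>x. f x + c * g x) \<in> V"
    and add: "f \<in> V \<Longrightarrow> g \<in> V \<Longrightarrow> h \<in> V \<Longrightarrow> B (\<lambda>x. f x + c * g x) h = B f h + c * B g h"
    and sym: "f \<in> V \<Longrightarrow> g \<in> V \<Longrightarrow> B f g = B g f"
    and nonneg: "f \<in> V \<Longrightarrow> B f f \<ge> 0"
begin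

lemma linear_combination:
  assumes "finite I" "\<And>i. i \<in> I \<Longrightarrow> \<phi> i \<in> V" "u \<in> V"
  shows "(\<lambda>x. u x + (\<Sum>i\<in>I. c i * \<phi> i x)) \<in> V \<and>
    (\<forall>w\<in>V. B (\<lambda>x. u x + (\<Sum>i\<in>I. c i * \<phi> i x)) w = B u w + (\<Sum>i\<in>I. c i * B (\<phi> i) w))"
  using assms
proof (induction I rule: finite_induct)
  case empty
  then show ?case by simp
next
  case (insert m I)
  let ?s = "\<lambda>x. u x + (\<Sum>i\<in>I. c i * \<phi> i x)"
  have s: "?s \<in> V" "\<And>w. w \<in> V \<Longrightarrow> B ?s w = B u w + (\<Sum>i\<in>I. c i * B (\<phi> i) w)"
    using insert by auto
  have eq: "(\<lambda>x. u x + (\<Sum>i\<in>insert m I. c i * \<phi> i x)) = (\<lambda>x. ?s x + c m * \<phi> m x)"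
    using insert.hyps by (auto simp: fun_eq_iff)
  have m: "\<phi> m \<in> V" using insert.prems by auto
  show ?case unfolding eq
    using closed[OF s(1) m] add[OF s(1) m] s(2) insert.hyps by auto
qed

text \<open>Along \<open>w + t e\<close> the quadratic form is affine in \<open>t\<close> once
  \<open>B e e\<close> vanishes; a non-zero slope would make it negative somewhere. The chosen
  \<open>t\<close> is where it equals -1.\<close>

lemma null_vector:
  assumes "w \<in> V" "e \<in> V" "B e e = 0"
  shows "B w e = 0"
proof (rule ccontr)
  assume n: "B w e \<noteq> 0"
  define t where "t = - (B w w + 1) / (2 * B w e)"
  let ?z = "\<lambda>x. w x + t * e x"
  have z: "?z \<in> V" using closed assms by blast
  have "B ?z ?z = B w ?z + t * B e ?z" using add[OF assms(1,2) z] .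
  also have "\<dots> = B ?z w + t * B ?z e" using sym z assms by simp
  also have "\<dots> = B w w + 2 * t * B w e"
    using add[OF assms(1,2)] assms sym by (simp add: algebra_simps)
  also have "\<dots> = -1" using n by (simp add: t_def field_simps)
  finally show False using nonneg[OF z] by simp
qed

text \<open>Gram-Schmidt by induction, so no Gram matrix is inverted and the family may be
  dependent. Both \<open>u\<close> and the new function are first made orthogonal to the old ones;
  the last correction goes along the orthogonalised new function.\<close>

lemma projection:
  assumes "finite I" "\<And>i. i \<in> I \<Longrightarrow> \<phi> i \<in> V" "u \<in> V"
  shows "\<exists>c. \<forall>i\<in>I. B (\<lambda>x. u x + (\<Sum>j\<in>I. c j * \<phi> j x)) (\<phi> i) = 0"
  using assms
proof (induction I arbitrary: u rule: finite_induct)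
  case empty
  then show ?case by simp
next
  case (insert m I)
  have m: "\<phi> m \<in> V" and I: "\<And>i. i \<in> I \<Longrightarrow> \<phi> i \<in> V" using insert.prems by auto
  obtain c where c: "\<forall>i\<in>I. B (\<lambda>x. u x + (\<Sum>j\<in>I. c j * \<phi> j x)) (\<phi> i) = 0"
    using insert.IH[of u] I insert.prems by blast
  obtain d where d: "\<forall>i\<in>I. B (\<lambda>x. \<phi> m x + (\<Sum>j\<in>I. d j * \<phi> j x)) (\<phi> i) = 0"
    using insert.IH[of "\<phi> m"] I m by blast
  define w where "w = (\<lambda>x. u x + (\<Sum>j\<in>I. c j * \<phi> j x))"
  define e where "e = (\<lambda>x. \<phi> m x + (\<Sum>j\<in>I. d j * \<phi> j x))"
  have w: "w \<in> V" and wi: "\<And>i. i \<in> I \<Longrightarrow> B w (\<phi> i) = 0"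
    using linear_combination[OF insert.hyps(1) I insert.prems(2)] c by (auto simp: w_def)
  have e: "e \<in> V" and ei: "\<And>i. i \<in> I \<Longrightarrow> B e (\<phi> i) = 0"
    using linear_combination[OF insert.hyps(1) I m] d by (auto simp: e_def)
  define t where "t = - B w e / B e e"
  let ?w' = "\<lambda>x. w x + t * e x"
  have w': "?w' \<in> V" using closed w e by blast
  have zero: "B ?w' e = 0"
    using add[OF w e e, of t] null_vector[OF w e] by (cases "B e e = 0") (auto simp: t_def)
  have w'i: "B ?w' (\<phi> i) = 0" if "i \<in> I" for i
    using add[OF w e I[OF that], of t] wi ei that by simp
  \<comment> \<open>\<open>e\<close> is \<open>\<phi> m\<close> plus old functions, and these are
    orthogonal to the corrected vector already; so orthogonality to \<open>e\<close> amounts to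
    orthogonality to \<open>\<phi> m\<close>.\<close>
  have "B e ?w' = B (\<phi> m) ?w' + (\<Sum>i\<in>I. d i * B (\<phi> i) ?w')"
    using linear_combination[of I \<phi> "\<phi> m" d, OF insert.hyps(1) I m] w' unfolding e_def by blast
  then have w'm: "B ?w' (\<phi> m) = 0"
    using zero w'i sym[OF w'] e m I by (simp add: sum.neutral)
  define c' where "c' = (\<lambda>i. if i = m then t else c i + t * d i)"
  have "?w' = (\<lambda>x. u x + (\<Sum>j\<in>insert m I. c' j * \<phi> j x))"
  proof
    fix x
    have "(\<Sum>j\<in>I. c' j * \<phi> j x) = (\<Sum>j\<in>I. c j * \<phi> j x + t * (d j * \<phi> j x))"
      using insert.hyps by (intro sum.cong) (auto simp: c'_def algebra_simps)
    then show "?w' x = u x + (\<Sum>j\<in>insert m I. c' j * \<phi> j x)"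
      using insert.hyps by (simp add: w_def e_def c'_def sum.distrib sum_distrib_left algebra_simps)
  qed
  then show ?case using w'i w'm by (metis insert_iff)
qed

end

lemma semi_inner_cbox:
  fixes l r :: "'a::euclidean_space"
  assumes "continuous_on (cbox l r) \<rho>" "\<And>z. z \<in> cbox l r \<Longrightarrow> \<rho> z \<ge> 0"
  shows "semi_inner {f. continuous_on (cbox l r) f}
    (\<lambda>f g. integral (cbox l r) (\<lambda>z. \<rho> z * f z * g z :: real))"
proof
  fix f g h :: "'a \<Rightarrow> real" and c
  assume fgh: "f \<in> {f. continuous_on (cbox l r) f}" "g \<in> {f. continuous_on (cbox l r) f}"
    "h \<in> {f. continuous_on (cbox l r) f}"
  have "(\<lambda>z. \<rho> z * f z * h z) integrable_on cbox l r" "(\<lambda>z. \<rho> z * g z * h z) integrable_on cbox l r"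
    using assms fgh by (auto intro!: integrable_continuous continuous_intros)
  then have "integral (cbox l r) (\<lambda>z. \<rho> z * f z * h z + c * (\<rho> z * g z * h z)) =
     integral (cbox l r) (\<lambda>z. \<rho> z * f z * h z) + c * integral (cbox l r) (\<lambda>z. \<rho> z * g z * h z)"
    by (simp add: integral_add integrable_on_mult_right)
  then show "integral (cbox l r) (\<lambda>z. \<rho> z * (f z + c * g z) * h z) =
     integral (cbox l r) (\<lambda>z. \<rho> z * f z * h z) + c * integral (cbox l r) (\<lambda>z. \<rho> z * g z * h z)"
    by (simp add: algebra_simps)
next
  fix f g :: "'a \<Rightarrow> real"
  show "integral (cbox l r) (\<lambda>z. \<rho> z * f z * g z) = integral (cbox l r) (\<lambda>z. \<rho> z * g z * f z)"
    by (simp add: algebra_simps)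
next
  fix f :: "'a \<Rightarrow> real"
  assume "f \<in> {f. continuous_on (cbox l r) f}"
  then show "0 \<le> integral (cbox l r) (\<lambda>z. \<rho> z * f z * f z)"
    using assms by (auto intro!: Henstock_Kurzweil_Integration.integral_nonneg
        integrable_continuous continuous_intros simp: mult.assoc)
qed (auto intro!: continuous_intros)

section \<open>Inverse inequalities\<close>

text \<open>The coefficient of \<open>x ^ i\<close> is controlled by the distance of that monomial
  from the span of the others in the space of square integrable functions. The distance is positive
  because a non-zero polynomial has finitely many roots.\<close>

lemma polyfun_coeff_bound_unit:
  "\<exists>C>0. \<forall>a::nat \<Rightarrow> real. \<forall>i\<le>k. (a i)\<^sup>2 \<le> C * integral {0..1} (\<lambda>x. (\<Sum>j\<le>k. a j * x ^ j)\<^sup>2)"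
proof -
  interpret semi_inner "{f. continuous_on (cbox 0 1) f}"
    "\<lambda>f g. integral (cbox 0 1) (\<lambda>x::real. 1 * f x * g x :: real)"
    by (rule semi_inner_cbox) auto
  have "\<exists>D>0. \<forall>a::nat \<Rightarrow> real. (a i)\<^sup>2 * D \<le> integral {0..1} (\<lambda>x. (\<Sum>j\<le>k. a j * x ^ j)\<^sup>2)"
    if i: "i \<le> k" for i
  proof -
    define J where "J = {..k} - {i}"
    have finJ: "finite J" by (simp add: J_def)
    have k: "{..k} = insert i J" "i \<notin> J" using i by (auto simp: J_def)
    have c0: "(\<lambda>x::real. x ^ j) \<in> {f. continuous_on (cbox 0 1) f}" for j
      by (auto intro!: continuous_intros)
    obtain c where c: "\<forall>m\<in>J. integral (cbox 0 1) (\<lambda>x::real. 1 * (x ^ i + (\<Sum>j\<in>J. c j * x ^ j)) * x ^ m) = 0"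
      using projection[of J "\<lambda>j x. x ^ j" "\<lambda>x. x ^ i", OF finJ c0 c0] by blast
    \<comment> \<open>The component of the monomial orthogonal to the others; \<open>D\<close> below
      is the squared distance.\<close>
    define e where "e = (\<lambda>x::real. x ^ i + (\<Sum>j\<in>J. c j * x ^ j))"
    have e_cont: "continuous_on {0..1} e" unfolding e_def by (intro continuous_intros)
    have orth: "integral {0..1} (\<lambda>x. e x * x ^ m) = 0" if "m \<in> J" for m
      using c that by (simp add: e_def)
    define D where "D = integral {0..1} (\<lambda>x. (e x)\<^sup>2)"
    \<comment> \<open>A zero distance would make a polynomial with coefficient 1 at
      \<open>x ^ i\<close> vanish on the whole interval.\<close>
    have D0: "D \<noteq> 0"
    proof
      assume "D = 0"
      then have z: "\<forall>x\<in>{0..1}. (e x)\<^sup>2 = 0"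
        unfolding D_def using integral_eq_0_iff[of 0 1 "\<lambda>x. (e x)\<^sup>2"] e_cont
        by (auto intro!: continuous_intros)
      define q where "q = (\<lambda>j. if j = i then 1 else c j)"
      have "e x = (\<Sum>j\<le>k. q j * x ^ j)" for x
        unfolding k(1) using k(2) finJ by (auto simp: e_def q_def intro!: sum.cong)
      then have "{0..1} \<subseteq> {x. (\<Sum>j\<le>k. q j * x ^ j) = 0}" using z by auto
      moreover have "infinite {0..1::real}" by (simp add: infinite_Icc)
      ultimately have "\<not> finite {x. (\<Sum>j\<le>k. q j * x ^ j) = 0}" using finite_subset by blast
      then have "q i = 0" using i Transcendental.polyfun_finite_roots by blast
      then show False by (simp add: q_def)
    qed
    moreover have "D \<ge> 0" unfolding D_def
      using e_cont by (intro Henstock_Kurzweil_Integration.integral_nonneg integrable_continuous_real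
          continuous_intros) auto
    ultimately have "D > 0" by simp
    moreover have "(a i)\<^sup>2 * D \<le> integral {0..1} (\<lambda>x. (\<Sum>j\<le>k. a j * x ^ j)\<^sup>2)" for a :: "nat \<Rightarrow> real"
    proof -
      define p where "p = (\<lambda>x::real. \<Sum>j\<le>k. a j * x ^ j)"
      have p_cont: "continuous_on {0..1} p" unfolding p_def by (intro continuous_intros)
      have "integral {0..1} (\<lambda>x. e x * p x) = integral {0..1} (\<lambda>x. \<Sum>j\<le>k. a j * (e x * x ^ j))"
        by (simp add: p_def sum_distrib_left algebra_simps)
      also have "\<dots> = (\<Sum>j\<le>k. a j * integral {0..1} (\<lambda>x. e x * x ^ j))"
        using e_cont by (subst integral_sum)
          (auto intro!: integrable_continuous_real continuous_intros)
      also have "\<dots> = a i * integral {0..1} (\<lambda>x. e x * x ^ i)"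
        unfolding k(1) using k(2) finJ orth by (simp add: sum.neutral)
      also have "integral {0..1} (\<lambda>x. e x * x ^ i) = D"
      proof -
        have "D = integral {0..1} (\<lambda>x. e x * x ^ i + (\<Sum>j\<in>J. c j * (e x * x ^ j)))"
          unfolding D_def
        proof (rule integral_cong)
          fix x :: real
          have "(e x)\<^sup>2 = e x * (x ^ i + (\<Sum>j\<in>J. c j * x ^ j))" by (simp add: e_def power2_eq_square)
          then show "(e x)\<^sup>2 = e x * x ^ i + (\<Sum>j\<in>J. c j * (e x * x ^ j))"
            by (simp add: distrib_left sum_distrib_left mult.left_commute)
        qed
        also have "\<dots> = integral {0..1} (\<lambda>x. e x * x ^ i) + (\<Sum>j\<in>J. c j * integral {0..1} (\<lambda>x. e x * x ^ j))"
        proof -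
          have "(\<lambda>x. e x * x ^ i) integrable_on {0..1}"
            "\<And>j. j \<in> J \<Longrightarrow> (\<lambda>x. c j * (e x * x ^ j)) integrable_on {0..1}"
            by (intro integrable_continuous_real continuous_intros e_cont)+
          then show ?thesis
            using finJ by (simp add: integral_add integral_sum integrable_sum)
        qed
        also have "(\<Sum>j\<in>J. c j * integral {0..1} (\<lambda>x. e x * x ^ j)) = 0"
          using orth by (simp add: sum.neutral)
        finally show ?thesis by simp
      qed
      finally have pe: "integral {0..1} (\<lambda>x. e x * p x) = a i * D" .
      \<comment> \<open>Bessel's inequality for the single direction \<open>e\<close>: the inner
        product of \<open>e\<close> and \<open>p\<close> is \<open>a i * D\<close>, so expanding
        this square gives the claim.\<close>
      have "0 \<le> integral {0..1} (\<lambda>x. (p x - a i * e x)\<^sup>2)"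
        using e_cont p_cont by (intro Henstock_Kurzweil_Integration.integral_nonneg integrable_continuous_real
          continuous_intros) auto
      also have "\<dots> = integral {0..1} (\<lambda>x. (p x)\<^sup>2 + ((a i)\<^sup>2 * (e x)\<^sup>2 - 2 * a i * (e x * p x)))"
        by (rule integral_cong) (simp add: power2_eq_square algebra_simps)
      also have "\<dots> = integral {0..1} (\<lambda>x. (p x)\<^sup>2) + ((a i)\<^sup>2 * D - 2 * a i * (a i * D))"
      proof -
        have "(\<lambda>x. (p x)\<^sup>2) integrable_on {0..1}" "(\<lambda>x. (a i)\<^sup>2 * (e x)\<^sup>2) integrable_on {0..1}"
          "(\<lambda>x. 2 * a i * (e x * p x)) integrable_on {0..1}"
          by (intro integrable_continuous_real continuous_intros e_cont p_cont)+
        then show ?thesis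
          by (simp add: integral_add integral_diff integrable_diff D_def[symmetric] pe)
      qed
      finally show ?thesis unfolding p_def by (simp add: power2_eq_square algebra_simps)
    qed
    ultimately show ?thesis by blast
  qed
  then have "\<forall>i\<in>{..k}. \<exists>D>0. \<forall>a::nat \<Rightarrow> real. (a i)\<^sup>2 * D \<le> integral {0..1} (\<lambda>x. (\<Sum>j\<le>k. a j * x ^ j)\<^sup>2)"
    by blast
  from bchoice[OF this] obtain D where D: "\<And>i. i \<le> k \<Longrightarrow> D i > 0"
    "\<And>i (a :: nat \<Rightarrow> real). i \<le> k \<Longrightarrow> (a i)\<^sup>2 * D i \<le> integral {0..1} (\<lambda>x. (\<Sum>j\<le>k. a j * x ^ j)\<^sup>2)"
    by blast
  define C where "C = (\<Sum>i\<le>k. 1 / D i)"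
  have Ci: "1 / D i \<le> C" if "i \<le> k" for i
    unfolding C_def using D(1) that by (intro member_le_sum) (auto intro!: less_imp_le)
  have "0 < 1 / D 0" using D(1)[of 0] by simp
  then have "C > 0" using Ci[of 0] by linarith
  moreover have "(a i)\<^sup>2 \<le> C * integral {0..1} (\<lambda>x. (\<Sum>j\<le>k. a j * x ^ j)\<^sup>2)" if i: "i \<le> k" for a i
  proof -
    let ?I = "integral {0..1} (\<lambda>x. (\<Sum>j\<le>k. a j * x ^ j)\<^sup>2)"
    have I: "(a i)\<^sup>2 * D i \<le> ?I" using D(2)[OF i, of a] .
    moreover have "0 \<le> (a i)\<^sup>2 * D i" using D(1)[OF i] by simp
    ultimately have "0 \<le> ?I" by linarith
    have "(a i)\<^sup>2 \<le> 1 / D i * ?I" using I D(1)[OF i] by (simp add: field_simps)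
    also have "\<dots> \<le> C * ?I" using Ci[OF i] \<open>0 \<le> ?I\<close> by (rule mult_right_mono)
    finally show ?thesis .
  qed
  ultimately show ?thesis by blast
qed

text \<open>Composition with a polynomial of degree at most one does not raise the degree; working
  with \<open>pcompose\<close> avoids a binomial expansion.\<close>

lemma polyfun_affine:
  fixes a :: "nat \<Rightarrow> real"
  shows "\<exists>d. \<forall>t. (\<Sum>j\<le>k. a j * (l + h * t) ^ j) = (\<Sum>j\<le>k. d j * t ^ j)"
proof -
  define q where "q = (\<Sum>j\<le>k. monom (a j) j)"
  define r where "r = pcompose q [:l, h:]"
  have "degree q \<le> k" unfolding q_def
    by (rule degree_sum_le) (simp_all add: le_trans[OF degree_monom_le])
  moreover have "degree r \<le> degree q * degree [:l, h:]" unfolding r_def by (rule degree_pcompose_le)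
  moreover have "degree [:l, h:] \<le> 1" by simp
  ultimately have deg: "degree r \<le> k"
    using mult_le_mono[of "degree q" k "degree [:l, h:]" 1] by linarith
  have "(\<Sum>j\<le>k. a j * (l + h * t) ^ j) = (\<Sum>j\<le>k. coeff r j * t ^ j)" for t
  proof -
    have "(\<Sum>j\<le>k. a j * (l + h * t) ^ j) = poly r t"
      by (simp add: r_def q_def poly_pcompose poly_sum poly_monom mult.commute)
    also have "\<dots> = (\<Sum>j\<le>k. coeff r j * t ^ j)"
      unfolding poly_altdef using deg by (intro sum.mono_neutral_left) (auto simp: coeff_eq_0)
    finally show ?thesis .
  qed
  then show ?thesis by blast
qed

text \<open>Scaling to the unit interval: the integral contributes \<open>1 / h\<close>, and the
  chain rule adds \<open>1 / h^2\<close> for the squared derivative, hence the third power of the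
  width.\<close>

lemma polyfun_inverse:
  "\<exists>C>0. \<forall>a::nat \<Rightarrow> real. \<forall>l r x. l < r \<longrightarrow> x \<in> {l..r} \<longrightarrow>
     (\<Sum>j\<le>k. a j * x ^ j)\<^sup>2 \<le> C / (r - l) * integral {l..r} (\<lambda>s. (\<Sum>j\<le>k. a j * s ^ j)\<^sup>2) \<and>
     (deriv (\<lambda>s. \<Sum>j\<le>k. a j * s ^ j) x)\<^sup>2
       \<le> C / (r - l) ^ 3 * integral {l..r} (\<lambda>s. (\<Sum>j\<le>k. a j * s ^ j)\<^sup>2)"
proof -
  obtain C :: real where C: "C > 0" "\<And>(a :: nat \<Rightarrow> real) i. i \<le> k \<Longrightarrow> (a i)\<^sup>2 \<le> C * integral {0..1} (\<lambda>x. (\<Sum>j\<le>k. a j * x ^ j)\<^sup>2)"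
    using polyfun_coeff_bound_unit[of k] by blast
  define C' where "C' = (k + 1) ^ 4 * C"
  have "C' > 0" using C by (simp add: C'_def)
  moreover have "(\<Sum>j\<le>k. a j * x ^ j)\<^sup>2 \<le> C' / (r - l) * integral {l..r} (\<lambda>s. (\<Sum>j\<le>k. a j * s ^ j)\<^sup>2)"
    "(deriv (\<lambda>s. \<Sum>j\<le>k. a j * s ^ j) x)\<^sup>2
       \<le> C' / (r - l) ^ 3 * integral {l..r} (\<lambda>s. (\<Sum>j\<le>k. a j * s ^ j)\<^sup>2)"
    if lr: "l < r" and x: "x \<in> {l..r}" for a :: "nat \<Rightarrow> real" and l r x
  proof -
    define h where "h = r - l"
    have h: "h > 0" using lr by (simp add: h_def)
    obtain d where d: "\<And>t. (\<Sum>j\<le>k. a j * (l + h * t) ^ j) = (\<Sum>j\<le>k. d j * t ^ j)"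
      using polyfun_affine[where k = k and a = a and l = l and h = h] by blast
    define p where "p = (\<lambda>s::real. \<Sum>j\<le>k. a j * s ^ j)"
    define I where "I = integral {l..r} (\<lambda>s. (p s)\<^sup>2)"
    define t where "t = (x - l) / h"
    have t: "\<bar>t\<bar> \<le> 1" "x = l + h * t" using x h by (auto simp: t_def h_def)
    have p_d: "p y = (\<Sum>j\<le>k. d j * ((y - l) / h) ^ j)" for y
      using d[of "(y - l) / h"] h by (simp add: p_def)
    have p_cont: "continuous_on S p" for S unfolding p_def by (intro continuous_intros)
    have unit: "0 \<le> h * t" "l + h * t \<le> r" if "0 \<le> t" "t \<le> 1" for t
    proof -
      show "0 \<le> h * t" using that h by simp
      have "h * t \<le> h * 1" using that h by (intro mult_left_mono) auto
      moreover have "r = l + h" by (simp add: h_def)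
      ultimately show "l + h * t \<le> r" by linarith
    qed
    have "((\<lambda>t. h *\<^sub>R (p (l + h * t))\<^sup>2) has_integral (integral {l + h * 0..l + h * 1} (\<lambda>s. (p s)\<^sup>2))) {0..1}"
    proof (intro has_integral_substitution[where c = l and d = r])
      show "(\<lambda>t. l + h * t) ` {0..1} \<subseteq> {l..r}" using unit by auto
      show "continuous_on {l..r} (\<lambda>s. (p s)\<^sup>2)" by (intro continuous_intros p_cont)
      show "((\<lambda>t. l + h * t) has_real_derivative h) (at t within {0..1})" for t
        by (auto intro!: derivative_eq_intros)
    qed (use h in auto)
    then have "integral {0..1} (\<lambda>t. h * (\<Sum>j\<le>k. d j * t ^ j)\<^sup>2) = I"
      unfolding I_def using d by (auto simp: h_def p_def dest!: integral_unique)
    then have I: "integral {0..1} (\<lambda>t. (\<Sum>j\<le>k. d j * t ^ j)\<^sup>2) = I / h"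
      using h by (simp add: field_simps)
    have dj: "(d j)\<^sup>2 \<le> C * (I / h)" if "j \<le> k" for j using C(2)[OF that, of d] I by simp
    \<comment> \<open>Serves values and derivatives alike, \<open>e j\<close> being
      \<open>t ^ j\<close> or \<open>j * t ^ (j - 1)\<close>. The factor \<open>(k + 1) ^ 4\<close>
      collects Cauchy-Schwarz, the number of terms and the bound \<open>(k + 1)^2\<close> for the
      squared \<open>e j\<close>.\<close>
    have key: "(\<Sum>j\<le>k. d j * e j)\<^sup>2 \<le> (k + 1) ^ 4 * C * (I / h)" if e: "\<And>j. j \<le> k \<Longrightarrow> \<bar>e j\<bar> \<le> real k + 1" for e :: "nat \<Rightarrow> real"
    proof -
      have "(\<Sum>j\<le>k. d j * e j)\<^sup>2 \<le> (\<Sum>j\<le>k. (d j * e j)\<^sup>2) * card {..k}"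
        by (rule sum_squared_le_sum_of_squares)
      also have "(\<Sum>j\<le>k. (d j * e j)\<^sup>2) * card {..k} \<le> (\<Sum>j\<le>k. C * (I / h) * (k + 1)\<^sup>2) * card {..k}"
      proof (intro mult_right_mono sum_mono)
        fix j assume "j \<in> {..k}"
        then have j: "j \<le> k" by simp
        have "(e j)\<^sup>2 \<le> (real k + 1)\<^sup>2" using e[OF j] by (simp add: abs_le_square_iff[symmetric])
        then show "(d j * e j)\<^sup>2 \<le> C * (I / h) * (k + 1)\<^sup>2"
          unfolding power_mult_distrib using dj[OF j] order_trans[OF zero_le_power2 dj[OF j]]
          by (intro mult_mono) (auto simp: algebra_simps)
      qed simp
      also have "(\<Sum>j\<le>k. C * (I / h) * (k + 1)\<^sup>2) * card {..k} = (k + 1) ^ 4 * C * (I / h)"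
        using h by (simp add: power2_eq_square power4_eq_xxxx field_simps)
      finally show ?thesis .
    qed
    have "p x = (\<Sum>j\<le>k. d j * t ^ j)" using p_d[of x] by (simp add: t_def)
    moreover have "(\<Sum>j\<le>k. d j * t ^ j)\<^sup>2 \<le> (k + 1) ^ 4 * C * (I / h)"
    proof (rule key)
      show "\<bar>t ^ j\<bar> \<le> real k + 1" for j
        using power_le_one[of "\<bar>t\<bar>" j] t(1) by (simp add: power_abs)
    qed
    ultimately have "(p x)\<^sup>2 \<le> (k + 1) ^ 4 * C * (I / h)" by simp
    then show "(\<Sum>j\<le>k. a j * x ^ j)\<^sup>2 \<le> C' / (r - l) * integral {l..r} (\<lambda>s. (\<Sum>j\<le>k. a j * s ^ j)\<^sup>2)"
      by (simp add: C'_def I_def p_def h_def)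
    have "(p has_real_derivative (\<Sum>j\<le>k. d j * (real j * t ^ (j - 1) / h))) (at x)"
      unfolding t_def ext[of p, OF p_d]
      by (rule derivative_eq_intros DERIV_sum refl | simp add: h)+
        (use h in \<open>auto intro!: sum.cong simp: divide_inverse\<close>)
    then have dp: "deriv p x = (\<Sum>j\<le>k. d j * (real j * t ^ (j - 1))) / h"
      by (simp add: DERIV_imp_deriv sum_divide_distrib)
    have sb: "(\<Sum>j\<le>k. d j * (real j * t ^ (j - 1)))\<^sup>2 \<le> (k + 1) ^ 4 * C * (I / h)"
    proof (rule key)
      fix j assume "j \<le> k"
      then have "\<bar>real j\<bar> * \<bar>t ^ (j - 1)\<bar> \<le> (real k + 1) * 1"
        using power_le_one[of "\<bar>t\<bar>" "j - 1"] t(1) by (intro mult_mono) (auto simp: power_abs)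
      then show "\<bar>real j * t ^ (j - 1)\<bar> \<le> real k + 1" by (simp add: abs_mult)
    qed
    have "(deriv p x)\<^sup>2 \<le> (k + 1) ^ 4 * C * (I / h) / h\<^sup>2"
      unfolding dp power_divide by (rule divide_right_mono[OF sb]) simp
    also have "\<dots> = C' / h ^ 3 * I" using h by (simp add: C'_def power2_eq_square power3_eq_cube)
    finally show "(deriv (\<lambda>s. \<Sum>j\<le>k. a j * s ^ j) x)\<^sup>2
       \<le> C' / (r - l) ^ 3 * integral {l..r} (\<lambda>s. (\<Sum>j\<le>k. a j * s ^ j)\<^sup>2)"
      by (simp add: I_def p_def h_def)
  qed
  ultimately show ?thesis by blast
qed

lemma Qk_slices:
  assumes "Qk k g"
  obtains A D where "\<And>x y. g x y = (\<Sum>a\<le>k. A y a * x ^ a)" "\<And>x y. g x y = (\<Sum>b\<le>k. D x b * y ^ b)"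
proof -
  obtain c where c: "\<And>x y. g x y = (\<Sum>a\<le>k. \<Sum>b\<le>k. c a b * x ^ a * y ^ b)"
    using assms unfolding Qk_def by blast
  show ?thesis
  proof
    fix x y
    show "g x y = (\<Sum>a\<le>k. (\<Sum>b\<le>k. c a b * y ^ b) * x ^ a)"
      unfolding c by (simp only: sum_distrib_right) (simp only: mult_ac)
    show "g x y = (\<Sum>b\<le>k. (\<Sum>a\<le>k. c a b * x ^ a) * y ^ b)"
      unfolding c by (subst sum.swap) (simp only: sum_distrib_right)
  qed
qed

lemma Qk_continuous: "Qk k g \<Longrightarrow> continuous_on S (\<lambda>z. g (fst z) (snd z))"
proof -
  assume "Qk k g"
  then obtain c where c: "\<And>x y. g x y = (\<Sum>a\<le>k. \<Sum>b\<le>k. c a b * x ^ a * y ^ b)"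
    unfolding Qk_def by blast
  show ?thesis unfolding c by (intro continuous_intros)
qed

text \<open>A predicate on the constant, so that one number can be fixed before \<open>eps\<close>,
  \<open>N\<close> and the mesh. The derivative is taken in \<open>x\<close> only; the other
  direction is reached by transposition.\<close>

definition inverse_constant :: "nat \<Rightarrow> real \<Rightarrow> bool" where
  "inverse_constant k C \<longleftrightarrow> C > 0 \<and> (\<forall>g l1 r1 l2 r2 x y. Qk k g \<longrightarrow> l1 < r1 \<longrightarrow> l2 < r2 \<longrightarrow> x \<in> {l1..r1} \<longrightarrow> y \<in> {l2..r2} \<longrightarrow>
     (g x y)\<^sup>2 \<le> C / ((r1 - l1) * (r2 - l2)) * integral (cbox (l1, l2) (r1, r2)) (\<lambda>z. (g (fst z) (snd z))\<^sup>2) \<and>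
     (deriv (\<lambda>s. g s y) x)\<^sup>2
       \<le> C / ((r1 - l1) ^ 3 * (r2 - l2)) * integral (cbox (l1, l2) (r1, r2)) (\<lambda>z. (g (fst z) (snd z))\<^sup>2))"

text \<open>The one-dimensional inequality is applied in \<open>y\<close> on every slice and
  integrated over \<open>x\<close>, then applied in \<open>x\<close>; the constants multiply, which
  gives \<open>C\<^sup>2\<close>.\<close>

lemma inverse_constant_exists: "\<exists>C. inverse_constant k C"
proof -
  obtain C :: real where C: "C > 0" and inv: "\<And>(a :: nat \<Rightarrow> real) l r x. l < r \<Longrightarrow> x \<in> {l..r} \<Longrightarrow>
     (\<Sum>j\<le>k. a j * x ^ j)\<^sup>2 \<le> C / (r - l) * integral {l..r} (\<lambda>s. (\<Sum>j\<le>k. a j * s ^ j)\<^sup>2)"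
    "\<And>(a :: nat \<Rightarrow> real) l r x. l < r \<Longrightarrow> x \<in> {l..r} \<Longrightarrow> (deriv (\<lambda>s. \<Sum>j\<le>k. a j * s ^ j) x)\<^sup>2
       \<le> C / (r - l) ^ 3 * integral {l..r} (\<lambda>s. (\<Sum>j\<le>k. a j * s ^ j)\<^sup>2)"
    using polyfun_inverse[of k] by blast
  have "(g x y)\<^sup>2 \<le> C\<^sup>2 / ((r1 - l1) * (r2 - l2)) * integral (cbox (l1, l2) (r1, r2)) (\<lambda>z. (g (fst z) (snd z))\<^sup>2)"
    "(deriv (\<lambda>s. g s y) x)\<^sup>2
       \<le> C\<^sup>2 / ((r1 - l1) ^ 3 * (r2 - l2)) * integral (cbox (l1, l2) (r1, r2)) (\<lambda>z. (g (fst z) (snd z))\<^sup>2)"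
    if Q: "Qk k g" and lr: "l1 < r1" "l2 < r2" and xy: "x \<in> {l1..r1}" "y \<in> {l2..r2}" for g l1 r1 l2 r2 x y
  proof -
    obtain A D where AD: "\<And>x y. g x y = (\<Sum>a\<le>k. A y a * x ^ a)" "\<And>x y. g x y = (\<Sum>b\<le>k. D x b * y ^ b)"
      using Qk_slices[OF Q] by blast
    define J where "J = integral (cbox (l1, l2) (r1, r2)) (\<lambda>z. (g (fst z) (snd z))\<^sup>2)"
    have contg: "continuous_on S (\<lambda>z. (g (fst z) (snd z))\<^sup>2)" for S
      by (intro continuous_intros Qk_continuous[OF Q])
    have J: "J = integral {l1..r1} (\<lambda>s. integral {l2..r2} (\<lambda>t. (g s t)\<^sup>2))"
      unfolding J_def using integral_prod_continuous[OF contg, of l1 l2 r1 r2] by simp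
    have "(g s y)\<^sup>2 \<le> C / (r2 - l2) * integral {l2..r2} (\<lambda>t. (g s t)\<^sup>2)" for s
      using inv(1)[OF lr(2) xy(2), of "D s"] AD(2) by simp
    then have "integral {l1..r1} (\<lambda>s. (g s y)\<^sup>2) \<le> integral {l1..r1} (\<lambda>s. C / (r2 - l2) * integral {l2..r2} (\<lambda>t. (g s t)\<^sup>2))"
    proof (intro integral_le)
      show "(\<lambda>s. (g s y)\<^sup>2) integrable_on {l1..r1}"
        unfolding AD(1) by (intro integrable_continuous_real continuous_intros)
      show "(\<lambda>s. C / (r2 - l2) * integral {l2..r2} (\<lambda>t. (g s t)\<^sup>2)) integrable_on {l1..r1}"
        using integrable_on_mult_right[OF integral_integrable_2dim[OF contg, of l2 r2 l1 r1], of "C / (r2 - l2)"]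
        by simp
    qed auto
    then have S: "integral {l1..r1} (\<lambda>s. (g s y)\<^sup>2) \<le> C / (r2 - l2) * J"
      unfolding J by simp
    have "(g x y)\<^sup>2 \<le> C / (r1 - l1) * integral {l1..r1} (\<lambda>s. (g s y)\<^sup>2)"
      using inv(1)[OF lr(1) xy(1), of "A y"] AD(1) by simp
    also have "\<dots> \<le> C / (r1 - l1) * (C / (r2 - l2) * J)"
      using S C lr by (intro mult_left_mono) auto
    finally show "(g x y)\<^sup>2 \<le> C\<^sup>2 / ((r1 - l1) * (r2 - l2)) * integral (cbox (l1, l2) (r1, r2)) (\<lambda>z. (g (fst z) (snd z))\<^sup>2)"
      unfolding J_def by (simp add: power2_eq_square)
    have "(deriv (\<lambda>s. g s y) x)\<^sup>2 \<le> C / (r1 - l1) ^ 3 * integral {l1..r1} (\<lambda>s. (g s y)\<^sup>2)"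
      using inv(2)[OF lr(1) xy(1), of "A y"] AD(1) by simp
    also have "\<dots> \<le> C / (r1 - l1) ^ 3 * (C / (r2 - l2) * J)"
      using S C lr by (intro mult_left_mono) auto
    finally show "(deriv (\<lambda>s. g s y) x)\<^sup>2
       \<le> C\<^sup>2 / ((r1 - l1) ^ 3 * (r2 - l2)) * integral (cbox (l1, l2) (r1, r2)) (\<lambda>z. (g (fst z) (snd z))\<^sup>2)"
      unfolding J_def by (simp add: power2_eq_square)
  qed
  moreover have "C\<^sup>2 > 0" using C by simp
  ultimately show ?thesis unfolding inverse_constant_def by blast
qed

section \<open>Approximation by tensor-product polynomials\<close>

lemma Qk_zero: "Qk k (\<lambda>x y. 0)"
  unfolding Qk_def by (intro exI[of _ "\<lambda>a b. 0"]) simp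

lemma Qk_add:
  assumes "Qk k f" "Qk k g"
  shows "Qk k (\<lambda>x y. f x y + g x y)"
proof -
  obtain c d where "\<And>x y. f x y = (\<Sum>a\<le>k. \<Sum>b\<le>k. c a b * x ^ a * y ^ b)"
    "\<And>x y. g x y = (\<Sum>a\<le>k. \<Sum>b\<le>k. d a b * x ^ a * y ^ b)"
    using assms unfolding Qk_def by blast
  then show ?thesis unfolding Qk_def
    by (intro exI[of _ "\<lambda>a b. c a b + d a b"]) (simp add: algebra_simps sum.distrib)
qed

lemma Qk_cmult:
  assumes "Qk k f"
  shows "Qk k (\<lambda>x y. r * f x y)"
proof -
  obtain c where "\<And>x y. f x y = (\<Sum>a\<le>k. \<Sum>b\<le>k. c a b * x ^ a * y ^ b)"
    using assms unfolding Qk_def by blast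
  then show ?thesis unfolding Qk_def
    by (intro exI[of _ "\<lambda>a b. r * c a b"]) (simp add: algebra_simps sum_distrib_left)
qed

lemma Qk_diff: "Qk k f \<Longrightarrow> Qk k g \<Longrightarrow> Qk k (\<lambda>x y. f x y - g x y)"
  using Qk_add[OF _ Qk_cmult[of k g "-1"], of f] by simp

lemma Qk_sum: "finite I \<Longrightarrow> (\<And>i. i \<in> I \<Longrightarrow> Qk k (f i)) \<Longrightarrow> Qk k (\<lambda>x y. \<Sum>i\<in>I. f i x y)"
  by (induction I rule: finite_induct) (auto intro: Qk_zero Qk_add)

lemma Qk_swap:
  assumes "Qk k f"
  shows "Qk k (\<lambda>x y. f y x)"
proof -
  obtain c where c: "\<And>x y. f x y = (\<Sum>a\<le>k. \<Sum>b\<le>k. c a b * x ^ a * y ^ b)"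
    using assms unfolding Qk_def by blast
  show ?thesis unfolding Qk_def c
    by (intro exI[of _ "\<lambda>a b. c b a"] allI, subst sum.swap) (simp add: mult_ac)
qed

lemma Qk_product:
  fixes p q :: "nat \<Rightarrow> real"
  shows "Qk k (\<lambda>x y. (\<Sum>a\<le>k. p a * x ^ a) * (\<Sum>b\<le>k. q b * y ^ b))"
  unfolding Qk_def sum_product by (intro exI[of _ "\<lambda>a b. p a * q b"]) (simp add: mult_ac)

lemma Qk_shifted_monomial:
  assumes "a \<le> k" "b \<le> k"
  shows "Qk k (\<lambda>x y. (x - l1) ^ a * (y - l2) ^ b)"
proof -
  have "\<exists>d. \<forall>t::real. (t - l) ^ a = (\<Sum>j\<le>k. d j * t ^ j)" if "a \<le> k" for a l
  proof -
    have "(\<Sum>j\<le>k. (if j = a then 1 else 0) * (- l + 1 * t) ^ j) = (t - l) ^ a" for t :: real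
    proof -
      have "(\<Sum>j\<le>k. (if j = a then 1 else 0) * (- l + 1 * t) ^ j) = (\<Sum>j\<le>k. if j = a then (t - l) ^ j else 0)"
        by (intro sum.cong) auto
      also have "\<dots> = (t - l) ^ a" using that by simp
      finally show ?thesis .
    qed
    then show ?thesis
      using polyfun_affine[where k = k and a = "\<lambda>j. if j = a then 1 else 0" and l = "- l" and h = 1] by simp
  qed
  then obtain d e where "\<And>t::real. (t - l1) ^ a = (\<Sum>j\<le>k. d j * t ^ j)" "\<And>t::real. (t - l2) ^ b = (\<Sum>j\<le>k. e j * t ^ j)"
    using assms by meson
  then show ?thesis using Qk_product by simp
qed

lemma Qk_has_derivative:
  assumes "Qk k g"
  shows "((\<lambda>s. g s y) has_real_derivative deriv (\<lambda>s. g s y) x) (at x)"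
    and "Qk k (\<lambda>x y. deriv (\<lambda>s. g s y) x)"
proof -
  obtain c where c: "\<And>x y. g x y = (\<Sum>a\<le>k. \<Sum>b\<le>k. c a b * x ^ a * y ^ b)"
    using assms unfolding Qk_def by blast
  have D: "((\<lambda>s. g s y) has_real_derivative (\<Sum>a\<le>k. \<Sum>b\<le>k. c a b * (real a * x ^ (a - 1)) * y ^ b)) (at x)" for x y
    unfolding c by (auto intro!: derivative_eq_intros sum.cong)
  show "((\<lambda>s. g s y) has_real_derivative deriv (\<lambda>s. g s y) x) (at x)"
    unfolding DERIV_imp_deriv[OF D] by (rule D)
  \<comment> \<open>The conditional kills the index \<open>a = k\<close>, where the shifted
    coefficient \<open>c (Suc k)\<close> is arbitrary and does not occur in
    \<open>g\<close>.\<close>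
  have "deriv (\<lambda>s. g s y) x = (\<Sum>a\<le>k. \<Sum>b\<le>k. c (Suc a) b * real (Suc a) * (if a < k then 1 else 0) * x ^ a * y ^ b)" for x y
  proof -
    have "deriv (\<lambda>s. g s y) x = (\<Sum>a\<le>k. \<Sum>b\<le>k. c a b * (real a * x ^ (a - 1)) * y ^ b)"
      using D by (rule DERIV_imp_deriv)
    also have "\<dots> = (\<Sum>a<k. \<Sum>b\<le>k. c (Suc a) b * (real (Suc a) * x ^ a) * y ^ b)"
      by (subst sum.atMost_shift) simp
    also have "\<dots> = (\<Sum>a<k. \<Sum>b\<le>k. c (Suc a) b * real (Suc a) * (if a < k then 1 else 0) * x ^ a * y ^ b)"
      by (intro sum.cong) (auto simp: mult_ac)
    also have "\<dots> = (\<Sum>a\<le>k. \<Sum>b\<le>k. c (Suc a) b * real (Suc a) * (if a < k then 1 else 0) * x ^ a * y ^ b)"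
      by (intro sum.mono_neutral_left) auto
    finally show ?thesis .
  qed
  then show "Qk k (\<lambda>x y. deriv (\<lambda>s. g s y) x)"
    unfolding Qk_def by (intro exI[of _ "\<lambda>a b. c (Suc a) b * real (Suc a) * (if a < k then 1 else 0)"]) simp
qed

text \<open>Abstract projection with the monomials as family; orthogonality to the monomials extends
  to all of \<open>Qk\<close> by linearity in the second argument.\<close>

lemma Qk_projection_exists:
  assumes "continuous_on (cbox l r) \<rho>" "\<And>z. z \<in> cbox l r \<Longrightarrow> \<rho> z \<ge> 0" "continuous_on (cbox l r) u"
  shows "\<exists>v. Qk k v \<and> (\<forall>g. Qk k g \<longrightarrow>
    integral (cbox l r) (\<lambda>z. \<rho> z * (u z - v (fst z) (snd z)) * g (fst z) (snd z)) = 0)"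
proof -
  interpret semi_inner "{f. continuous_on (cbox l r) f}"
    "\<lambda>f g. integral (cbox l r) (\<lambda>z. \<rho> z * f z * g z)"
    by (rule semi_inner_cbox[OF assms(1,2)])
  define I where "I = {..k} \<times> {..k}"
  define \<phi> where "\<phi> = (\<lambda>i (z::real \<times> real). fst z ^ fst i * snd z ^ snd i)" for i :: "nat \<times> nat"
  have I: "finite I" by (simp add: I_def)
  have \<phi>: "\<phi> i \<in> {f. continuous_on (cbox l r) f}" for i
    by (auto simp: \<phi>_def intro!: continuous_intros)
  have u: "u \<in> {f. continuous_on (cbox l r) f}" using assms by simp
  obtain c where c: "\<forall>i\<in>I. integral (cbox l r) (\<lambda>z. \<rho> z * (u z + (\<Sum>j\<in>I. c j * \<phi> j z)) * \<phi> i z) = 0"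
    using projection[of I \<phi> u, OF I \<phi> u] by blast
  \<comment> \<open>\<open>projection\<close> returns \<open>u\<close> plus a combination, so the
    approximant carries the opposite coefficients.\<close>
  define v where "v = (\<lambda>x y. \<Sum>a\<le>k. \<Sum>b\<le>k. - c (a, b) * x ^ a * y ^ b)"
  have v: "Qk k v" unfolding Qk_def v_def by (intro exI[of _ "\<lambda>a b. - c (a, b)"]) simp
  have uv: "u z + (\<Sum>j\<in>I. c j * \<phi> j z) = u z - v (fst z) (snd z)" for z
    unfolding v_def I_def \<phi>_def by (simp add: sum.cartesian_product sum_negf split_beta mult.assoc)
  define w where "w = (\<lambda>z. u z - v (fst z) (snd z))"
  have w: "w \<in> {f. continuous_on (cbox l r) f}"
    unfolding w_def using assms Qk_continuous[OF v] by (auto intro!: continuous_intros)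
  have w\<phi>: "integral (cbox l r) (\<lambda>z. \<rho> z * w z * \<phi> i z) = 0" if "i \<in> I" for i
    using c that unfolding uv w_def by blast
  have "integral (cbox l r) (\<lambda>z. \<rho> z * w z * g (fst z) (snd z)) = 0" if g: "Qk k g" for g
  proof -
    obtain d where d: "\<And>x y. g x y = (\<Sum>a\<le>k. \<Sum>b\<le>k. d a b * x ^ a * y ^ b)"
      using g unfolding Qk_def by blast
    have gI: "g (fst z) (snd z) = 0 + (\<Sum>i\<in>I. d (fst i) (snd i) * \<phi> i z)" for z
      unfolding d I_def \<phi>_def by (simp add: sum.cartesian_product split_beta mult.assoc)
    have z: "(\<lambda>z. 0) \<in> {f. continuous_on (cbox l r) f}" by simp
    have "integral (cbox l r) (\<lambda>z. \<rho> z * (0 + (\<Sum>i\<in>I. d (fst i) (snd i) * \<phi> i z)) * w z) =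
      integral (cbox l r) (\<lambda>z. \<rho> z * 0 * w z) + (\<Sum>i\<in>I. d (fst i) (snd i) * integral (cbox l r) (\<lambda>z. \<rho> z * \<phi> i z * w z))"
      using linear_combination[of I \<phi> "\<lambda>z. 0" "\<lambda>i. d (fst i) (snd i)", OF I \<phi> z] w by blast
    also have "\<dots> = 0" using w\<phi> by (simp add: sum.neutral mult_ac)
    finally show ?thesis unfolding gI by (simp add: mult_ac)
  qed
  then show ?thesis using v unfolding w_def by blast
qed

section \<open>Weighted projections and their stability in the maximum norm\<close>

lemma integral_pair_bounds:
  fixes F :: "real \<times> real \<Rightarrow> real"
  assumes "continuous_on (cbox (l1, l2) (r1, r2)) F" "l1 \<le> r1" "l2 \<le> r2"
    "\<And>x y. x \<in> {l1..r1} \<Longrightarrow> y \<in> {l2..r2} \<Longrightarrow> F (x, y) \<le> B"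
  shows "integral (cbox (l1, l2) (r1, r2)) F \<le> B * ((r1 - l1) * (r2 - l2))"
proof -
  have "integral (cbox (l1, l2) (r1, r2)) F \<le> integral (cbox (l1, l2) (r1, r2)) (\<lambda>z. B)"
    using assms by (intro integral_le integrable_continuous) (auto simp: cbox_Pair_eq)
  also have "\<dots> = B * ((r1 - l1) * (r2 - l2))" using assms by (simp add: content_Pair)
  finally show ?thesis .
qed

text \<open>One and the same \<open>v\<close> must be orthogonal, best in the weighted integral norm
  and near-best in the maximum norm: edge terms need the maximum norm, the balanced norm of
  \<open>p\<close> and \<open>q\<close> needs the integral norm. The constant sees the weight only
  through its bounds and does not see the rectangle.\<close>

definition projection_constant :: "nat \<Rightarrow> real \<Rightarrow> real \<Rightarrow> real \<Rightarrow> bool" where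
  "projection_constant k \<rho>0 \<rho>1 C \<longleftrightarrow> C > 0 \<and> (\<forall>\<rho> u l1 r1 l2 r2. l1 < r1 \<longrightarrow> l2 < r2 \<longrightarrow>
    continuous_on (cbox (l1, l2) (r1, r2)) (\<lambda>z. \<rho> (fst z) (snd z)) \<longrightarrow>
    continuous_on (cbox (l1, l2) (r1, r2)) (\<lambda>z. u (fst z) (snd z)) \<longrightarrow>
    (\<forall>x\<in>{l1..r1}. \<forall>y\<in>{l2..r2}. \<rho>0 \<le> \<rho> x y \<and> \<rho> x y \<le> \<rho>1) \<longrightarrow>
    (\<exists>v. Qk k v \<and>
      (\<forall>g. Qk k g \<longrightarrow> integral (cbox (l1, l2) (r1, r2))
         (\<lambda>z. \<rho> (fst z) (snd z) * (u (fst z) (snd z) - v (fst z) (snd z)) * g (fst z) (snd z)) = 0) \<and>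
      (\<forall>w. Qk k w \<longrightarrow>
        integral (cbox (l1, l2) (r1, r2)) (\<lambda>z. \<rho> (fst z) (snd z) * (u (fst z) (snd z) - v (fst z) (snd z))\<^sup>2) \<le>
        integral (cbox (l1, l2) (r1, r2)) (\<lambda>z. \<rho> (fst z) (snd z) * (u (fst z) (snd z) - w (fst z) (snd z))\<^sup>2)) \<and>
      (\<forall>w \<delta>. Qk k w \<longrightarrow> (\<forall>x\<in>{l1..r1}. \<forall>y\<in>{l2..r2}. \<bar>u x y - w x y\<bar> \<le> \<delta>) \<longrightarrow>
        (\<forall>x\<in>{l1..r1}. \<forall>y\<in>{l2..r2}. \<bar>u x y - v x y\<bar> \<le> C * \<delta>))))"

text \<open>For any competitor \<open>w\<close> the polynomial \<open>v - w\<close> has, by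
  Pythagoras, weighted norm at most that of \<open>u - w\<close>, which is bounded by the maximum
  error times the area. The inverse inequality returns to the maximum norm and divides by the same
  area.\<close>

lemma projection_constant_exists:
  assumes "0 < \<rho>0"
  shows "\<exists>C. projection_constant k \<rho>0 \<rho>1 C"
proof -
  obtain Ci :: real where Ci: "Ci > 0" and inv: "\<And>g l1 r1 l2 r2 x y.
    Qk k g \<Longrightarrow> l1 < r1 \<Longrightarrow> l2 < r2 \<Longrightarrow> x \<in> {l1..r1} \<Longrightarrow> y \<in> {l2..r2} \<Longrightarrow>
     (g x y)\<^sup>2 \<le> Ci / ((r1 - l1) * (r2 - l2)) * integral (cbox (l1, l2) (r1, r2)) (\<lambda>z. (g (fst z) (snd z))\<^sup>2)"
    using inverse_constant_exists[of k] unfolding inverse_constant_def by blast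
  \<comment> \<open>The leading 1 pays for \<open>u - w\<close>, the root for \<open>v - w\<close>.
    The absolute value keeps the root non-negative also when no weight is admissible.\<close>
  define C where "C = 1 + sqrt (Ci * \<bar>\<rho>1\<bar> / \<rho>0)"
  have "C > 0" using Ci assms by (simp add: C_def add_pos_nonneg)
  moreover have "\<exists>v. Qk k v \<and>
      (\<forall>g. Qk k g \<longrightarrow> integral (cbox (l1, l2) (r1, r2))
         (\<lambda>z. \<rho> (fst z) (snd z) * (u (fst z) (snd z) - v (fst z) (snd z)) * g (fst z) (snd z)) = 0) \<and>
      (\<forall>w. Qk k w \<longrightarrow>
        integral (cbox (l1, l2) (r1, r2)) (\<lambda>z. \<rho> (fst z) (snd z) * (u (fst z) (snd z) - v (fst z) (snd z))\<^sup>2) \<le>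
        integral (cbox (l1, l2) (r1, r2)) (\<lambda>z. \<rho> (fst z) (snd z) * (u (fst z) (snd z) - w (fst z) (snd z))\<^sup>2)) \<and>
      (\<forall>w \<delta>. Qk k w \<longrightarrow> (\<forall>x\<in>{l1..r1}. \<forall>y\<in>{l2..r2}. \<bar>u x y - w x y\<bar> \<le> \<delta>) \<longrightarrow>
        (\<forall>x\<in>{l1..r1}. \<forall>y\<in>{l2..r2}. \<bar>u x y - v x y\<bar> \<le> C * \<delta>))"
    if lr: "l1 < r1" "l2 < r2" and cont: "continuous_on (cbox (l1, l2) (r1, r2)) (\<lambda>z. \<rho> (fst z) (snd z))"
      "continuous_on (cbox (l1, l2) (r1, r2)) (\<lambda>z. u (fst z) (snd z))"
      and \<rho>: "\<forall>x\<in>{l1..r1}. \<forall>y\<in>{l2..r2}. \<rho>0 \<le> \<rho> x y \<and> \<rho> x y \<le> \<rho>1" for \<rho> u l1 r1 l2 r2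
  proof -
    let ?K = "cbox (l1, l2) (r1, r2)"
    define \<rho>' where "\<rho>' = (\<lambda>z. \<rho> (fst z) (snd z))"
    define u' where "u' = (\<lambda>z. u (fst z) (snd z))"
    have \<rho>'c: "continuous_on ?K \<rho>'" and u'c: "continuous_on ?K u'"
      using cont by (simp_all add: \<rho>'_def u'_def)
    have \<rho>K: "\<rho>0 \<le> \<rho>' z" "\<rho>' z \<le> \<rho>1" if "z \<in> ?K" for z
      using \<rho> that by (auto simp: \<rho>'_def cbox_Pair_eq)
    have \<rho>0': "0 \<le> \<rho>' z" if "z \<in> ?K" for z using \<rho>K[OF that] assms by simp
    obtain v where v: "Qk k v"
      and orth: "\<And>g. Qk k g \<Longrightarrow> integral ?K (\<lambda>z. \<rho>' z * (u' z - v (fst z) (snd z)) * g (fst z) (snd z)) = 0"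
      using Qk_projection_exists[OF \<rho>'c \<rho>0' u'c, of k] by blast
    have pyth: "integral ?K (\<lambda>z. \<rho>' z * (u' z - w (fst z) (snd z))\<^sup>2) =
       integral ?K (\<lambda>z. \<rho>' z * (u' z - v (fst z) (snd z))\<^sup>2) + integral ?K (\<lambda>z. \<rho>' z * (v (fst z) (snd z) - w (fst z) (snd z))\<^sup>2)"
      if w: "Qk k w" for w
    proof -
      let ?v = "\<lambda>z. v (fst z) (snd z)" and ?w = "\<lambda>z. w (fst z) (snd z)"
      note c = \<rho>'c u'c Qk_continuous[OF v] Qk_continuous[OF w]
      have i: "(\<lambda>z. \<rho>' z * (u' z - ?v z)\<^sup>2) integrable_on ?K"
        "(\<lambda>z. 2 * (\<rho>' z * (u' z - ?v z) * (?v z - ?w z))) integrable_on ?K"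
        "(\<lambda>z. \<rho>' z * (?v z - ?w z)\<^sup>2) integrable_on ?K"
        by (intro integrable_continuous continuous_intros c)+
      have "integral ?K (\<lambda>z. \<rho>' z * (u' z - ?w z)\<^sup>2) = integral ?K (\<lambda>z. \<rho>' z * (u' z - ?v z)\<^sup>2
         + (2 * (\<rho>' z * (u' z - ?v z) * (?v z - ?w z)) + \<rho>' z * (?v z - ?w z)\<^sup>2))"
        by (rule integral_cong) (simp add: power2_eq_square algebra_simps)
      also have "\<dots> = integral ?K (\<lambda>z. \<rho>' z * (u' z - ?v z)\<^sup>2) + integral ?K (\<lambda>z. \<rho>' z * (?v z - ?w z)\<^sup>2)"
        using i orth[OF Qk_diff[OF v w]] by (simp add: integral_add integrable_add)
      finally show ?thesis .
    qed
    have nonneg: "0 \<le> integral ?K (\<lambda>z. \<rho>' z * (g (fst z) (snd z))\<^sup>2)" if "Qk k g" for g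
      using \<rho>0' by (intro Henstock_Kurzweil_Integration.integral_nonneg integrable_continuous continuous_intros \<rho>'c Qk_continuous[OF that]) auto
    have best: "integral ?K (\<lambda>z. \<rho>' z * (u' z - v (fst z) (snd z))\<^sup>2) \<le> integral ?K (\<lambda>z. \<rho>' z * (u' z - w (fst z) (snd z))\<^sup>2)"
      if w: "Qk k w" for w
      using pyth[OF w] nonneg[OF Qk_diff[OF v w]] by simp
    have sup: "\<bar>u x y - v x y\<bar> \<le> C * \<delta>"
      if w: "Qk k w" and \<delta>: "\<forall>x\<in>{l1..r1}. \<forall>y\<in>{l2..r2}. \<bar>u x y - w x y\<bar> \<le> \<delta>" and xy: "x \<in> {l1..r1}" "y \<in> {l2..r2}"
      for w \<delta> x y
    proof -
      let ?A = "(r1 - l1) * (r2 - l2)"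
      have A: "?A > 0" using lr by simp
      have \<delta>0: "\<delta> \<ge> 0" using \<delta> xy by force
      have \<rho>1: "\<rho>1 > 0" using \<rho> xy assms by force
      let ?e = "\<lambda>x y. v x y - w x y"
      have e: "Qk k ?e" using Qk_diff[OF v w] .
      note c = \<rho>'c u'c Qk_continuous[OF e] Qk_continuous[OF w]
      have "\<rho>0 * integral ?K (\<lambda>z. (?e (fst z) (snd z))\<^sup>2) = integral ?K (\<lambda>z. \<rho>0 * (?e (fst z) (snd z))\<^sup>2)"
        by simp
      also have "\<dots> \<le> integral ?K (\<lambda>z. \<rho>' z * (?e (fst z) (snd z))\<^sup>2)"
        using \<rho>K by (intro integral_le integrable_continuous continuous_intros c) (auto intro: mult_right_mono)
      also have "\<dots> \<le> integral ?K (\<lambda>z. \<rho>' z * (u' z - w (fst z) (snd z))\<^sup>2)"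
        unfolding pyth[OF w] using \<rho>0' c(2) Qk_continuous[OF v]
        by (auto intro!: Henstock_Kurzweil_Integration.integral_nonneg integrable_continuous continuous_intros \<rho>'c)
      also have "\<dots> \<le> \<rho>1 * \<delta>\<^sup>2 * ?A"
      proof (rule integral_pair_bounds)
        show "continuous_on ?K (\<lambda>z. \<rho>' z * (u' z - w (fst z) (snd z))\<^sup>2)" by (intro continuous_intros c)
        fix s t assume st: "s \<in> {l1..r1}" "t \<in> {l2..r2}"
        then have "(u s t - w s t)\<^sup>2 \<le> \<delta>\<^sup>2" using \<delta> \<delta>0 by (simp add: abs_le_square_iff[symmetric])
        then show "\<rho>' (s, t) * (u' (s, t) - w (fst (s, t)) (snd (s, t)))\<^sup>2 \<le> \<rho>1 * \<delta>\<^sup>2"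
          using \<rho> st \<rho>1 assms by (auto simp: \<rho>'_def u'_def intro!: mult_mono)
      qed (use lr in auto)
      finally have "integral ?K (\<lambda>z. (?e (fst z) (snd z))\<^sup>2) \<le> \<rho>1 / \<rho>0 * \<delta>\<^sup>2 * ?A"
        using assms by (simp add: field_simps)
      then have "Ci / ?A * integral ?K (\<lambda>z. (?e (fst z) (snd z))\<^sup>2) \<le> Ci / ?A * (\<rho>1 / \<rho>0 * \<delta>\<^sup>2 * ?A)"
        using Ci A by (intro mult_left_mono) auto
      also have "\<dots> = Ci * \<rho>1 / \<rho>0 * \<delta>\<^sup>2" using lr by simp
      finally have "(?e x y)\<^sup>2 \<le> Ci * \<rho>1 / \<rho>0 * \<delta>\<^sup>2" using inv[OF e lr xy] by linarith
      then have "\<bar>?e x y\<bar> \<le> sqrt (Ci * \<rho>1 / \<rho>0 * \<delta>\<^sup>2)" by (rule real_le_rsqrt[of "\<bar>?e x y\<bar>", simplified])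
      also have "\<dots> = sqrt (Ci * \<bar>\<rho>1\<bar> / \<rho>0) * \<delta>" using \<rho>1 \<delta>0 by (subst real_sqrt_mult) simp
      finally have "\<bar>?e x y\<bar> \<le> sqrt (Ci * \<bar>\<rho>1\<bar> / \<rho>0) * \<delta>" .
      moreover have "\<bar>u x y - w x y\<bar> \<le> \<delta>" using \<delta> xy by blast
      ultimately show ?thesis by (simp add: C_def algebra_simps)
    qed
    show ?thesis using v orth best sup unfolding \<rho>'_def u'_def by blast
  qed
  ultimately show ?thesis unfolding projection_constant_def by blast
qed

text \<open>Mixed derivatives are carried along as data instead of being computed by
  \<open>pd\<close>: such families can be summed, shifted by one derivative and transposed without
  reconsidering the choice operator behind \<open>dI\<close>.\<close>

definition smooth_family :: "nat \<Rightarrow> (nat \<Rightarrow> nat \<Rightarrow> real \<Rightarrow> real \<Rightarrow> real) \<Rightarrow> bool" where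
  "smooth_family m D \<longleftrightarrow> (\<forall>i\<le>m. \<forall>j\<le>m. continuous_on sq (\<lambda>z. D i j (fst z) (snd z)) \<and>
     (\<forall>x\<in>{0..1}. \<forall>y\<in>{0..1}.
        (j < m \<longrightarrow> ((\<lambda>t. D i j x t) has_real_derivative D i (Suc j) x y) (at y within {0..1})) \<and>
        (i < m \<longrightarrow> ((\<lambda>s. D i j s y) has_real_derivative D (Suc i) j x y) (at x within {0..1}))))"

lemma smooth_familyD:
  assumes "smooth_family m D"
  shows "i \<le> m \<Longrightarrow> j \<le> m \<Longrightarrow> continuous_on sq (\<lambda>z. D i j (fst z) (snd z))"
    and "i \<le> m \<Longrightarrow> j < m \<Longrightarrow> x \<in> {0..1} \<Longrightarrow> y \<in> {0..1} \<Longrightarrow>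
       ((\<lambda>t. D i j x t) has_real_derivative D i (Suc j) x y) (at y within {0..1})"
    and "i < m \<Longrightarrow> j \<le> m \<Longrightarrow> x \<in> {0..1} \<Longrightarrow> y \<in> {0..1} \<Longrightarrow>
       ((\<lambda>s. D i j s y) has_real_derivative D (Suc i) j x y) (at x within {0..1})"
  using assms unfolding smooth_family_def by auto

lemma smooth_family_swap:
  assumes "smooth_family m D"
  shows "smooth_family m (\<lambda>i j x y. D j i y x)"
proof -
  have "continuous_on sq (\<lambda>z. D j i (snd z) (fst z))" if "i \<le> m" "j \<le> m" for i j
  proof -
    have "prod.swap ` sq \<subseteq> sq" by (auto simp: cbox_Pair_eq)
    from continuous_on_compose2[OF smooth_familyD(1)[OF assms that(2,1)] continuous_on_swap this]
    show ?thesis by simp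
  qed
  then show ?thesis using smooth_familyD(2,3)[OF assms] unfolding smooth_family_def by auto
qed

lemma smooth_family_sum:
  assumes "finite G" "\<And>g. g \<in> G \<Longrightarrow> smooth_family m (D g)"
  shows "smooth_family m (\<lambda>i j x y. \<Sum>g\<in>G. D g i j x y)"
  unfolding smooth_family_def
  by (auto intro!: continuous_on_sum DERIV_sum smooth_familyD[OF assms(2)])

lemma smooth_family_shift:
  assumes "smooth_family (Suc m) D"
  shows "smooth_family m (\<lambda>i j x y. c * D (Suc i) j x y)"
  unfolding smooth_family_def
  by (auto intro!: continuous_on_mult_left DERIV_cmult smooth_familyD[OF assms])

lemma smooth_family_mono:
  assumes "smooth_family m D" "n \<le> m"
  shows "smooth_family n D"
  using assms unfolding smooth_family_def by (auto dest: order.trans intro: order.strict_trans2)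

section \<open>One-sided derivatives on the unit interval and the values of
  \<open>pd\<close>\<close>

lemma within_unit_nontrivial: "x \<in> {0..1} \<Longrightarrow> at x within {0..1::real} \<noteq> bot"
  using islimpt_Icc[of 0 1 x] by (simp add: trivial_limit_within)

lemma has_real_derivative_unique_within:
  assumes "(f has_real_derivative a) (at x within S)" "(f has_real_derivative b) (at x within S)" "at x within S \<noteq> bot"
  shows "a = b"
  using vector_derivative_unique_within[OF assms(3)] assms(1,2)
  by (simp add: has_real_derivative_iff_has_vector_derivative)

text \<open>The definition of \<open>Ck_sq\<close> differentiates in \<open>x\<close> after \<open>y\<close>; the missing
  \<open>y\<close>-derivatives of \<open>pd i j g\<close> with \<open>i > 0\<close> come from differentiating under the integral.\<close>

lemma Ck_sq_smooth_family:
  assumes "Ck_sq m g"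
  shows "smooth_family m (\<lambda>i j. pd i j g)"
proof -
  have cont: "continuous_on sq (\<lambda>z. pd i j g (fst z) (snd z))" if "i \<le> m" "j \<le> m" for i j
    using assms that unfolding Ck_sq_def by blast
  have dx: "((\<lambda>s. pd i j g s y) has_real_derivative pd (Suc i) j g x y) (at x within {0..1})"
    if "i < m" "j \<le> m" "x \<in> {0..1}" "y \<in> {0..1}" for i j x y
    using assms that unfolding Ck_sq_def by (meson less_imp_le)
  have slice: "continuous_on {0..1} (\<lambda>t. pd i j g x t)" if "i \<le> m" "j \<le> m" "x \<in> {0..1}" for i j x
    using that by (intro continuous_on_compose2[OF cont[OF that(1,2)], of "{0..1}" "\<lambda>t. (x, t)", simplified] continuous_intros)
      (auto simp: cbox_Pair_eq)
  have dy: "((\<lambda>t. pd i j g x t) has_real_derivative pd i (Suc j) g x y) (at y within {0..1})"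
    if "i \<le> m" "j < m" "x \<in> {0..1}" "y \<in> {0..1}" for i j x y
    using that
  proof (induction i arbitrary: x y)
    case 0
    then have "((\<lambda>t. pdy j g x t) has_real_derivative pdy (Suc j) g x y) (at y within {0..1})"
      using assms unfolding Ck_sq_def by (meson less_imp_le le0)
    then show ?case by (simp add: pd_def)
  next
    case (Suc i)
    \<comment> \<open>The \<open>x\<close>-derivative of the increment
      \<open>pd i j g s t - pd i j g s 0\<close> is computed twice, directly and under the integral
      sign; uniqueness of the derivative equates the two results. The result is then differentiated
      in \<open>t\<close>.\<close>
    have key: "pd (Suc i) j g x t = pd (Suc i) j g x 0 + integral {0..t} (\<lambda>t. pd (Suc i) (Suc j) g x t)"
      if t: "t \<in> {0..1}" for t
    proof -
      have ftc: "pd i j g s t - pd i j g s 0 = integral (cbox 0 t) (\<lambda>t. pd i (Suc j) g s t)" if s: "s \<in> {0..1}" for s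
      proof -
        have "((\<lambda>t. pd i (Suc j) g s t) has_integral (pd i j g s t - pd i j g s 0)) {0..t}"
        proof (rule fundamental_theorem_of_calculus)
          fix r assume "r \<in> {0..t}"
          then have "((\<lambda>t. pd i j g s t) has_real_derivative pd i (Suc j) g s r) (at r within {0..1})"
            using Suc.IH[of s r] Suc.prems t s by auto
          then show "((\<lambda>t. pd i j g s t) has_vector_derivative pd i (Suc j) g s r) (at r within {0..t})"
            using t by (auto simp: has_real_derivative_iff_has_vector_derivative
                intro: has_vector_derivative_within_subset)
        qed (use t in auto)
        then show ?thesis by (simp add: integral_unique)
      qed
      have "((\<lambda>s. integral (cbox 0 t) (\<lambda>t. pd i (Suc j) g s t)) has_field_derivative
         integral (cbox 0 t) (\<lambda>t. pd (Suc i) (Suc j) g x t)) (at x within {0..1})"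
      proof (rule leibniz_rule_field_derivative)
        fix s r :: real assume "s \<in> {0..1}" "r \<in> cbox 0 t"
        then show "((\<lambda>s. pd i (Suc j) g s r) has_field_derivative pd (Suc i) (Suc j) g s r) (at s within {0..1})"
          using Suc.prems t by (intro dx) auto
      next
        fix s :: real assume "s \<in> {0..1}"
        then show "(\<lambda>t. pd i (Suc j) g s t) integrable_on cbox 0 t"
          using Suc.prems t by (auto intro!: integrable_continuous_real intro: continuous_on_subset[OF slice])
      next
        show "continuous_on ({0..1::real} \<times> cbox 0 t) (\<lambda>(s, t). pd (Suc i) (Suc j) g s t)"
          using Suc.prems t unfolding split_beta
          by (intro continuous_on_subset[OF cont]) (auto simp: cbox_Pair_eq)
      qed (use Suc.prems in auto)
      then have 1: "((\<lambda>s. pd i j g s t - pd i j g s 0) has_real_derivative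
         integral {0..t} (\<lambda>t. pd (Suc i) (Suc j) g x t)) (at x within {0..1})"
        using Suc.prems by (subst has_field_derivative_cong_eventually[where g = "\<lambda>s. integral (cbox 0 t) (\<lambda>t. pd i (Suc j) g s t)"])
          (auto simp: ftc eventually_at_filter)
      have 2: "((\<lambda>s. pd i j g s t - pd i j g s 0) has_real_derivative
         pd (Suc i) j g x t - pd (Suc i) j g x 0) (at x within {0..1})"
        using Suc.prems t by (intro DERIV_diff dx) auto
      show ?thesis
        using has_real_derivative_unique_within[OF 1 2 within_unit_nontrivial] Suc.prems by simp
    qed
    have "((\<lambda>t. pd (Suc i) j g x 0 + integral {0..t} (\<lambda>t. pd (Suc i) (Suc j) g x t)) has_real_derivative
       0 + pd (Suc i) (Suc j) g x y) (at y within {0..1})"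
      using Suc.prems by (intro DERIV_add DERIV_const integral_has_real_derivative slice) auto
    then show ?case
      using Suc.prems by (subst has_field_derivative_cong_eventually
          [where g = "\<lambda>t. pd (Suc i) j g x 0 + integral {0..t} (\<lambda>t. pd (Suc i) (Suc j) g x t)"])
        (auto simp: eventually_at_filter key[symmetric])
  qed
  show ?thesis unfolding smooth_family_def using cont dx dy by blast
qed

text \<open>\<open>dI\<close> selects some derivative within the unit interval. No point of the
  interval is isolated, so the selection is unique, and agreement of the functions on the interval
  suffices.\<close>

lemma dI_eq:
  assumes "\<And>t. t \<in> {0..1} \<Longrightarrow> f t = g t" "(g has_real_derivative D) (at x within {0..1})" "x \<in> {0..1}"
  shows "dI f x = D"
proof -
  have "(f has_real_derivative D) (at x within {0..1})"
    using assms by (subst has_field_derivative_cong_eventually[where g = g]) (auto simp: eventually_at_filter)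
  then show ?thesis unfolding dI_def
    using has_real_derivative_unique_within within_unit_nontrivial[OF assms(3)] by (metis someI)
qed

text \<open>Identifies the derivatives occurring in the equation and in the error norm with sums
  over the components of the decomposition, although \<open>u\<close> is known to equal that sum
  only on the closed square.\<close>

lemma pd_eq_smooth_family:
  assumes D: "smooth_family m D" and u: "\<And>x y. x \<in> {0..1} \<Longrightarrow> y \<in> {0..1} \<Longrightarrow> u x y = D 0 0 x y"
    and "i \<le> m" "j \<le> m" "x \<in> {0..1}" "y \<in> {0..1}"
  shows "pd i j u x y = D i j x y"
proof -
  have pdy: "pdy j u x y = D 0 j x y" if "j \<le> m" "x \<in> {0..1}" "y \<in> {0..1}" for j x y
    using that
  proof (induction j arbitrary: y)
    case 0
    then show ?case using u by (simp add: pdy_def)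
  next
    case (Suc j)
    have "pdy (Suc j) u x y = dI (\<lambda>t. pdy j u x t) y" by (simp add: pdy_def)
    also have "\<dots> = D 0 (Suc j) x y"
      using Suc by (intro dI_eq[where g = "\<lambda>t. D 0 j x t"] smooth_familyD(2)[OF D]) auto
    finally show ?case .
  qed
  show ?thesis using assms(3-6)
  proof (induction i arbitrary: x)
    case 0
    then show ?case using pdy by (simp add: pd_def)
  next
    case (Suc i)
    have "pd (Suc i) j u x y = dI (\<lambda>s. pd i j u s y) x" by (simp add: pd_def)
    also have "\<dots> = D (Suc i) j x y"
      using Suc by (intro dI_eq[where g = "\<lambda>s. D i j s y"] smooth_familyD(3)[OF D]) auto
    finally show ?case .
  qed
qed

text \<open>Taylor expansion in \<open>y\<close> at the lower edge, after which each coefficient is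
  replaced by its Taylor polynomial in \<open>x\<close>. The remainder of the first step gives the
  power in \<open>h2\<close>; the second step gives the sum over \<open>b\<close> times the power in
  \<open>h1\<close>. Each direction keeps its own growth rate, as anisotropic layers demand.\<close>

lemma taylor_Qk:
  assumes D: "smooth_family (Suc k) D"
    and K: "0 \<le> l1" "l1 \<le> r1" "r1 \<le> 1" "0 \<le> l2" "l2 \<le> r2" "r2 \<le> 1"
    and pos: "A \<ge> 0" "\<theta>1 \<ge> 0" "\<theta>2 \<ge> 0"
    and bound: "\<And>i j x y. i \<le> Suc k \<Longrightarrow> j \<le> Suc k \<Longrightarrow> x \<in> {l1..r1} \<Longrightarrow> y \<in> {l2..r2} \<Longrightarrow>
      \<bar>D i j x y\<bar> \<le> A * \<theta>1 ^ i * \<theta>2 ^ j"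
  shows "\<exists>v. Qk k v \<and> (\<forall>x\<in>{l1..r1}. \<forall>y\<in>{l2..r2}. \<bar>D 0 0 x y - v x y\<bar> \<le>
     A * (((r2 - l2) * \<theta>2) ^ Suc k + (\<Sum>b\<le>k. ((r2 - l2) * \<theta>2) ^ b) * ((r1 - l1) * \<theta>1) ^ Suc k))"
proof -
  let ?h1 = "r1 - l1" and ?h2 = "r2 - l2"
  have fact_ge: "(fact n :: real) \<ge> 1" for n by simp
  define v where "v = (\<lambda>x y. \<Sum>b\<le>k. (\<Sum>a\<le>k. D a b l1 l2 * (x - l1) ^ a / fact a) * (y - l2) ^ b / fact b)"
  have "v = (\<lambda>x y. \<Sum>b\<le>k. \<Sum>a\<le>k. (D a b l1 l2 / (fact a * fact b)) * ((x - l1) ^ a * (y - l2) ^ b))"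
    unfolding v_def by (simp only: sum_distrib_right sum_divide_distrib) (simp add: mult_ac)
  moreover have "Qk k (\<lambda>x y. \<Sum>b\<le>k. \<Sum>a\<le>k. (D a b l1 l2 / (fact a * fact b)) * ((x - l1) ^ a * (y - l2) ^ b))"
    by (intro Qk_sum Qk_cmult Qk_shifted_monomial) auto
  ultimately have "Qk k v" by simp
  moreover have "\<bar>D 0 0 x y - v x y\<bar> \<le>
     A * ((?h2 * \<theta>2) ^ Suc k + (\<Sum>b\<le>k. (?h2 * \<theta>2) ^ b) * (?h1 * \<theta>1) ^ Suc k)"
    if xy: "x \<in> {l1..r1}" "y \<in> {l2..r2}" for x y
  proof -
    have "norm (D 0 0 x y - (\<Sum>j\<le>k. D 0 j x l2 * (y - l2) ^ j / fact j))
       \<le> A * \<theta>2 ^ Suc k * norm (y - l2) ^ Suc k / fact k"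
    proof (rule field_Taylor[where S = "{l2..r2}" and f = "\<lambda>j. D 0 j x"])
      fix j t assume "t \<in> {l2..r2}" "j \<le> k"
      then show "((\<lambda>t. D 0 j x t) has_field_derivative D 0 (Suc j) x t) (at t within {l2..r2})"
        using K xy by (intro has_field_derivative_subset[OF smooth_familyD(2)[OF D]]) auto
    next
      fix t assume "t \<in> {l2..r2}"
      then show "norm (D 0 (Suc k) x t) \<le> A * \<theta>2 ^ Suc k"
        using bound[of 0 "Suc k" x t] xy by simp
    qed (use xy K in auto)
    also have "\<dots> \<le> A * \<theta>2 ^ Suc k * ?h2 ^ Suc k / 1"
      using pos xy fact_ge by (intro frac_le mult_left_mono power_mono) (auto intro!: mult_nonneg_nonneg)
    finally have y_err: "\<bar>D 0 0 x y - (\<Sum>j\<le>k. D 0 j x l2 * (y - l2) ^ j / fact j)\<bar> \<le> A * (?h2 * \<theta>2) ^ Suc k"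
      by (simp add: power_mult_distrib mult_ac)
    have x_err: "\<bar>D 0 b x l2 - (\<Sum>a\<le>k. D a b l1 l2 * (x - l1) ^ a / fact a)\<bar> \<le> A * \<theta>2 ^ b * (?h1 * \<theta>1) ^ Suc k"
      if b: "b \<le> k" for b
    proof -
      have "norm (D 0 b x l2 - (\<Sum>a\<le>k. D a b l1 l2 * (x - l1) ^ a / fact a))
         \<le> A * \<theta>1 ^ Suc k * \<theta>2 ^ b * norm (x - l1) ^ Suc k / fact k"
      proof (rule field_Taylor[where S = "{l1..r1}" and f = "\<lambda>a s. D a b s l2"])
        fix a s assume "s \<in> {l1..r1}" "a \<le> k"
        then show "((\<lambda>s. D a b s l2) has_field_derivative D (Suc a) b s l2) (at s within {l1..r1})"
          using K xy b by (intro has_field_derivative_subset[OF smooth_familyD(3)[OF D]]) auto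
      next
        fix s assume "s \<in> {l1..r1}"
        then show "norm (D (Suc k) b s l2) \<le> A * \<theta>1 ^ Suc k * \<theta>2 ^ b"
          using bound[of "Suc k" b s l2] xy b K by simp
      qed (use xy K in auto)
      also have "\<dots> \<le> A * \<theta>1 ^ Suc k * \<theta>2 ^ b * ?h1 ^ Suc k / 1"
        using pos xy fact_ge by (intro frac_le mult_left_mono power_mono) (auto intro!: mult_nonneg_nonneg)
      finally show ?thesis by (simp add: power_mult_distrib mult_ac)
    qed
    have "\<bar>(\<Sum>j\<le>k. D 0 j x l2 * (y - l2) ^ j / fact j) - v x y\<bar> =
       \<bar>\<Sum>b\<le>k. (D 0 b x l2 - (\<Sum>a\<le>k. D a b l1 l2 * (x - l1) ^ a / fact a)) * ((y - l2) ^ b / fact b)\<bar>"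
      unfolding v_def by (simp add: sum_subtractf[symmetric] left_diff_distrib diff_divide_distrib)
    also have "\<dots> \<le> (\<Sum>b\<le>k. A * \<theta>2 ^ b * (?h1 * \<theta>1) ^ Suc k * ?h2 ^ b)"
    proof (intro order.trans[OF sum_abs] sum_mono)
      fix b assume "b \<in> {..k}"
      then have b: "b \<le> k" by simp
      have "\<bar>(y - l2) ^ b / fact b\<bar> \<le> ?h2 ^ b / 1"
        unfolding abs_divide power_abs using xy fact_ge by (intro frac_le power_mono) auto
      then show "\<bar>(D 0 b x l2 - (\<Sum>a\<le>k. D a b l1 l2 * (x - l1) ^ a / fact a)) * ((y - l2) ^ b / fact b)\<bar>
        \<le> A * \<theta>2 ^ b * (?h1 * \<theta>1) ^ Suc k * ?h2 ^ b"
        unfolding abs_mult[of "_ - _"] using x_err[OF b] pos K by (intro mult_mono) auto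
    qed
    also have "\<dots> = A * ((\<Sum>b\<le>k. (?h2 * \<theta>2) ^ b) * (?h1 * \<theta>1) ^ Suc k)"
      by (simp add: sum_distrib_left sum_distrib_right power_mult_distrib mult_ac)
    finally show ?thesis using y_err by (simp add: distrib_left)
  qed
  ultimately show ?thesis by blast
qed

section \<open>Numerical fluxes on a tensor-product mesh\<close>

text \<open>The fluxes in the \<open>y\<close>-direction are those in the \<open>x\<close>-direction of the transposed functions,
  so only the latter are analysed.\<close>

definition tr :: "dgfun \<Rightarrow> dgfun" where
  "tr v = (\<lambda>i j x y. v j i y x)"

lemma VN_tr: "VN k N v \<Longrightarrow> VN k N (tr v)"
  unfolding VN_def tr_def by (auto intro: Qk_swap)

lemma VN_dx: "VN k N v \<Longrightarrow> VN k N (dx v)"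
  unfolding VN_def dx_def by (auto intro: Qk_has_derivative(2))

lemma VN_diff: "VN k N v \<Longrightarrow> VN k N w \<Longrightarrow> VN k N (\<lambda>i j x y. v i j x y - w i j x y)"
  unfolding VN_def by (auto intro: Qk_diff)

lemma tr_dy: "tr (dy v) = dx (tr v)"
  unfolding tr_def dx_def dy_def by simp

lemma jumpH_eq: "jumpH N xs v i j = jumpV N xs (tr v) j i"
  unfolding jumpH_def jumpV_def tr_def by (rule ext) simp

section \<open>Cells, traces and elementwise inner products\<close>

locale dg_mesh =
  fixes N :: nat and xs :: "nat \<Rightarrow> real"
  assumes N1: "N \<ge> 1" and mono: "i \<in> {1..N} \<Longrightarrow> xs (i - 1) < xs i"
    and xs0: "xs 0 = 0" and xsN: "xs N = 1"
begin

definition el :: "nat \<Rightarrow> nat \<Rightarrow> (real \<times> real) set" where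
  "el i j = cbox (xs (i - 1), xs (j - 1)) (xs i, xs j)"

lemma xs_le: "i \<le> j \<Longrightarrow> j \<le> N \<Longrightarrow> xs i \<le> xs j"
proof (induction j)
  case (Suc j)
  then show ?case using mono[of "Suc j"] by (cases "i = Suc j") auto
qed simp

lemma xs_unit: "i \<le> N \<Longrightarrow> xs i \<in> {0..1}"
  using xs_le[of 0 i] xs_le[of i N] xs0 xsN by auto

lemma mem_el: "(x, y) \<in> el i j \<longleftrightarrow> x \<in> {xs (i - 1)..xs i} \<and> y \<in> {xs (j - 1)..xs j}"
  unfolding el_def by (auto simp: cbox_Pair_eq)

lemma el_subset: "i \<in> {1..N} \<Longrightarrow> j \<in> {1..N} \<Longrightarrow> el i j \<subseteq> sq"
proof -
  assume "i \<in> {1..N}" "j \<in> {1..N}"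
  then have "i - 1 \<le> N" "i \<le> N" "j - 1 \<le> N" "j \<le> N" by auto
  then have "0 \<le> xs (i - 1)" "xs i \<le> 1" "0 \<le> xs (j - 1)" "xs j \<le> 1"
    using xs_unit by auto
  then show ?thesis by (auto simp: el_def cbox_Pair_eq)
qed

lemma sum_mesh_widths: "(\<Sum>j\<in>{1..N}. xs j - xs (j - 1)) = 1"
proof -
  have "(\<Sum>j\<in>{1..n}. xs j - xs (j - 1)) = xs n - xs 0" for n by (induction n) auto
  then show ?thesis using xs0 xsN by simp
qed

text \<open>The common class of discrete functions and of the exact solution. Continuity up to the
  boundary of each closed cell makes one-sided traces plain values of the function attached to the
  cell.\<close>

definition cdg :: "dgfun \<Rightarrow> bool" where
  "cdg v \<longleftrightarrow> (\<forall>i\<in>{1..N}. \<forall>j\<in>{1..N}. continuous_on (el i j) (\<lambda>z. v i j (fst z) (snd z)))"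

lemma cdgD: "cdg v \<Longrightarrow> i \<in> {1..N} \<Longrightarrow> j \<in> {1..N} \<Longrightarrow> continuous_on (el i j) (\<lambda>z. v i j (fst z) (snd z))"
  unfolding cdg_def by blast

lemma cdg_VN: "VN k N v \<Longrightarrow> cdg v"
  unfolding cdg_def VN_def by (auto intro: Qk_continuous)

lemma cdg_fun: "continuous_on sq (\<lambda>z. g (fst z) (snd z)) \<Longrightarrow> cdg (\<lambda>i j x y. g x y)"
  unfolding cdg_def using continuous_on_subset el_subset by blast

lemma cdg_diff: "cdg v \<Longrightarrow> cdg w \<Longrightarrow> cdg (\<lambda>i j x y. v i j x y - w i j x y)"
  unfolding cdg_def by (auto intro: continuous_intros)

lemma cdg_add: "cdg v \<Longrightarrow> cdg w \<Longrightarrow> cdg (\<lambda>i j x y. v i j x y + w i j x y)"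
  unfolding cdg_def by (auto intro: continuous_intros)

lemma cdg_mult: "cdg v \<Longrightarrow> cdg w \<Longrightarrow> cdg (\<lambda>i j x y. v i j x y * w i j x y)"
  unfolding cdg_def by (auto intro: continuous_intros)

lemma cdg_const: "cdg (\<lambda>i j x y. c)"
  unfolding cdg_def by simp

lemma el_swap: "prod.swap ` el i j = el j i"
  unfolding el_def by (auto simp: cbox_Pair_eq image_iff)

lemma cdg_tr: "cdg v \<Longrightarrow> cdg (tr v)"
  unfolding cdg_def tr_def
proof safe
  fix i j assume v: "\<forall>i\<in>{1..N}. \<forall>j\<in>{1..N}. continuous_on (el i j) (\<lambda>z. v i j (fst z) (snd z))"
    and ij: "i \<in> {1..N}" "j \<in> {1..N}"
  then have "continuous_on (el j i) (\<lambda>z. v j i (fst z) (snd z))" by blast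
  from continuous_on_compose2[OF this continuous_on_swap, of "el i j"] el_swap[of i j]
  show "continuous_on (el i j) (\<lambda>z. v j i (snd z) (fst z))" by simp
qed

lemma cdg_slice:
  assumes "cdg v" "i \<in> {1..N}" "j \<in> {1..N}" "x \<in> {xs (i - 1)..xs i}"
  shows "continuous_on {xs (j - 1)..xs j} (\<lambda>y. v i j x y)"
proof -
  have "continuous_on {xs (j - 1)..xs j} (\<lambda>y. (x, y))" by (intro continuous_intros)
  moreover have "(\<lambda>y. (x, y)) ` {xs (j - 1)..xs j} \<subseteq> el i j" using assms by (auto simp: mem_el)
  ultimately show ?thesis using continuous_on_compose2[OF cdgD[OF assms(1-3)]] by fastforce
qed

lemma cdg_slice_right: "cdg v \<Longrightarrow> i \<in> {1..N} \<Longrightarrow> j \<in> {1..N} \<Longrightarrow> continuous_on {xs (j - 1)..xs j} (\<lambda>y. v i j (xs i) y)"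
  using mono by (intro cdg_slice) (auto intro: less_imp_le)

lemma cdg_slice_left: "cdg v \<Longrightarrow> i < N \<Longrightarrow> j \<in> {1..N} \<Longrightarrow> continuous_on {xs (j - 1)..xs j} (\<lambda>y. v (Suc i) j (xs i) y)"
  using mono[of "Suc i"] by (intro cdg_slice) (auto intro: less_imp_le)

lemma jumpV_interior:
  "0 < i \<Longrightarrow> i < N \<Longrightarrow> jumpV N xs v i j y = v (Suc i) j (xs i) y - v i j (xs i) y"
  unfolding jumpV_def by simp

lemma jumpV_continuous:
  assumes "cdg v" "i \<le> N" "j \<in> {1..N}"
  shows "continuous_on {xs (j - 1)..xs j} (\<lambda>y. jumpV N xs v i j y)"
proof -
  consider "i = 0" | "i = N" | "0 < i" "i < N" using assms by linarith
  then show ?thesis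
  proof cases
    case 1
    then show ?thesis using cdg_slice_left[OF assms(1) _ assms(3), of 0] N1 by (simp add: jumpV_def)
  next
    case 2
    then show ?thesis using cdg_slice_right[OF assms(1) _ assms(3), of N] N1
      by (auto simp: jumpV_def intro: continuous_intros)
  next
    case 3
    then show ?thesis using cdg_slice_right[OF assms(1) _ assms(3), of i] cdg_slice_left[OF assms(1) _ assms(3), of i]
      by (auto simp: jumpV_def intro: continuous_intros)
  qed
qed

lemma integrable_el:
  assumes "cdg v" "i \<in> {1..N}" "j \<in> {1..N}"
  shows "(\<lambda>z. v i j (fst z) (snd z)) integrable_on el i j"
  unfolding el_def using cdgD[OF assms] by (intro integrable_continuous) (simp add: el_def)

lemma ip_alt: "ip N xs v w = (\<Sum>i\<in>{1..N}. \<Sum>j\<in>{1..N}. integral (el i j) (\<lambda>z. v i j (fst z) (snd z) * w i j (fst z) (snd z)))"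
  unfolding ip_def el_def ..

lemma ip_commute: "ip N xs v w = ip N xs w v"
  unfolding ip_def by (simp add: mult.commute)

lemma ip_cong:
  assumes "\<And>i j x y. i \<in> {1..N} \<Longrightarrow> j \<in> {1..N} \<Longrightarrow> (x, y) \<in> el i j \<Longrightarrow> v i j x y * w i j x y = v' i j x y * w' i j x y"
  shows "ip N xs v w = ip N xs v' w'"
  unfolding ip_alt
proof (intro sum.cong refl integral_cong)
  fix i j z assume "i \<in> {1..N}" "j \<in> {1..N}" "z \<in> el i j"
  then show "v i j (fst z) (snd z) * w i j (fst z) (snd z) = v' i j (fst z) (snd z) * w' i j (fst z) (snd z)"
    using assms[of i j "fst z" "snd z"] by simp
qed

lemma ip_add_left:
  assumes "cdg u" "cdg u'" "cdg v"
  shows "ip N xs (\<lambda>i j x y. u i j x y + u' i j x y) v = ip N xs u v + ip N xs u' v"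
  unfolding ip_alt sum.distrib[symmetric]
  using integrable_el[OF cdg_mult[OF assms(1,3)]] integrable_el[OF cdg_mult[OF assms(2,3)]]
  by (intro sum.cong refl) (simp add: distrib_right integral_add)

lemma ip_cmult_left: "ip N xs (\<lambda>i j x y. c * u i j x y) v = c * ip N xs u v"
  unfolding ip_alt by (simp add: sum_distrib_left mult.assoc)

lemma ip_diff_left:
  assumes "cdg u" "cdg u'" "cdg v"
  shows "ip N xs (\<lambda>i j x y. u i j x y - u' i j x y) v = ip N xs u v - ip N xs u' v"
  unfolding ip_alt sum_subtractf[symmetric]
  using integrable_el[OF cdg_mult[OF assms(1,3)]] integrable_el[OF cdg_mult[OF assms(2,3)]]
  by (intro sum.cong refl) (simp add: left_diff_distrib integral_diff)

lemma ip_mono: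
  assumes "cdg v" "cdg w" "cdg v'" "cdg w'"
    and "\<And>i j x y. i \<in> {1..N} \<Longrightarrow> j \<in> {1..N} \<Longrightarrow> (x, y) \<in> el i j \<Longrightarrow> v i j x y * w i j x y \<le> v' i j x y * w' i j x y"
  shows "ip N xs v w \<le> ip N xs v' w'"
  unfolding ip_alt
proof (intro sum_mono integral_le)
  fix i j z assume "i \<in> {1..N}" "j \<in> {1..N}" "z \<in> el i j"
  then show "v i j (fst z) (snd z) * w i j (fst z) (snd z) \<le> v' i j (fst z) (snd z) * w' i j (fst z) (snd z)"
    using assms(5)[of i j "fst z" "snd z"] by simp
qed (use integrable_el[OF cdg_mult[OF assms(1,2)]] integrable_el[OF cdg_mult[OF assms(3,4)]] in auto)

lemma ip_nonneg:
  assumes "cdg v" "cdg w" "\<And>i j x y. i \<in> {1..N} \<Longrightarrow> j \<in> {1..N} \<Longrightarrow> (x, y) \<in> el i j \<Longrightarrow> 0 \<le> v i j x y * w i j x y"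
  shows "0 \<le> ip N xs v w"
proof -
  have z: "cdg (\<lambda>i j x y. 0)" by (rule cdg_const)
  have "ip N xs (\<lambda>i j x y. 0) (\<lambda>i j x y. 0) \<le> ip N xs v w"
    using assms by (intro ip_mono z) auto
  then show ?thesis by (simp add: ip_alt)
qed

lemma integral_el_tr:
  assumes "continuous_on (el i j) (\<lambda>z. f (fst z) (snd z))"
  shows "integral (el j i) (\<lambda>z. f (snd z) (fst z)) = integral (el i j) (\<lambda>z. f (fst z) (snd z) :: real)"
  using integral_swap_2dim[of "xs (i - 1)" "xs (j - 1)" "xs i" "xs j" f] assms
  unfolding el_def case_prod_unfold by simp

lemma ip_tr:
  assumes "cdg v" "cdg w"
  shows "ip N xs (tr v) (tr w) = ip N xs v w"
proof -
  have "integral (el i j) (\<lambda>z. v j i (snd z) (fst z) * w j i (snd z) (fst z)) =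
     integral (el j i) (\<lambda>z. v j i (fst z) (snd z) * w j i (fst z) (snd z))"
    if "i \<in> {1..N}" "j \<in> {1..N}" for i j
    using integral_el_tr[of j i "\<lambda>x y. v j i x y * w j i x y"] cdgD[OF cdg_mult[OF assms] that(2,1)] by simp
  then have "ip N xs (tr v) (tr w) = (\<Sum>i\<in>{1..N}. \<Sum>j\<in>{1..N}. integral (el j i) (\<lambda>z. v j i (fst z) (snd z) * w j i (fst z) (snd z)))"
    unfolding ip_alt tr_def by (intro sum.cong refl) auto
  also have "\<dots> = ip N xs v w" unfolding ip_alt by (rule sum.swap)
  finally show ?thesis .
qed

section \<open>Edge integrals, fluxes and jump products\<close>

lemma eint_integrable:
  fixes f :: "real \<Rightarrow> real"
  shows "continuous_on {xs (j - 1)..xs j} f \<Longrightarrow> f integrable_on {xs (j - 1)..xs j}"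
  by (rule integrable_continuous_real)

lemma eint_diff:
  "continuous_on {xs (j - 1)..xs j} f \<Longrightarrow> continuous_on {xs (j - 1)..xs j} g \<Longrightarrow>
    eint xs j (\<lambda>y. f y - g y) = eint xs j f - eint xs j g"
  unfolding eint_def by (intro integral_diff eint_integrable)

lemma eint_mono:
  "continuous_on {xs (j - 1)..xs j} f \<Longrightarrow> continuous_on {xs (j - 1)..xs j} g \<Longrightarrow>
   (\<And>y. y \<in> {xs (j - 1)..xs j} \<Longrightarrow> f y \<le> g y) \<Longrightarrow> eint xs j f \<le> eint xs j g"
  unfolding eint_def by (intro integral_le eint_integrable)

lemma eint_const: "j \<in> {1..N} \<Longrightarrow> eint xs j (\<lambda>y. c) = c * (xs j - xs (j - 1))"
  using mono[of j] unfolding eint_def by simp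

lemma eint_cmult: "eint xs j (\<lambda>y. c * f y) = c * eint xs j f"
  unfolding eint_def by simp

lemma eint_add:
  "continuous_on {xs (j - 1)..xs j} f \<Longrightarrow> continuous_on {xs (j - 1)..xs j} g \<Longrightarrow>
    eint xs j (\<lambda>y. f y + g y) = eint xs j f + eint xs j g"
  unfolding eint_def by (intro integral_add eint_integrable)

text \<open>The bounded factor leaves the edge length, and the lengths along one mesh line add up to
  1.\<close>

lemma eint_young:
  assumes "j \<in> {1..N}" "continuous_on {xs (j - 1)..xs j} f" "continuous_on {xs (j - 1)..xs j} g"
    and "\<And>y. y \<in> {xs (j - 1)..xs j} \<Longrightarrow> \<bar>f y\<bar> \<le> \<delta>" "\<gamma> > 0"
  shows "eint xs j (\<lambda>y. f y * g y) \<le> \<delta>\<^sup>2 / (4 * \<gamma>) * (xs j - xs (j - 1)) + \<gamma> * eint xs j (\<lambda>y. g y * g y)"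
proof -
  have "eint xs j (\<lambda>y. f y * g y) \<le> eint xs j (\<lambda>y. \<delta>\<^sup>2 / (4 * \<gamma>) + \<gamma> * (g y * g y))"
  proof (rule eint_mono)
    fix y assume y: "y \<in> {xs (j - 1)..xs j}"
    have "f y * g y \<le> (f y)\<^sup>2 / (4 * \<gamma>) + \<gamma> * (g y)\<^sup>2"
      using young[OF assms(5), of "f y" "g y"] by linarith
    moreover have "(f y)\<^sup>2 \<le> \<delta>\<^sup>2" using assms(4)[OF y] by (simp add: abs_le_square_iff[symmetric])
    ultimately show "f y * g y \<le> \<delta>\<^sup>2 / (4 * \<gamma>) + \<gamma> * (g y * g y)"
      using divide_right_mono[of "(f y)\<^sup>2" "\<delta>\<^sup>2" "4 * \<gamma>"] assms(5) by (simp add: power2_eq_square)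
  qed (use assms in \<open>auto intro!: continuous_intros\<close>)
  also have "\<dots> = \<delta>\<^sup>2 / (4 * \<gamma>) * (xs j - xs (j - 1)) + \<gamma> * eint xs j (\<lambda>y. g y * g y)"
    using assms by (subst eint_add) (auto intro!: continuous_intros simp: eint_const eint_cmult)
  finally show ?thesis .
qed

text \<open>The derivative of the test function is an argument of its own. For a polynomial it is
  \<open>dx\<close>; for the exact solution it comes from a smooth family, since
  \<open>deriv\<close> asks for a two-sided derivative, which is not provided on the boundary of the
  square.\<close>

definition FU :: "dgfun \<Rightarrow> dgfun \<Rightarrow> dgfun \<Rightarrow> real" where
  "FU U S Sx = ip N xs U Sx +
     (\<Sum>j\<in>{1..N}. \<Sum>i\<in>{1..N-1}. eint xs j (\<lambda>y. U i j (xs i) y * jumpV N xs S i j y))"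

definition FP :: "dgfun \<Rightarrow> dgfun \<Rightarrow> dgfun \<Rightarrow> real" where
  "FP P V Vx = ip N xs P Vx +
     (\<Sum>j\<in>{1..N}. (\<Sum>i\<in>{0..N-1}. eint xs j (\<lambda>y. P (Suc i) j (xs i) y * jumpV N xs V i j y))
        - eint xs j (\<lambda>y. P N j (xs N) y * V N j (xs N) y))"

definition JJ :: "dgfun \<Rightarrow> dgfun \<Rightarrow> real" where
  "JJ U V = (\<Sum>j\<in>{1..N}. \<Sum>i\<in>{0..N}. eint xs j (\<lambda>y. jumpV N xs U i j y * jumpV N xs V i j y))"

lemma FU_diff:
  assumes "cdg U" "cdg U'" "cdg S" "cdg Sx"
  shows "FU (\<lambda>i j x y. U i j x y - U' i j x y) S Sx = FU U S Sx - FU U' S Sx"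
proof -
  have "eint xs j (\<lambda>y. (U i j (xs i) y - U' i j (xs i) y) * jumpV N xs S i j y) =
     eint xs j (\<lambda>y. U i j (xs i) y * jumpV N xs S i j y) - eint xs j (\<lambda>y. U' i j (xs i) y * jumpV N xs S i j y)"
    if "i \<in> {1..N-1}" "j \<in> {1..N}" for i j
    using that unfolding left_diff_distrib
    by (intro eint_diff continuous_on_mult cdg_slice_right[OF assms(1)] cdg_slice_right[OF assms(2)]
        jumpV_continuous[OF assms(3)]) auto
  then show ?thesis unfolding FU_def ip_diff_left[OF assms(1,2,4)] by (simp add: sum_subtractf)
qed

lemma FP_diff:
  assumes "cdg P" "cdg P'" "cdg V" "cdg Vx"
  shows "FP (\<lambda>i j x y. P i j x y - P' i j x y) V Vx = FP P V Vx - FP P' V Vx"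
proof -
  have 1: "eint xs j (\<lambda>y. (P (Suc i) j (xs i) y - P' (Suc i) j (xs i) y) * jumpV N xs V i j y) =
     eint xs j (\<lambda>y. P (Suc i) j (xs i) y * jumpV N xs V i j y) - eint xs j (\<lambda>y. P' (Suc i) j (xs i) y * jumpV N xs V i j y)"
    if "i \<in> {0..N-1}" "j \<in> {1..N}" for i j
    using that N1 unfolding left_diff_distrib
    by (intro eint_diff continuous_on_mult cdg_slice_left[OF assms(1)] cdg_slice_left[OF assms(2)]
        jumpV_continuous[OF assms(3)]) auto
  have 2: "eint xs j (\<lambda>y. (P N j (xs N) y - P' N j (xs N) y) * V N j (xs N) y) =
     eint xs j (\<lambda>y. P N j (xs N) y * V N j (xs N) y) - eint xs j (\<lambda>y. P' N j (xs N) y * V N j (xs N) y)"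
    if "j \<in> {1..N}" for j
    using that N1 unfolding left_diff_distrib
    by (intro eint_diff continuous_on_mult cdg_slice_right[OF assms(1)] cdg_slice_right[OF assms(2)]
        cdg_slice_right[OF assms(3)]) auto
  show ?thesis unfolding FP_def ip_diff_left[OF assms(1,2,4)] using 1 2 by (simp add: sum_subtractf)
qed

lemma jumpV_diff:
  "jumpV N xs (\<lambda>i j x y. U i j x y - U' i j x y) i j y = jumpV N xs U i j y - jumpV N xs U' i j y"
  unfolding jumpV_def by simp

lemma JJ_diff:
  assumes "cdg U" "cdg U'" "cdg V"
  shows "JJ (\<lambda>i j x y. U i j x y - U' i j x y) V = JJ U V - JJ U' V"
proof -
  have "eint xs j (\<lambda>y. (jumpV N xs U i j y - jumpV N xs U' i j y) * jumpV N xs V i j y) =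
     eint xs j (\<lambda>y. jumpV N xs U i j y * jumpV N xs V i j y) - eint xs j (\<lambda>y. jumpV N xs U' i j y * jumpV N xs V i j y)"
    if "i \<in> {0..N}" "j \<in> {1..N}" for i j
    using that unfolding left_diff_distrib
    by (intro eint_diff continuous_on_mult jumpV_continuous[OF assms(1)] jumpV_continuous[OF assms(2)]
        jumpV_continuous[OF assms(3)]) auto
  then show ?thesis unfolding JJ_def jumpV_diff by (simp add: sum_subtractf)
qed

lemma JJ_nonneg:
  assumes "cdg U"
  shows "0 \<le> JJ U U"
  unfolding JJ_def eint_def
  by (intro sum_nonneg Henstock_Kurzweil_Integration.integral_nonneg eint_integrable continuous_on_mult
      jumpV_continuous[OF assms]) auto

lemma JJ_diff_square:
  assumes "cdg U" "cdg V"
  shows "JJ (\<lambda>i j x y. U i j x y - V i j x y) (\<lambda>i j x y. U i j x y - V i j x y) \<le> 2 * JJ U U + 2 * JJ V V"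
proof -
  have "eint xs j (\<lambda>y. (jumpV N xs U i j y - jumpV N xs V i j y) * (jumpV N xs U i j y - jumpV N xs V i j y)) \<le>
     2 * eint xs j (\<lambda>y. jumpV N xs U i j y * jumpV N xs U i j y) + 2 * eint xs j (\<lambda>y. jumpV N xs V i j y * jumpV N xs V i j y)"
    if ij: "i \<in> {0..N}" "j \<in> {1..N}" for i j
  proof -
    note c = jumpV_continuous[OF assms(1), of i j] jumpV_continuous[OF assms(2), of i j]
    have "eint xs j (\<lambda>y. (jumpV N xs U i j y - jumpV N xs V i j y) * (jumpV N xs U i j y - jumpV N xs V i j y)) \<le>
       eint xs j (\<lambda>y. 2 * (jumpV N xs U i j y * jumpV N xs U i j y) + 2 * (jumpV N xs V i j y * jumpV N xs V i j y))"
      using c ij square_diff_le by (intro eint_mono) (auto intro!: continuous_intros simp: power2_eq_square)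
    also have "\<dots> = 2 * eint xs j (\<lambda>y. jumpV N xs U i j y * jumpV N xs U i j y) + 2 * eint xs j (\<lambda>y. jumpV N xs V i j y * jumpV N xs V i j y)"
      using c ij by (subst eint_add) (auto intro!: continuous_intros simp: eint_cmult)
    finally show ?thesis .
  qed
  then show ?thesis unfolding JJ_def jumpV_diff sum_distrib_left sum.distrib[symmetric]
    by (intro sum_mono) auto
qed

lemma ip_diff_square:
  assumes "cdg U" "cdg V" "cdg w" "\<And>i j x y. i \<in> {1..N} \<Longrightarrow> j \<in> {1..N} \<Longrightarrow> (x, y) \<in> el i j \<Longrightarrow> 0 \<le> w i j x y"
  shows "ip N xs (\<lambda>i j x y. w i j x y * (U i j x y - V i j x y)) (\<lambda>i j x y. U i j x y - V i j x y) \<le>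
     2 * ip N xs (\<lambda>i j x y. w i j x y * U i j x y) U + 2 * ip N xs (\<lambda>i j x y. w i j x y * V i j x y) V"
proof -
  have o: "cdg (\<lambda>i j x y. 1)" by (rule cdg_const)
  have UU: "cdg (\<lambda>i j x y. 2 * (w i j x y * U i j x y * U i j x y))"
    and VV: "cdg (\<lambda>i j x y. 2 * (w i j x y * V i j x y * V i j x y))"
    by (intro cdg_mult cdg_const assms)+
  have "ip N xs (\<lambda>i j x y. w i j x y * (U i j x y - V i j x y)) (\<lambda>i j x y. U i j x y - V i j x y) \<le>
    ip N xs (\<lambda>i j x y. 2 * (w i j x y * U i j x y * U i j x y) + 2 * (w i j x y * V i j x y * V i j x y)) (\<lambda>i j x y. 1)"
  proof (rule ip_mono)
    fix i j x y assume "i \<in> {1..N}" "j \<in> {1..N}" "(x, y) \<in> el i j"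
    then have "w i j x y * (U i j x y - V i j x y)\<^sup>2 \<le> w i j x y * (2 * (U i j x y)\<^sup>2 + 2 * (V i j x y)\<^sup>2)"
      using assms(4) square_diff_le by (intro mult_left_mono) auto
    then show "w i j x y * (U i j x y - V i j x y) * (U i j x y - V i j x y) \<le>
       (2 * (w i j x y * U i j x y * U i j x y) + 2 * (w i j x y * V i j x y * V i j x y)) * 1"
      by (simp add: power2_eq_square algebra_simps)
  qed (intro cdg_mult cdg_diff cdg_add UU VV assms o)+
  also have "\<dots> = ip N xs (\<lambda>i j x y. 2 * (w i j x y * U i j x y * U i j x y)) (\<lambda>i j x y. 1) +
     ip N xs (\<lambda>i j x y. 2 * (w i j x y * V i j x y * V i j x y)) (\<lambda>i j x y. 1)"
    by (rule ip_add_left[OF UU VV o])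
  also have "\<dots> = 2 * ip N xs (\<lambda>i j x y. w i j x y * U i j x y) U + 2 * ip N xs (\<lambda>i j x y. w i j x y * V i j x y) V"
    unfolding ip_cmult_left by (simp add: ip_alt)
  finally show ?thesis .
qed

text \<open>The derivative within the closed interval covers both the polynomials and the exact
  solution, which is differentiable only from inside the square.\<close>

definition has_dx :: "dgfun \<Rightarrow> dgfun \<Rightarrow> bool" where
  "has_dx U Ux \<longleftrightarrow> (\<forall>i\<in>{1..N}. \<forall>j\<in>{1..N}. \<forall>x\<in>{xs (i - 1)..xs i}. \<forall>y\<in>{xs (j - 1)..xs j}.
     ((\<lambda>s. U i j s y) has_real_derivative Ux i j x y) (at x within {xs (i - 1)..xs i}))"

lemma has_dx_VN: "VN k N v \<Longrightarrow> has_dx v (dx v)"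
  unfolding has_dx_def VN_def dx_def by (auto intro: has_field_derivative_at_within Qk_has_derivative(1))

lemma integration_by_parts:
  assumes "cdg U" "cdg Ux" "has_dx U Ux" "i \<in> {1..N}" "j \<in> {1..N}"
  shows "integral (el i j) (\<lambda>z. Ux i j (fst z) (snd z)) = eint xs j (\<lambda>y. U i j (xs i) y) - eint xs j (\<lambda>y. U i j (xs (i - 1)) y)"
proof -
  let ?I = "{xs (i - 1)..xs i}" and ?J = "{xs (j - 1)..xs j}"
  have c: "continuous_on (cbox (xs (i - 1), xs (j - 1)) (xs i, xs j)) (\<lambda>z. Ux i j (fst z) (snd z))"
    using cdgD[OF assms(2,4,5)] by (simp add: el_def)
  have le: "xs (i - 1) \<le> xs i" using mono assms(4) less_imp_le by blast
  have "integral (el i j) (\<lambda>z. Ux i j (fst z) (snd z)) = integral ?I (\<lambda>x. integral ?J (\<lambda>y. Ux i j x y))"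
    unfolding el_def using integral_prod_continuous[OF c] by simp
  also have "\<dots> = integral ?J (\<lambda>y. integral ?I (\<lambda>x. Ux i j x y))"
    using integral_swap_continuous[of "xs (i - 1)" "xs (j - 1)" "xs i" "xs j" "Ux i j"] c by (simp add: split_beta)
  also have "\<dots> = integral ?J (\<lambda>y. U i j (xs i) y - U i j (xs (i - 1)) y)"
  proof (rule integral_cong)
    fix y assume y: "y \<in> ?J"
    have "((\<lambda>x. Ux i j x y) has_integral (U i j (xs i) y - U i j (xs (i - 1)) y)) ?I"
      using assms(3-5) y unfolding has_dx_def
      by (intro fundamental_theorem_of_calculus le) (auto simp: has_real_derivative_iff_has_vector_derivative)
    then show "integral ?I (\<lambda>x. Ux i j x y) = U i j (xs i) y - U i j (xs (i - 1)) y"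
      by (rule integral_unique)
  qed
  also have "\<dots> = eint xs j (\<lambda>y. U i j (xs i) y) - eint xs j (\<lambda>y. U i j (xs (i - 1)) y)"
    using le unfolding eint_def by (intro integral_diff eint_integrable cdg_slice[OF assms(1,4,5)]) auto
  finally show ?thesis .
qed

text \<open>The alternating choice of the traces makes the two fluxes adjoint to each other: after
  integrating by parts on each element, all edge terms cancel.\<close>

lemma flux_adjoint:
  assumes U: "cdg U" "cdg Ux" "has_dx U Ux" and P: "cdg P" "cdg Px" "has_dx P Px"
  shows "FU U P Px + FP P U Ux = 0"
proof -
  \<comment> \<open>The two letters name the sides of the traces of \<open>U\<close> and of
    \<open>P\<close> at the line \<open>xs i\<close>, with \<open>m\<close> for the left and
    \<open>p\<close> for the right cell.\<close>
  define mm where "mm = (\<lambda>i j. eint xs j (\<lambda>y. U i j (xs i) y * P i j (xs i) y))"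
  define pp where "pp = (\<lambda>i j. eint xs j (\<lambda>y. U (Suc i) j (xs i) y * P (Suc i) j (xs i) y))"
  define mp where "mp = (\<lambda>i j. eint xs j (\<lambda>y. U i j (xs i) y * P (Suc i) j (xs i) y))"
  have parts: "integral (el i j) (\<lambda>z. U i j (fst z) (snd z) * Px i j (fst z) (snd z)) +
     integral (el i j) (\<lambda>z. P i j (fst z) (snd z) * Ux i j (fst z) (snd z)) = mm i j - pp (i - 1) j"
    if ij: "i \<in> {1..N}" "j \<in> {1..N}" for i j
  proof -
    have "has_dx (\<lambda>i j x y. U i j x y * P i j x y) (\<lambda>i j x y. U i j x y * Px i j x y + P i j x y * Ux i j x y)"
      unfolding has_dx_def
    proof safe
      fix i j x y assume "i \<in> {1..N}" "j \<in> {1..N}" "x \<in> {xs (i - 1)..xs i}" "y \<in> {xs (j - 1)..xs j}"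
      then have "((\<lambda>s. U i j s y) has_real_derivative Ux i j x y) (at x within {xs (i - 1)..xs i})"
        "((\<lambda>s. P i j s y) has_real_derivative Px i j x y) (at x within {xs (i - 1)..xs i})"
        using U(3) P(3) unfolding has_dx_def by blast+
      from DERIV_mult'[OF this]
      show "((\<lambda>s. U i j s y * P i j s y) has_real_derivative U i j x y * Px i j x y + P i j x y * Ux i j x y)
        (at x within {xs (i - 1)..xs i})" by (simp add: mult.commute)
    qed
    from integration_by_parts[OF cdg_mult[OF U(1) P(1)] cdg_add[OF cdg_mult[OF U(1) P(2)] cdg_mult[OF P(1) U(2)]] this ij]
    have "integral (el i j) (\<lambda>z. U i j (fst z) (snd z) * Px i j (fst z) (snd z) + P i j (fst z) (snd z) * Ux i j (fst z) (snd z))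
      = mm i j - pp (i - 1) j"
      using ij by (simp add: mm_def pp_def)
    then show ?thesis
      using integrable_el[OF cdg_mult[OF U(1) P(2)] ij] integrable_el[OF cdg_mult[OF P(1) U(2)] ij]
      by (simp add: integral_add)
  qed
  have "ip N xs U Px + ip N xs P Ux = (\<Sum>i\<in>{1..N}. \<Sum>j\<in>{1..N}. mm i j - pp (i - 1) j)"
    unfolding ip_alt sum.distrib[symmetric] using parts by (intro sum.cong refl) auto
  also have "\<dots> = (\<Sum>j\<in>{1..N}. \<Sum>i\<in>{1..N}. mm i j - pp (i - 1) j)" by (rule sum.swap)
  finally have ips: "ip N xs U Px + ip N xs P Ux = (\<Sum>j\<in>{1..N}. \<Sum>i\<in>{1..N}. mm i j - pp (i - 1) j)" .
  have e1: "eint xs j (\<lambda>y. U i j (xs i) y * jumpV N xs P i j y) = mp i j - mm i j" if "i \<in> {1..N-1}" "j \<in> {1..N}" for i j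
  proof -
    have i: "0 < i" "i < N" "i \<in> {1..N}" using that by auto
    show ?thesis unfolding mp_def mm_def jumpV_interior[OF i(1,2)] right_diff_distrib
      by (intro eint_diff continuous_on_mult cdg_slice_right[OF U(1)] cdg_slice_right[OF P(1)]
          cdg_slice_left[OF U(1)] cdg_slice_left[OF P(1)] i that)
  qed
  have e2: "eint xs j (\<lambda>y. P (Suc i) j (xs i) y * jumpV N xs U i j y) = pp i j - mp i j" if "i \<in> {1..N-1}" "j \<in> {1..N}" for i j
  proof -
    have i: "0 < i" "i < N" "i \<in> {1..N}" using that by auto
    show ?thesis unfolding mp_def pp_def jumpV_interior[OF i(1,2)] right_diff_distrib mult.commute[of "P _ _ _ _"]
      by (intro eint_diff continuous_on_mult cdg_slice_right[OF U(1)] cdg_slice_right[OF P(1)]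
          cdg_slice_left[OF U(1)] cdg_slice_left[OF P(1)] i that)
  qed
  have e3: "eint xs j (\<lambda>y. P (Suc 0) j (xs 0) y * jumpV N xs U 0 j y) = pp 0 j" for j
    by (simp add: jumpV_def pp_def mult.commute)
  have e4: "eint xs j (\<lambda>y. P N j (xs N) y * U N j (xs N) y) = mm N j" for j
    by (simp add: mm_def mult.commute)
  obtain n where n: "N = Suc n" using N1 by (cases N) auto
  \<comment> \<open>The terms \<open>pp 0\<close> and \<open>mm N\<close> left by integration by
    parts are precisely the two boundary contributions of \<open>FP\<close>.\<close>
  have tele: "(\<Sum>i\<in>{1..N}. mm i j - pp (i - 1) j) + (\<Sum>i\<in>{1..N-1}. mp i j - mm i j) +
     (pp 0 j + (\<Sum>i\<in>{1..N-1}. pp i j - mp i j) - mm N j) = 0" for j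
  proof -
    have "(\<Sum>i\<in>{1..N}. mm i j) = (\<Sum>i\<in>{1..n}. mm i j) + mm N j" by (simp add: n)
    moreover have "(\<Sum>i\<in>{1..N}. pp (i - 1) j) = pp 0 j + (\<Sum>i\<in>{1..n}. pp i j)"
    proof -
      have "(\<Sum>i\<in>{1..N}. pp (i - 1) j) = (\<Sum>i\<in>{0..n}. pp i j)"
        unfolding n using sum.shift_bounds_cl_Suc_ivl[of "\<lambda>i. pp (i - 1) j" 0 n] by simp
      then show ?thesis by (simp add: sum.atLeast_Suc_atMost)
    qed
    ultimately show ?thesis by (simp add: sum_subtractf n)
  qed
  have FPsum: "(\<Sum>i\<in>{0..N-1}. eint xs j (\<lambda>y. P (Suc i) j (xs i) y * jumpV N xs U i j y)) = pp 0 j + (\<Sum>i\<in>{1..N-1}. pp i j - mp i j)"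
    if "j \<in> {1..N}" for j
    using e2 e3[of j] that by (simp add: sum.atLeast_Suc_atMost)
  have "FU U P Px + FP P U Ux = (\<Sum>j\<in>{1..N}. (\<Sum>i\<in>{1..N}. mm i j - pp (i - 1) j) + (\<Sum>i\<in>{1..N-1}. mp i j - mm i j) +
     (pp 0 j + (\<Sum>i\<in>{1..N-1}. pp i j - mp i j) - mm N j))"
    unfolding FU_def FP_def using ips e1 FPsum e4 by (simp add: sum.distrib sum_subtractf)
  then show ?thesis using tele by simp
qed

lemma ldgB_eq:
  assumes "cdg U" "cdg Q" "VN k N v" "VN k N r"
  shows "ldgB eps lam b N xs U P Q v s r = ip N xs P s / eps + ip N xs Q r / eps + ip N xs (\<lambda>i j x y. b x y * U i j x y) v
     + FU U s (dx s) + FU (tr U) (tr r) (dx (tr r)) + FP P v (dx v) + FP (tr Q) (tr v) (dx (tr v))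
     + lam * (JJ U v + JJ (tr U) (tr v))"
proof -
  have dyip: "ip N xs W (dy g) = ip N xs (tr W) (dx (tr g))" if "cdg W" "VN k N g" for W g
  proof -
    have "cdg (tr (tr (dy g)))" unfolding tr_dy using that(2) by (intro cdg_tr cdg_VN VN_dx VN_tr)
    then have "cdg (dy g)" by (simp add: tr_def)
    then show ?thesis using ip_tr[OF that(1)] by (simp add: tr_dy[symmetric])
  qed
  show ?thesis
    unfolding ldgB_def Let_def FU_def FP_def JJ_def jumpH_eq dyip[OF assms(1,4)] dyip[OF assms(2,3)]
    unfolding tr_def mult.assoc[of lam] eint_cmult sum_distrib_left[symmetric]
    by (simp add: distrib_left)
qed

end

section \<open>Bounds for the fluxes and jumps of a projection error\<close>

context dg_mesh
begin

text \<open>Here neither orthogonality nor the stabilisation helps, so traces and derivatives of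
  \<open>s\<close> are traded for its integral norm by the inverse inequality. Each of the
  \<open>N\<close> columns contributes at most a multiple of \<open>\<delta>\<^sup>2 / hm\<close>,
  because the cell heights add up to 1.\<close>

lemma FU_bound:
  assumes C: "inverse_constant k C" and \<eta>: "cdg \<eta>" and s: "VN k N s"
    and hm: "0 < hm" "\<And>i. i \<in> {1..N} \<Longrightarrow> hm \<le> xs i - xs (i - 1)" and \<gamma>: "0 < \<gamma>"
    and \<delta>: "\<And>i j x y. i \<in> {1..N} \<Longrightarrow> j \<in> {1..N} \<Longrightarrow> (x, y) \<in> el i j \<Longrightarrow> \<bar>\<eta> i j x y\<bar> \<le> \<delta>"
  shows "FU \<eta> s (dx s) \<le> 9 * C * \<delta>\<^sup>2 * N / (4 * \<gamma> * hm) + \<gamma> * ip N xs s s"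
proof -
  \<comment> \<open>Three contributions share \<open>\<gamma>\<close>: the volume term and the
    traces of \<open>s\<close> from either side of an edge. With three terms of size
    \<open>N * X\<close> this makes the factor 9.\<close>
  define g where "g = \<gamma> / 3"
  have g: "g > 0" using \<gamma> by (simp add: g_def)
  have C0: "C > 0" using C unfolding inverse_constant_def by blast
  define h where "h = (\<lambda>i. xs i - xs (i - 1))"
  have h: "h i > 0" "hm \<le> h i" if "i \<in> {1..N}" for i
    using mono[OF that] hm(2)[OF that] by (simp_all add: h_def)
  define \<sigma> where "\<sigma> = (\<lambda>i j. integral (el i j) (\<lambda>z. s i j (fst z) (snd z) * s i j (fst z) (snd z)))"
  define X where "X = C * \<delta>\<^sup>2 / (4 * g * hm)"
  have cs: "cdg s" "cdg (dx s)" using s by (auto intro: cdg_VN VN_dx)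
  have sup: "(s i j x y)\<^sup>2 \<le> C / (h i * h j) * \<sigma> i j" "(dx s i j x y)\<^sup>2 \<le> C / (h i ^ 3 * h j) * \<sigma> i j"
    if ij: "i \<in> {1..N}" "j \<in> {1..N}" and xy: "(x, y) \<in> el i j" for i j x y
  proof -
    have "Qk k (s i j)" using s ij unfolding VN_def by blast
    moreover have "xs (i - 1) < xs i" "xs (j - 1) < xs j" using ij mono by blast+
    moreover have "x \<in> {xs (i - 1)..xs i}" "y \<in> {xs (j - 1)..xs j}" using xy by (auto simp: mem_el)
    ultimately show "(s i j x y)\<^sup>2 \<le> C / (h i * h j) * \<sigma> i j" "(dx s i j x y)\<^sup>2 \<le> C / (h i ^ 3 * h j) * \<sigma> i j"
      using C unfolding inverse_constant_def \<sigma>_def h_def el_def dx_def power2_eq_square by blast+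
  qed
  have \<eta>2: "(\<eta> i j x y)\<^sup>2 \<le> \<delta>\<^sup>2" if "i \<in> {1..N}" "j \<in> {1..N}" "(x, y) \<in> el i j" for i j x y
    using \<delta>[OF that] by (simp add: abs_le_square_iff[symmetric])
  have X: "C * \<delta>\<^sup>2 / (4 * g * h i) \<le> X" if "i \<in> {1..N}" for i
    unfolding X_def using h[OF that] hm(1) C0 g by (intro divide_left_mono) auto
  have int: "integral (el i j) (\<lambda>z. \<eta> i j (fst z) (snd z) * dx s i j (fst z) (snd z)) \<le> X * h j + g * \<sigma> i j"
    if ij: "i \<in> {1..N}" "j \<in> {1..N}" for i j
  proof -
    define B where "B = C * \<delta>\<^sup>2 / (4 * g * (h i)\<^sup>2) + g / (h i * h j) * \<sigma> i j"
    note hi = h(1)[OF ij(1)] and hj = h(1)[OF ij(2)]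
    have "integral (cbox (xs (i - 1), xs (j - 1)) (xs i, xs j)) (\<lambda>z. \<eta> i j (fst z) (snd z) * dx s i j (fst z) (snd z))
      \<le> B * ((xs i - xs (i - 1)) * (xs j - xs (j - 1)))"
    proof (rule integral_pair_bounds)
      show "continuous_on (cbox (xs (i - 1), xs (j - 1)) (xs i, xs j)) (\<lambda>z. \<eta> i j (fst z) (snd z) * dx s i j (fst z) (snd z))"
        using cdgD[OF cdg_mult[OF \<eta> cs(2)] ij] by (simp add: el_def)
      fix x y assume xy: "x \<in> {xs (i - 1)..xs i}" "y \<in> {xs (j - 1)..xs j}"
      then have e: "(x, y) \<in> el i j" by (simp add: mem_el)
      \<comment> \<open>Chosen so that \<open>G\<close> times the inverse factor
        \<open>C / (h i ^ 3 * h j)\<close> becomes \<open>g\<close> divided by the area of the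
        cell.\<close>
      define G where "G = g * (h i)\<^sup>2 / C"
      have G: "G > 0" using g C0 hi by (simp add: G_def)
      have "\<eta> i j x y * dx s i j x y \<le> (\<eta> i j x y)\<^sup>2 / (4 * G) + G * (dx s i j x y)\<^sup>2"
        using young[OF G, of "\<eta> i j x y" "dx s i j x y"] by linarith
      also have "\<dots> \<le> \<delta>\<^sup>2 / (4 * G) + G * (C / (h i ^ 3 * h j) * \<sigma> i j)"
        using \<eta>2[OF ij e] sup(2)[OF ij e] G by (intro add_mono divide_right_mono mult_left_mono) auto
      also have "\<dots> = B" unfolding B_def G_def using g C0 hi hj by (simp add: field_simps power2_eq_square power3_eq_cube)
      finally show "\<eta> i j (fst (x, y)) (snd (x, y)) * dx s i j (fst (x, y)) (snd (x, y)) \<le> B" by simp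
    qed (use mono ij less_imp_le in blast)+
    then have "integral (el i j) (\<lambda>z. \<eta> i j (fst z) (snd z) * dx s i j (fst z) (snd z)) \<le> B * (h i * h j)"
      by (simp add: el_def h_def)
    also have "\<dots> = C * \<delta>\<^sup>2 / (4 * g * h i) * h j + g * \<sigma> i j"
      unfolding B_def using hi hj g by (simp add: field_simps power2_eq_square)
    also have "\<dots> \<le> X * h j + g * \<sigma> i j" using X[OF ij(1)] hj by (intro add_right_mono mult_right_mono) auto
    finally show ?thesis .
  qed
  have edge: "eint xs j (\<lambda>y. \<eta> i j (xs i) y * jumpV N xs s i j y) \<le> 2 * X * h j + g * (\<sigma> (Suc i) j + \<sigma> i j)"
    if i: "i \<in> {1..N-1}" and j: "j \<in> {1..N}" for i j
  proof -
    have i': "i \<in> {1..N}" "Suc i \<in> {1..N}" "0 < i" "i < N" "i \<le> N" using i by auto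
    note hj = h(1)[OF j]
    have mem: "(xs i, y) \<in> el i j" "(xs i, y) \<in> el (Suc i) j" if "y \<in> {xs (j - 1)..xs j}" for y
      using mono[OF i'(1)] mono[OF i'(2)] that by (auto simp: mem_el)
    have trace: "\<eta> i j (xs i) y * t \<le> X + g / h j * \<sigma> a j"
      if y: "y \<in> {xs (j - 1)..xs j}" and t: "t\<^sup>2 \<le> C / (h a * h j) * \<sigma> a j" and a: "a \<in> {1..N}" for a t y
    proof -
      note ha = h(1)[OF a]
      \<comment> \<open>The trace analogue: the inverse factor \<open>C / (h a * h j)\<close> turns
        into \<open>g / h j\<close>, which integrates to \<open>g\<close> along the edge.\<close>
      define G where "G = g * h a / C"
      have G: "G > 0" using g C0 ha by (simp add: G_def)
      have "\<eta> i j (xs i) y * t \<le> (\<eta> i j (xs i) y)\<^sup>2 / (4 * G) + G * t\<^sup>2"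
        using young[OF G, of "\<eta> i j (xs i) y" t] by linarith
      also have "\<dots> \<le> \<delta>\<^sup>2 / (4 * G) + G * (C / (h a * h j) * \<sigma> a j)"
        using \<eta>2[OF i'(1) j mem(1)[OF y]] t G by (intro add_mono divide_right_mono mult_left_mono) auto
      also have "\<dots> = C * \<delta>\<^sup>2 / (4 * g * h a) + g / h j * \<sigma> a j"
        unfolding G_def using g C0 ha hj by (simp add: field_simps)
      also have "\<dots> \<le> X + g / h j * \<sigma> a j" using X[OF a] by simp
      finally show ?thesis .
    qed
    have "eint xs j (\<lambda>y. \<eta> i j (xs i) y * jumpV N xs s i j y)
       \<le> eint xs j (\<lambda>y. (X + g / h j * \<sigma> (Suc i) j) + (X + g / h j * \<sigma> i j))"
    proof (rule eint_mono)
      show "continuous_on {xs (j - 1)..xs j} (\<lambda>y. \<eta> i j (xs i) y * jumpV N xs s i j y)"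
        by (intro continuous_on_mult cdg_slice_right[OF \<eta> i'(1) j] jumpV_continuous[OF cs(1) i'(5) j])
      fix y assume y: "y \<in> {xs (j - 1)..xs j}"
      have "\<eta> i j (xs i) y * jumpV N xs s i j y = \<eta> i j (xs i) y * s (Suc i) j (xs i) y + \<eta> i j (xs i) y * (- s i j (xs i) y)"
        unfolding jumpV_interior[OF i'(3,4)] by (simp add: algebra_simps)
      also have "\<dots> \<le> (X + g / h j * \<sigma> (Suc i) j) + (X + g / h j * \<sigma> i j)"
        using sup(1)[OF i'(2) j mem(2)[OF y]] sup(1)[OF i'(1) j mem(1)[OF y]]
        by (intro add_mono trace[OF y _ i'(2)] trace[OF y _ i'(1)]) auto
      finally show "\<eta> i j (xs i) y * jumpV N xs s i j y \<le> (X + g / h j * \<sigma> (Suc i) j) + (X + g / h j * \<sigma> i j)" .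
    qed auto
    also have "\<dots> = ((X + g / h j * \<sigma> (Suc i) j) + (X + g / h j * \<sigma> i j)) * h j"
      using eint_const[OF j] by (simp add: h_def)
    also have "\<dots> = 2 * X * h j + g * (\<sigma> (Suc i) j + \<sigma> i j)" using hj by (simp add: field_simps)
    finally show ?thesis .
  qed
  have \<sigma>0: "0 \<le> \<sigma> i j" if "i \<in> {1..N}" "j \<in> {1..N}" for i j
    unfolding \<sigma>_def using integrable_el[OF cdg_mult[OF cs(1) cs(1)] that]
    by (intro Henstock_Kurzweil_Integration.integral_nonneg) auto
  have X0: "X \<ge> 0" unfolding X_def using C0 g hm by simp
  have sh: "(\<Sum>j\<in>{1..N}. h j) = 1" unfolding h_def by (rule sum_mesh_widths)
  have ips: "ip N xs s s = (\<Sum>i\<in>{1..N}. \<Sum>j\<in>{1..N}. \<sigma> i j)" unfolding ip_alt \<sigma>_def ..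
  have ips': "ip N xs s s = (\<Sum>j\<in>{1..N}. \<Sum>i\<in>{1..N}. \<sigma> i j)" unfolding ips by (rule sum.swap)
  have "ip N xs \<eta> (dx s) \<le> (\<Sum>i\<in>{1..N}. \<Sum>j\<in>{1..N}. X * h j + g * \<sigma> i j)"
    unfolding ip_alt using int by (intro sum_mono) auto
  also have "\<dots> = N * X + g * ip N xs s s"
    unfolding ips using sh by (simp add: sum.distrib sum_distrib_left[symmetric])
  finally have 1: "ip N xs \<eta> (dx s) \<le> N * X + g * ip N xs s s" .
  have "(\<Sum>j\<in>{1..N}. \<Sum>i\<in>{1..N-1}. eint xs j (\<lambda>y. \<eta> i j (xs i) y * jumpV N xs s i j y)) \<le>
     (\<Sum>j\<in>{1..N}. 2 * N * X * h j + 2 * g * (\<Sum>i\<in>{1..N}. \<sigma> i j))"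
  proof (rule sum_mono)
    fix j assume j: "j \<in> {1..N}"
    have "(\<Sum>i\<in>{1..N-1}. eint xs j (\<lambda>y. \<eta> i j (xs i) y * jumpV N xs s i j y)) \<le>
      (\<Sum>i\<in>{1..N-1}. 2 * X * h j + g * (\<sigma> (Suc i) j + \<sigma> i j))"
      using edge j by (intro sum_mono) auto
    also have "\<dots> = real (N - 1) * (2 * X * h j) + g * ((\<Sum>i\<in>{1..N-1}. \<sigma> (Suc i) j) + (\<Sum>i\<in>{1..N-1}. \<sigma> i j))"
      by (simp add: sum.distrib sum_distrib_left distrib_left)
    \<comment> \<open>Every cell meets at most two interior vertical edges, so both sums are
      dominated by the sum over all cells of the row.\<close>
    also have "\<dots> \<le> N * (2 * X * h j) + g * ((\<Sum>i\<in>{1..N}. \<sigma> i j) + (\<Sum>i\<in>{1..N}. \<sigma> i j))"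
    proof (intro add_mono mult_right_mono mult_left_mono)
      have "(\<Sum>i\<in>{1..N-1}. \<sigma> (Suc i) j) = (\<Sum>i\<in>Suc ` {1..N-1}. \<sigma> i j)" by (subst sum.reindex) auto
      also have "\<dots> \<le> (\<Sum>i\<in>{1..N}. \<sigma> i j)" using \<sigma>0 j by (intro sum_mono2) auto
      finally show "(\<Sum>i\<in>{1..N-1}. \<sigma> (Suc i) j) \<le> (\<Sum>i\<in>{1..N}. \<sigma> i j)" .
      show "(\<Sum>i\<in>{1..N-1}. \<sigma> i j) \<le> (\<Sum>i\<in>{1..N}. \<sigma> i j)" using \<sigma>0 j by (intro sum_mono2) auto
    qed (use X0 g h(1)[OF j] in auto)
    finally show "(\<Sum>i\<in>{1..N-1}. eint xs j (\<lambda>y. \<eta> i j (xs i) y * jumpV N xs s i j y)) \<le>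
       2 * N * X * h j + 2 * g * (\<Sum>i\<in>{1..N}. \<sigma> i j)" by (simp add: algebra_simps)
  qed
  also have "\<dots> = 2 * N * X + 2 * g * ip N xs s s"
    unfolding ips' using sh by (simp add: sum.distrib sum_distrib_left[symmetric])
  finally have "FU \<eta> s (dx s) \<le> 3 * N * X + 3 * g * ip N xs s s"
    using 1 unfolding FU_def by linarith
  then show ?thesis unfolding X_def g_def by (simp add: field_simps)
qed

text \<open>With the volume term gone, only edges remain, and there the jumps of \<open>v\<close>
  are part of the energy. No inverse inequality enters, and the loss is just the number
  \<open>N + 1\<close> of mesh lines.\<close>

lemma FP_bound:
  assumes \<eta>: "cdg \<eta>" and v: "cdg v" and orth: "ip N xs \<eta> vx = 0" and \<gamma>: "0 < \<gamma>"
    and \<delta>: "\<And>i j x y. i \<in> {1..N} \<Longrightarrow> j \<in> {1..N} \<Longrightarrow> (x, y) \<in> el i j \<Longrightarrow> \<bar>\<eta> i j x y\<bar> \<le> \<delta>"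
  shows "FP \<eta> v vx \<le> (real N + 1) * \<delta>\<^sup>2 / (4 * \<gamma>) + \<gamma> * JJ v v"
proof -
  define J where "J = (\<lambda>i j. eint xs j (\<lambda>y. jumpV N xs v i j y * jumpV N xs v i j y))"
  define Y where "Y = \<delta>\<^sup>2 / (4 * \<gamma>)"
  have "(\<Sum>i\<in>{0..N-1}. eint xs j (\<lambda>y. \<eta> (Suc i) j (xs i) y * jumpV N xs v i j y))
        - eint xs j (\<lambda>y. \<eta> N j (xs N) y * v N j (xs N) y) \<le> (\<Sum>i\<in>{0..N}. Y * (xs j - xs (j - 1)) + \<gamma> * J i j)"
    if j: "j \<in> {1..N}" for j
  proof -
    have "eint xs j (\<lambda>y. \<eta> (Suc i) j (xs i) y * jumpV N xs v i j y) \<le> Y * (xs j - xs (j - 1)) + \<gamma> * J i j"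
      if i: "i < N" for i
      unfolding Y_def J_def
    proof (rule eint_young[OF j _ _ _ \<gamma>])
      fix y assume "y \<in> {xs (j - 1)..xs j}"
      then show "\<bar>\<eta> (Suc i) j (xs i) y\<bar> \<le> \<delta>" using i j mono[of "Suc i"] by (intro \<delta>) (auto simp: mem_el)
    qed (intro cdg_slice_left[OF \<eta> i j] jumpV_continuous[OF v less_imp_le[OF i] j])+
    then have 1: "(\<Sum>i\<in>{0..N-1}. eint xs j (\<lambda>y. \<eta> (Suc i) j (xs i) y * jumpV N xs v i j y)) \<le>
      (\<Sum>i\<in>{0..N-1}. Y * (xs j - xs (j - 1)) + \<gamma> * J i j)" using N1 by (intro sum_mono) auto
    have N: "N \<in> {1..N}" using N1 by simp
    have "eint xs j (\<lambda>y. \<eta> N j (xs N) y * jumpV N xs v N j y) \<le> Y * (xs j - xs (j - 1)) + \<gamma> * J N j"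
      unfolding Y_def J_def
    proof (rule eint_young[OF j _ _ _ \<gamma>])
      fix y assume "y \<in> {xs (j - 1)..xs j}"
      then show "\<bar>\<eta> N j (xs N) y\<bar> \<le> \<delta>" using N j mono[of N] by (intro \<delta>) (auto simp: mem_el)
    qed (intro cdg_slice_right[OF \<eta> N j] jumpV_continuous[OF v le_refl j])+
    \<comment> \<open>On the last line the jump is minus the left trace, so the separately
      subtracted boundary term has the same shape as the others.\<close>
    moreover have "eint xs j (\<lambda>y. \<eta> N j (xs N) y * jumpV N xs v N j y) = - eint xs j (\<lambda>y. \<eta> N j (xs N) y * v N j (xs N) y)"
      using N1 eint_cmult[of j "-1"] by (simp add: jumpV_def)
    moreover have "{0..N} = insert N {0..N-1}" "N \<notin> {0..N-1}" using N1 by auto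
    ultimately show ?thesis using 1 by simp
  qed
  then have "FP \<eta> v vx \<le> (\<Sum>j\<in>{1..N}. \<Sum>i\<in>{0..N}. Y * (xs j - xs (j - 1)) + \<gamma> * J i j)"
    unfolding FP_def orth add_0 by (rule sum_mono)
  also have "\<dots> = (\<Sum>j\<in>{1..N}. (real N + 1) * Y * (xs j - xs (j - 1))) + \<gamma> * JJ v v"
    unfolding JJ_def J_def by (simp add: sum.distrib sum_distrib_left mult.assoc add.commute)
  also have "\<dots> = (real N + 1) * Y + \<gamma> * JJ v v"
    unfolding sum_distrib_left[symmetric] sum_mesh_widths by simp
  finally show ?thesis unfolding Y_def by simp
qed

lemma jumpV_bound:
  assumes \<delta>: "\<And>i j x y. i \<in> {1..N} \<Longrightarrow> j \<in> {1..N} \<Longrightarrow> (x, y) \<in> el i j \<Longrightarrow> \<bar>\<eta> i j x y\<bar> \<le> \<delta>"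
    and "i \<le> N" "j \<in> {1..N}" "y \<in> {xs (j - 1)..xs j}"
  shows "\<bar>jumpV N xs \<eta> i j y\<bar> \<le> 2 * \<delta>"
proof -
  have L: "\<bar>\<eta> i j (xs i) y\<bar> \<le> \<delta>" if "0 < i"
    using that assms mono[of i] by (intro \<delta>) (auto simp: mem_el)
  have R: "\<bar>\<eta> (Suc i) j (xs i) y\<bar> \<le> \<delta>" if "i < N"
    using that assms mono[of "Suc i"] by (intro \<delta>) (auto simp: mem_el)
  consider "i = 0" | "i = N" "0 < i" | "0 < i" "i < N" using assms by linarith
  then show ?thesis using L R N1 by cases (auto simp: jumpV_def)
qed

lemma JJ_bound:
  assumes \<eta>: "cdg \<eta>" and v: "cdg v" and \<gamma>: "0 < \<gamma>"
    and \<delta>: "\<And>i j x y. i \<in> {1..N} \<Longrightarrow> j \<in> {1..N} \<Longrightarrow> (x, y) \<in> el i j \<Longrightarrow> \<bar>\<eta> i j x y\<bar> \<le> \<delta>"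
  shows "JJ \<eta> v \<le> (real N + 1) * \<delta>\<^sup>2 / \<gamma> + \<gamma> * JJ v v"
proof -
  define J where "J = (\<lambda>i j. eint xs j (\<lambda>y. jumpV N xs v i j y * jumpV N xs v i j y))"
  define Y where "Y = (2 * \<delta>)\<^sup>2 / (4 * \<gamma>)"
  have "JJ \<eta> v \<le> (\<Sum>j\<in>{1..N}. \<Sum>i\<in>{0..N}. Y * (xs j - xs (j - 1)) + \<gamma> * J i j)"
    unfolding JJ_def J_def Y_def using jumpV_bound[OF \<delta>]
    by (intro sum_mono eint_young[OF _ _ _ _ \<gamma>] jumpV_continuous[OF \<eta>] jumpV_continuous[OF v]) auto
  also have "\<dots> = (\<Sum>j\<in>{1..N}. (real N + 1) * Y * (xs j - xs (j - 1))) + \<gamma> * JJ v v"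
    unfolding JJ_def J_def by (simp add: sum.distrib sum_distrib_left mult.assoc add.commute)
  also have "\<dots> = (real N + 1) * Y + \<gamma> * JJ v v"
    unfolding sum_distrib_left[symmetric] sum_mesh_widths by simp
  finally show ?thesis unfolding Y_def by (simp add: power_mult_distrib)
qed

text \<open>\<open>JJ_bound\<close> with both arguments equal and weight one half; the jump term on
  the right is absorbed on the left.\<close>

lemma JJ_bound_self:
  assumes \<eta>: "cdg \<eta>"
    and \<delta>: "\<And>i j x y. i \<in> {1..N} \<Longrightarrow> j \<in> {1..N} \<Longrightarrow> (x, y) \<in> el i j \<Longrightarrow> \<bar>\<eta> i j x y\<bar> \<le> \<delta>"
  shows "JJ \<eta> \<eta> \<le> 4 * (real N + 1) * \<delta>\<^sup>2"
  using JJ_bound[of \<eta> \<eta> "1/2", OF \<eta> \<eta> _ \<delta>] by (simp add: field_simps)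

end

section \<open>Layer-adapted meshes\<close>

locale layer_mesh =
  fixes kind :: mesh_kind and sg beta eps :: real and N k :: nat
  assumes sg: "sg \<ge> real k + 3/2" and beta: "beta > 0" and eps: "0 < eps"
    and N4: "4 \<le> N" "4 dvd N" and epsN: "sqrt eps \<le> 1 / real N"
    and tau: "tau kind sg beta eps N \<le> 1/4"
begin

abbreviation "xs \<equiv> mesh_pt kind sg beta eps N"
abbreviation "M \<equiv> max_dpsi kind N eps"
abbreviation "n \<equiv> N div 4"

text \<open>The values of \<open>psi\<close> at the grid parameters. In the left fine region the
  mesh point is a multiple of \<open>- ln (ps i)\<close>, so widths and layer functions are both
  expressed through \<open>ps\<close>.\<close>

definition ps :: "nat \<Rightarrow> real" where
  "ps i = exp (- phi kind N eps (real i / real N))"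

lemma Nn: "N = 4 * n" "n \<ge> 1"
  using N4 by auto

lemma sqrt_eps: "0 < sqrt eps" "sqrt eps \<le> 1 / 4" "sqrt eps \<le> 1 / real N" "real N \<ge> 4" "1 / real N \<le> 1/4"
proof -
  show *: "real N \<ge> 4" using N4 by simp
  show **: "1 / real N \<le> 1/4" using * by (simp add: field_simps)
  show "sqrt eps \<le> 1/4" using epsN ** by linarith
qed (use eps epsN in auto)

text \<open>The value of \<open>psi\<close> at \<open>t = 1/4\<close>. On the two logarithmic meshes \<open>psi\<close> is affine.\<close>

definition rest :: real where
  "rest = (case kind of S_mesh \<Rightarrow> 1 / real N | BS_mesh \<Rightarrow> 1 / real N | B_mesh \<Rightarrow> sqrt eps)"

lemma rest: "0 < rest" "rest \<le> 1/4" "sqrt eps \<le> rest" "rest \<le> 1 / real N"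
proof -
  have D: "rest = sqrt eps \<or> rest = 1 / real N" unfolding rest_def by (cases kind) simp_all
  have "0 < 1 / real N" using sqrt_eps(4) by simp
  then show "0 < rest" "rest \<le> 1/4" "sqrt eps \<le> rest" "rest \<le> 1 / real N"
    using D sqrt_eps(1-3,5) by (elim disjE; simp only:)+
qed

lemma phi_log: "kind \<noteq> S_mesh \<Longrightarrow> phi kind N eps t = - ln (1 - 4 * (1 - rest) * t)"
  unfolding phi_def rest_def by (auto split: mesh_kind.split)

text \<open>The range extends slightly beyond \<open>1/4\<close>: \<open>max_dpsi\<close> uses the
  two-sided \<open>deriv\<close>, so at the endpoint the logarithm must make sense on both sides. At
  the limit of the range the argument still equals \<open>rest\<^sup>2\<close>.\<close>

lemma log_arg_pos: "t < 1/4 + rest / 4 \<Longrightarrow> 1 - 4 * (1 - rest) * t > 0"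
proof -
  assume t: "t < 1/4 + rest / 4"
  have "(1 - rest) * t \<le> (1 - rest) * (1/4 + rest / 4)" using t rest by (intro mult_left_mono) auto
  moreover have "4 * ((1 - rest) * (1/4 + rest / 4)) = 1 - rest\<^sup>2" by (simp add: power2_eq_square field_simps)
  moreover have "rest\<^sup>2 > 0" using rest by simp
  moreover have "4 * (1 - rest) * t = 4 * ((1 - rest) * t)" by simp
  ultimately show ?thesis by linarith
qed

text \<open>On the S-mesh the derivative of the decreasing exponential is largest in modulus at
  \<open>t = 0\<close>; otherwise it is constant on the interval.\<close>

lemma M_eq: "M = (if kind = S_mesh then 4 * ln N else 4 * (1 - rest))"
proof (cases "kind = S_mesh")
  case True
  have "deriv (psi kind N eps) t = - (4 * ln N) * exp (- (4 * t * ln N))" for t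
    unfolding psi_def phi_def using True
    by (intro DERIV_imp_deriv) (auto intro!: derivative_eq_intros)
  then have d: "\<bar>deriv (psi kind N eps) t\<bar> = 4 * ln N * exp (- (4 * t * ln N))" for t
    using N4 by (simp add: abs_mult)
  have "M = 4 * ln N" unfolding max_dpsi_def
  proof (rule cSup_eq_maximum)
    show "4 * ln N \<in> (\<lambda>t. \<bar>deriv (psi kind N eps) t\<bar>) ` {0..1/4}"
      by (rule image_eqI[of _ _ 0]) (auto simp: d)
    fix y assume "y \<in> (\<lambda>t. \<bar>deriv (psi kind N eps) t\<bar>) ` {0..1/4}"
    then obtain t where "t \<in> {0..1/4}" "y = 4 * ln N * exp (- (4 * t * ln N))" by (auto simp: d)
    then show "y \<le> 4 * ln N" using N4 by (auto intro!: mult_left_le)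
  qed
  then show ?thesis unfolding if_P[OF True] .
next
  case False
  have d: "deriv (psi kind N eps) t = - (4 * (1 - rest))" if t: "t \<in> {0..1/4}" for t
  proof -
    have "eventually (\<lambda>s. s \<in> {..<1/4 + rest / 4}) (nhds t)"
      using t rest by (intro eventually_nhds_in_open) auto
    then have "eventually (\<lambda>s. psi kind N eps s = 1 - 4 * (1 - rest) * s) (nhds t)"
      by (rule eventually_mono) (use log_arg_pos in \<open>auto simp: psi_def phi_log[OF False]\<close>)
    then have "deriv (psi kind N eps) t = deriv (\<lambda>s. 1 - 4 * (1 - rest) * s) t" by (rule deriv_cong_ev) simp
    also have "\<dots> = - (4 * (1 - rest))" by (intro DERIV_imp_deriv) (auto intro!: derivative_eq_intros)
    finally show ?thesis .
  qed
  have "(\<lambda>t. \<bar>deriv (psi kind N eps) t\<bar>) ` {0..1/4} = (\<lambda>t. 4 * (1 - rest)) ` {0..1/4::real}"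
    using rest by (intro image_cong refl) (auto simp: d)
  then show ?thesis unfolding max_dpsi_def if_not_P[OF False] by simp
qed

lemma M_S: "kind = S_mesh \<Longrightarrow> M = 4 * ln N"
  and M_log: "kind \<noteq> S_mesh \<Longrightarrow> M = 4 * (1 - rest)"
  by (rule trans[OF M_eq if_P], assumption) (rule trans[OF M_eq if_not_P], assumption)

text \<open>The upper bound is what later converts terms of size \<open>N * kap\<^sup>2\<close> into
  the target size \<open>kap\<^sup>2 * N\<^sup>2 / M\<close>.\<close>

lemma M_bounds: "M \<ge> 2" "M \<le> 4 * N"
proof -
  have "exp 1 \<le> real N" using exp_le sqrt_eps(4) by linarith
  then have "1 \<le> ln (real N)" using sqrt_eps(4) by (subst ln_ge_iff) auto
  moreover have "ln (real N) \<le> N" using ln_le_minus_one[of "real N"] sqrt_eps(4) by linarith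
  ultimately show "M \<ge> 2" "M \<le> 4 * N" unfolding M_eq using rest sqrt_eps(4) by auto
qed

lemma ps_pos: "0 < ps i"
  by (simp add: ps_def)

lemma ps_S: "kind = S_mesh \<Longrightarrow> ps i = exp (- (real i * (M / N)))"
  unfolding ps_def phi_def M_S by simp

lemma ps_log: 
  assumes "kind \<noteq> S_mesh" "i \<le> n"
  shows "ps i = 1 - real i * (M / N)"
proof -
  have "real i / N \<le> 1/4" using assms Nn by (simp add: field_simps)
  then have "1 - 4 * (1 - rest) * (real i / N) > 0" using rest(1) by (intro log_arg_pos) linarith
  then show ?thesis unfolding ps_def phi_log[OF assms(1)] M_log[OF assms(1)] by (simp add: mult_ac)
qed

lemma ps0: "ps 0 = 1"
  unfolding ps_def phi_def by (cases kind) auto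

lemma ps_n: "ps n = rest"
proof (cases "kind = S_mesh")
  case True
  have "real n * (4 / N) = 1" using Nn by (simp add: field_simps)
  then have "real n * (M / N) = ln N" unfolding M_S[OF True] by (simp add: field_simps)
  then have "ps n = exp (- ln N)" using ps_S[OF True] by simp
  also have "\<dots> = 1 / N" using sqrt_eps(4) by (simp add: exp_minus inverse_eq_divide)
  also have "\<dots> = rest" unfolding rest_def using True by simp
  finally show ?thesis .
next
  case False
  have "real n * (4 / N) = 1" using Nn by (simp add: field_simps)
  moreover have "real n * (4 * (1 - rest) / N) = real n * (4 / N) * (1 - rest)" by simp
  ultimately have "real n * (M / N) = 1 - rest" unfolding M_log[OF False] by (simp only: mult_1)
  then show ?thesis using ps_log[OF False] by simp
qed

text \<open>On the S-mesh \<open>ps\<close> is a geometric sequence with ratio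
  \<open>exp (- (M / N))\<close>, on the other meshes an arithmetic one with difference
  \<open>M / N\<close>. The bound on differences controls fine widths from above, the bound on
  logarithms from below.\<close>

lemma ps_step:
  assumes "Suc i \<le> n"
  shows "ps (Suc i) < ps i" "ps i - ps (Suc i) \<le> M / N" "ln (ps i / ps (Suc i)) \<ge> M / N"
proof -
  have MN: "M / N > 0" using M_bounds sqrt_eps(4) by simp
  have goal: "ps (Suc i) < ps i \<and> ps i - ps (Suc i) \<le> M / N \<and> ln (ps i / ps (Suc i)) \<ge> M / N"
  proof (cases "kind = S_mesh")
    case True
    have e: "ps (Suc i) = ps i * exp (- (M / N))" unfolding ps_S[OF True] by (simp add: exp_add[symmetric] algebra_simps add_divide_distrib)
    have "exp (- (M / N)) < 1" using MN by simp
    moreover have "1 - exp (- (M / N)) \<le> M / N" using exp_ge_add_one_self[of "- (M / N)"] by simp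
    moreover have "0 \<le> real i * (M / N)" using MN by (intro mult_nonneg_nonneg) auto
    then have "ps i \<le> 1" unfolding ps_S[OF True] exp_le_one_iff by linarith
    moreover have "ps i * (1 - exp (- (M / N))) \<le> 1 * (M / N)"
      using calculation MN ps_pos[of i] by (intro mult_mono) auto
    moreover have "ps i / ps (Suc i) = exp (M / N)" using ps_pos[of i] by (simp add: e exp_minus field_simps)
    ultimately show ?thesis using ps_pos[of i] by (simp add: e algebra_simps)
  next
    case False
    have a: "ps i = 1 - real i * (M / N)" "ps (Suc i) = 1 - real (Suc i) * (M / N)"
      using ps_log[OF False] assms by auto
    then have d: "ps i - ps (Suc i) = M / N" by (simp add: algebra_simps add_divide_distrib)
    have "0 \<le> real i * (M / N)" using MN by (intro mult_nonneg_nonneg) auto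
    then have "ps i \<le> 1" using a(1) by linarith
    have "M / N = ps i - ps (Suc i)" using d by simp
    \<comment> \<open>Dividing by \<open>ps i\<close>, which is at most 1, can only enlarge the
      step; it turns the difference into a relative one that \<open>ln_le_minus_one\<close> can
      handle.\<close>
    also have "\<dots> \<le> (ps i - ps (Suc i)) / ps i"
    proof (rule mult_imp_le_div_pos[OF ps_pos])
      show "(ps i - ps (Suc i)) * ps i \<le> ps i - ps (Suc i)"
        using \<open>ps i \<le> 1\<close> unfolding d by (rule mult_left_le) (use MN in simp)
    qed
    also have "\<dots> = 1 - ps (Suc i) / ps i" using ps_pos[of i] by (simp add: field_simps)
    also have "\<dots> \<le> - ln (ps (Suc i) / ps i)" using ln_le_minus_one[of "ps (Suc i) / ps i"] ps_pos by simp
    also have "\<dots> = ln (ps i / ps (Suc i))" using ps_pos by (simp add: ln_div)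
    finally show ?thesis using d MN by simp
  qed
  then show "ps (Suc i) < ps i" "ps i - ps (Suc i) \<le> M / N" "ln (ps i / ps (Suc i)) \<ge> M / N" by auto
qed

lemma ps_antimono: "i \<le> j \<Longrightarrow> j \<le> n \<Longrightarrow> ps j \<le> ps i"
proof (induction j)
  case (Suc j)
  then show ?case using ps_step(1)[of j] by (cases "i = Suc j") auto
qed simp

lemma ps_le1: "i \<le> n \<Longrightarrow> ps i \<le> 1"
  using ps_antimono[of 0 i] ps0 by simp

section \<open>Mesh points and mesh widths\<close>

definition c0 :: real where "c0 = sg * sqrt eps / beta"

lemma sg_pos: "sg > 0"
  using sg by linarith

lemma c0: "c0 > 0"
  unfolding c0_def using sg_pos beta sqrt_eps by simp

lemma xs_fine: "i \<le> n \<Longrightarrow> xs i = c0 * - ln (ps i)"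
  unfolding mesh_pt_def Let_def using Nn by (simp add: c0_def ps_def)

lemma tau_eq: "tau kind sg beta eps N = c0 * - ln (ps n)"
proof -
  have "real n / real N = 1 / 4" using Nn by (simp add: field_simps)
  then show ?thesis unfolding tau_def by (simp add: c0_def ps_def)
qed

text \<open>The branches of \<open>mesh_pt\<close> agree at the transition indices \<open>n\<close>
  and \<open>3 * n\<close>, so the affine formula holds up to and including them.\<close>

lemma xs_coarse:
  assumes "n \<le> i" "i \<le> 3 * n"
  shows "xs i = tau kind sg beta eps N + 2 * (1 - 2 * tau kind sg beta eps N) * (real i / N - 1/4)"
proof -
  consider "i = n" | "i = 3 * n" | "n < i" "i < 3 * n" using assms by linarith
  then show ?thesis
  proof cases
    case 1
    have "real n / real N = 1 / 4" using Nn by (simp add: field_simps)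
    then show ?thesis using 1 xs_fine[of n] tau_eq by simp
  next
    case 2
    have r: "real (3 * n) / real N = 3 / 4" using Nn by (simp add: field_simps)
    have nots: "\<not> 4 * i \<le> N" "\<not> 4 * i < 3 * N" using 2 Nn by linarith+
    have q: "1 - real i / real N = 1 / 4" using r 2 by simp
    have "xs i = 1 - tau kind sg beta eps N"
      unfolding mesh_pt_def Let_def tau_def by (simp only: nots q if_False)
    moreover have q2: "real i / real N = 3 / 4" using r 2 by simp
    ultimately show ?thesis unfolding q2 by (simp add: algebra_simps)
  next
    case 3
    then have "\<not> 4 * i \<le> N" "4 * i < 3 * N" using Nn by linarith+
    then show ?thesis unfolding mesh_pt_def Let_def by simp
  qed
qed

text \<open>Symmetry about the midpoint, which transfers the estimates for the left layer to the
  right one.\<close>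

lemma xs_reflect:
  assumes "i \<le> N"
  shows "xs (N - i) = 1 - xs i"
proof -
  have aux: "xs (N - i) = 1 - xs i" if i: "i \<le> n" for i
  proof (cases "i = n")
    case True
    have "N - i = 3 * n" using True Nn by linarith
    moreover have "real (3 * n) / real N = 3 / 4" "real n / real N = 1 / 4" using Nn by (simp_all add: field_simps)
    ultimately show ?thesis using True xs_coarse[of "3 * n"] xs_coarse[of n] by (simp add: diff_divide_distrib)
  next
    case False
    have "\<not> 4 * (N - i) \<le> N" "\<not> 4 * (N - i) < 3 * N" "4 * i \<le> N" using i False Nn by linarith+
    moreover have rN: "real (N - i) = real N - real i" using i Nn by (intro of_nat_diff) linarith
    have "1 - real (N - i) / N = real i / N"
      unfolding rN diff_divide_distrib using sqrt_eps(4) by simp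
    ultimately show ?thesis unfolding mesh_pt_def Let_def by simp
  qed
  have rN: "real (N - i) = real N - real i" using assms by (rule of_nat_diff)
  consider "i \<le> n" | "N - i \<le> n" | "n \<le> i" "i \<le> 3 * n" using assms Nn by linarith
  then show ?thesis
  proof cases
    case 1
    then show ?thesis by (rule aux)
  next
    case 2
    then show ?thesis using aux[of "N - i"] assms by simp
  next
    case 3
    then have a: "n \<le> N - i" "N - i \<le> 3 * n" using Nn by linarith+
    have q: "real (N - i) / N = 1 - real i / N"
      unfolding rN diff_divide_distrib using sqrt_eps(4) by simp
    show ?thesis unfolding xs_coarse[OF a] xs_coarse[OF 3] q by (simp add: algebra_simps)
  qed
qed

text \<open>The first entry of the minimum comes from the fine cells. The second makes the coarse
  cells comply: their width is at least \<open>1 / N\<close>, while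
  \<open>sqrt eps \<le> 1 / N\<close> and \<open>M / N \<le> 4\<close>.\<close>

definition hmin :: real where
  "hmin = min (sg / beta) (1/4) * (sqrt eps * (M / N))"

definition hC :: real where
  "hC = max (sg / beta) 1"

lemma hmin_pos: "hmin > 0"
  unfolding hmin_def using sg_pos beta sqrt_eps M_bounds by simp

lemma ln_div': "ln (ps i / ps j) = ln (ps i) - ln (ps j)"
  using ps_pos[of i] ps_pos[of j] by (simp add: ln_div)

lemma width_fine:
  assumes "Suc i \<le> n"
  shows "xs (Suc i) - xs i = c0 * ln (ps i / ps (Suc i))"
  unfolding ln_div' using xs_fine[of i] xs_fine[of "Suc i"] assms by (simp add: algebra_simps)

lemma width_fine_upper:
  assumes "Suc i \<le> n"
  shows "xs (Suc i) - xs i \<le> c0 * ((M / N) / ps (Suc i))"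
proof -
  have "ln (ps i / ps (Suc i)) \<le> ps i / ps (Suc i) - 1" using ps_pos by (intro ln_le_minus_one) simp
  also have "\<dots> = (ps i - ps (Suc i)) / ps (Suc i)" using ps_pos[of "Suc i"] by (simp add: field_simps)
  also have "\<dots> \<le> (M / N) / ps (Suc i)"
    using ps_step(2)[OF assms] ps_pos[of "Suc i"] by (intro divide_right_mono) auto
  finally show ?thesis unfolding width_fine[OF assms] by (rule mult_left_mono) (use c0 in simp)
qed

lemma width_bounds_left:
  assumes "i < 3 * n"
  shows "hmin \<le> xs (Suc i) - xs i" "xs (Suc i) - xs i \<le> hC * (M / N)"
proof -
  have MN: "M / N > 0" using M_bounds sqrt_eps(4) by simp
  have "hmin \<le> xs (Suc i) - xs i \<and> xs (Suc i) - xs i \<le> hC * (M / N)"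
  proof (cases "Suc i \<le> n")
    case True
    have "hmin \<le> sg / beta * (sqrt eps * (M / N))"
      unfolding hmin_def using sqrt_eps(1) MN by (intro mult_right_mono mult_nonneg_nonneg) auto
    also have "\<dots> = c0 * (M / N)" by (simp add: c0_def)
    also have "\<dots> \<le> c0 * ln (ps i / ps (Suc i))" using ps_step(3)[OF True] c0 by (intro mult_left_mono) auto
    finally have 1: "hmin \<le> xs (Suc i) - xs i" unfolding width_fine[OF True] .
    \<comment> \<open>No value of \<open>ps\<close> in the fine region falls below
      \<open>rest\<close>, so the division by \<open>ps (Suc i)\<close> costs at most the factor
      \<open>sqrt eps\<close> contained in \<open>c0\<close>.\<close>
    have "ps (Suc i) \<ge> sqrt eps" using ps_antimono[OF True] ps_n rest(3) by simp
    then have "c0 * ((M / N) / ps (Suc i)) \<le> c0 * ((M / N) / sqrt eps)"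
      using c0 MN sqrt_eps(1) by (intro mult_left_mono divide_left_mono mult_pos_pos ps_pos) auto
    also have "\<dots> = sg / beta * (M / N)" using sqrt_eps(1) by (simp add: c0_def)
    also have "\<dots> \<le> hC * (M / N)" unfolding hC_def using MN by (intro mult_right_mono) auto
    finally show ?thesis using 1 width_fine_upper[OF True] by linarith
  next
    case False
    then have i: "n \<le> i" "Suc i \<le> 3 * n" using assms by linarith+
    define t where "t = tau kind sg beta eps N"
    have "0 \<le> c0 * - ln (ps n)" using ps_le1[of n] ps_pos[of n] c0 by (intro mult_nonneg_nonneg) auto
    then have t: "0 \<le> t" "t \<le> 1/4" using tau tau_eq by (auto simp: t_def)
    have w: "xs (Suc i) - xs i = 2 * (1 - 2 * t) / N"
      using i unfolding t_def by (simp add: xs_coarse add_divide_distrib diff_divide_distrib algebra_simps)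
    have "M / N \<le> 4" using M_bounds(2) sqrt_eps(4) by (simp add: pos_divide_le_eq)
    then have "sqrt eps * (M / N) \<le> 1 / N * 4"
      using sqrt_eps MN by (intro mult_mono) auto
    moreover have "0 \<le> sqrt eps * (M / N)" using sqrt_eps(1) MN by (intro mult_nonneg_nonneg) auto
    moreover have "hmin \<le> 1/4 * (sqrt eps * (M / N))"
      unfolding hmin_def by (rule mult_right_mono[OF min.cobounded2 calculation(2)])
    ultimately have "hmin \<le> 1 / N" by linarith
    also have "\<dots> \<le> 2 * (1 - 2 * t) / N" using t by (intro divide_right_mono) auto
    finally have 1: "hmin \<le> xs (Suc i) - xs i" using w by simp
    have "2 * (1 - 2 * t) / N \<le> M / N" using t M_bounds by (intro divide_right_mono) auto
    also have "\<dots> \<le> hC * (M / N)" unfolding hC_def using mult_right_mono[of 1 "max (sg / beta) 1" "M / N"] MN by simp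
    finally show ?thesis using 1 w by simp
  qed
  then show "hmin \<le> xs (Suc i) - xs i" "xs (Suc i) - xs i \<le> hC * (M / N)" by auto
qed

lemma width_bounds:
  assumes "i \<in> {1..N}"
  shows "hmin \<le> xs i - xs (i - 1)" "xs i - xs (i - 1) \<le> hC * (M / N)"
proof -
  obtain m where m: "i = Suc m" "m < N" using assms by (cases i) auto
  have "hmin \<le> xs (Suc m) - xs m \<and> xs (Suc m) - xs m \<le> hC * (M / N)"
  proof (cases "m < 3 * n")
    case True
    then show ?thesis using width_bounds_left by blast
  next
    case False
    define l where "l = N - Suc m"
    have l: "l < 3 * n" "Suc l = N - m" using False m Nn by (auto simp: l_def)
    have "xs (Suc l) = 1 - xs m" "xs l = 1 - xs (Suc m)"
      using xs_reflect[of m] xs_reflect[of "Suc m"] l m by (auto simp: l_def)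
    then show ?thesis using width_bounds_left[OF l(1)] by simp
  qed
  then show "hmin \<le> xs i - xs (i - 1)" "xs i - xs (i - 1) \<le> hC * (M / N)" using m by auto
qed

sublocale dg_mesh N xs
proof
  show "1 \<le> N" using N4 by simp
  show "xs (i - 1) < xs i" if "i \<in> {1..N}" for i using width_bounds(1)[OF that] hmin_pos by linarith
  show "xs 0 = 0" using xs_fine[of 0] ps0 by simp
  then show "xs N = 1" using xs_reflect[of 0] by simp
qed

text \<open>The size of the local approximation error; the final squared bound is a multiple of
  \<open>kap\<^sup>2 * N\<^sup>2 / M\<close>.\<close>

definition kap :: real where "kap = (M / N) ^ Suc k"

lemma kap_pos: "kap > 0"
  unfolding kap_def using M_bounds sqrt_eps(4) by (intro zero_less_power divide_pos_pos) auto

section \<open>Exponential layer functions on the mesh\<close>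

definition ew :: "real \<Rightarrow> real" where "ew x = exp (- beta * x / sqrt eps)"

lemma ew_antimono: "x \<le> y \<Longrightarrow> ew y \<le> ew x"
  unfolding ew_def using beta sqrt_eps by (simp add: divide_right_mono)

text \<open>The factor \<open>sg / beta\<close> in the mesh points turns the decay rate of the layer
  into the exponent \<open>sg\<close> of \<open>ps\<close>.\<close>

lemma ew_xs: "i \<le> n \<Longrightarrow> ew (xs i) = ps i powr sg"
  using ps_pos[of i] beta sqrt_eps by (simp add: ew_def xs_fine c0_def powr_def field_simps)

lemma powr_le_power:
  fixes q :: real
  assumes "0 < q" "q \<le> 1"
  shows "q powr sg \<le> q ^ Suc k"
proof -
  have "q powr sg \<le> q powr real (Suc k)" using assms sg by (intro powr_mono') auto
  then show ?thesis using assms by (simp add: powr_realpow del: of_nat_Suc)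
qed

text \<open>The factor \<open>sqrt eps\<close> is the gain of the integral norm over the maximum
  norm. The value at the left end is kept, so smallness of the layer there carries over to the
  integral.\<close>

lemma integral_ew_square:
  assumes "a \<le> b"
  shows "integral {a..b} (\<lambda>x. (ew x)\<^sup>2) \<le> sqrt eps / (2 * beta) * (ew a)\<^sup>2"
proof -
  have e: "(ew x)\<^sup>2 = exp (- 2 * beta * x / sqrt eps)" for x
    unfolding ew_def by (simp add: power2_eq_square exp_add[symmetric])
  define F where "F = (\<lambda>x. - (sqrt eps / (2 * beta)) * exp (- 2 * beta * x / sqrt eps))"
  have "((\<lambda>x. (ew x)\<^sup>2) has_integral (F b - F a)) {a..b}"
    unfolding e F_def using assms sqrt_eps(1) beta
    by (intro fundamental_theorem_of_calculus)
      (auto intro!: derivative_eq_intros simp: has_real_derivative_iff_has_vector_derivative[symmetric])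
  then have "integral {a..b} (\<lambda>x. (ew x)\<^sup>2) = F b - F a" by (rule integral_unique)
  also have "\<dots> \<le> - F a" unfolding F_def using sqrt_eps(1) beta by simp
  finally show ?thesis unfolding F_def e by simp
qed

text \<open>The powers of 2 are the loss in comparing the two ends of a cell, since the layer is
  largest at the left end while the width is governed by \<open>ps\<close> at the right end. The
  maximum with 1 lets the same number bound the scaled width itself.\<close>

definition LC :: real where
  "LC = max (sg / beta) 1 ^ Suc k * 2 ^ Suc k"

text \<open>On each mesh interval a layer function is either resolved by the mesh, or so small that it
  may be replaced by zero.\<close>

lemma layer_dichotomy:
  assumes i: "i \<in> {1..N}"
  shows "(xs i - xs (i - 1)) / sqrt eps \<le> LC \<and>
           ((xs i - xs (i - 1)) / sqrt eps) ^ Suc k * ew (xs (i - 1)) \<le> LC * kap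
       \<or> ew (xs (i - 1)) \<le> 2 ^ Suc k * kap"
proof -
  have MN: "M / N > 0" using M_bounds sqrt_eps(4) by simp
  let ?m = "max (sg / beta) 1"
  have m1: "?m \<ge> 1" by simp
  have "?m \<le> ?m ^ Suc k" using self_le_power[OF m1, of "Suc k"] by simp
  moreover have "?m ^ Suc k * 1 \<le> ?m ^ Suc k * 2 ^ Suc k"
    using m1 one_le_power[of "2::real" "Suc k"] by (intro mult_left_mono) auto
  ultimately have LC: "sg / beta \<le> LC" "?m ^ Suc k * 2 ^ Suc k \<le> LC" unfolding LC_def by linarith+
  obtain m where m: "i = Suc m" "m < N" using i by (cases i) auto
  show ?thesis
  proof (cases "i \<le> n")
    case True
    then have in': "Suc m \<le> n" using m by simp
    have q1: "ps m \<le> 1" using ps_le1[of m] in' by simp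
    have em: "ew (xs m) \<le> ps m ^ Suc k"
      using ew_xs[of m] in' powr_le_power[OF ps_pos q1] by simp
    \<comment> \<open>If \<open>ps (Suc m)\<close> dominates the step size \<open>M / N\<close>,
      then \<open>ps\<close> at most doubles across the cell, and width times \<open>ps m\<close> is
      of order \<open>sqrt eps * M / N\<close>. Otherwise \<open>ps m \<le> 2 * (M / N)\<close>, and
      the layer is of order \<open>kap\<close> already.\<close>
    show ?thesis
    proof (cases "M / N \<le> ps (Suc m)")
      case True
      have le2: "ps m \<le> 2 * ps (Suc m)" using ps_step(2)[OF in'] True by linarith
      define H where "H = (xs (Suc m) - xs m) / sqrt eps"
      have H0: "0 \<le> H" unfolding H_def using mono[OF i] m sqrt_eps by simp
      have H: "H \<le> sg / beta * ((M / N) / ps (Suc m))"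
        unfolding H_def using width_fine_upper[OF in'] sqrt_eps(1) by (simp add: c0_def field_simps)
      have "(M / N) / ps (Suc m) \<le> 1" using True ps_pos[of "Suc m"] by (simp only: divide_le_eq_1_pos)
      then have "sg / beta * ((M / N) / ps (Suc m)) \<le> sg / beta * 1"
        using sg_pos beta by (intro mult_left_mono) auto
      then have 1: "H \<le> LC" using H LC by linarith
      have "ps m / ps (Suc m) \<le> 2" using le2 ps_pos[of "Suc m"] by (simp add: pos_divide_le_eq)
      then have "(M / N) * (ps m / ps (Suc m)) \<le> (M / N) * 2" by (rule mult_left_mono) (use MN in simp)
      then have "(M / N) / ps (Suc m) * ps m \<le> (M / N) * 2" by simp
      then have "sg / beta * ((M / N) / ps (Suc m) * ps m) \<le> ?m * ((M / N) * 2)"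
        by (rule mult_mono[rotated]) (use M_bounds ps_pos[of m] ps_pos[of "Suc m"] in auto)
      moreover have "H * ps m \<le> sg / beta * ((M / N) / ps (Suc m)) * ps m"
        using H ps_pos[of m] by (intro mult_right_mono) auto
      ultimately have "H * ps m \<le> ?m * ((M / N) * 2)" by (simp only: mult.assoc)
      then have "(H * ps m) ^ Suc k \<le> (?m * ((M / N) * 2)) ^ Suc k"
        using H0 ps_pos[of m] by (intro power_mono mult_nonneg_nonneg) auto
      also have "\<dots> = (?m ^ Suc k * 2 ^ Suc k) * kap" unfolding kap_def by (simp only: power_mult_distrib mult_ac)
      also have "\<dots> \<le> LC * kap" using LC(2) kap_pos by (intro mult_right_mono) auto
      finally have "(H * ps m) ^ Suc k \<le> LC * kap" .
      moreover have "H ^ Suc k * ew (xs m) \<le> H ^ Suc k * ps m ^ Suc k" using em H0 by (intro mult_left_mono) auto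
      ultimately have "H ^ Suc k * ew (xs m) \<le> LC * kap" by (simp only: power_mult_distrib) 
      then show ?thesis using 1 m by (simp add: H_def)
    next
      case False
      then have "ps m \<le> 2 * (M / N)" using ps_step(2)[OF in'] by linarith
      then have "ps m ^ Suc k \<le> (2 * (M / N)) ^ Suc k" using ps_pos[of m] by (intro power_mono) auto
      also have "\<dots> = 2 ^ Suc k * kap" unfolding kap_def by (simp only: power_mult_distrib)
      finally show ?thesis using em m by simp
    qed
  next
    case False
    then have "n \<le> i - 1" "i - 1 \<le> N" using i by auto
    \<comment> \<open>Beyond the transition point monotonicity reduces everything to index
      \<open>n\<close>, where \<open>ps n = rest \<le> 1 / N \<le> M / N\<close>.\<close>
    then have "ew (xs (i - 1)) \<le> ew (xs n)" using xs_le by (intro ew_antimono) auto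
    also have "\<dots> \<le> ps n ^ Suc k" using ew_xs[of n] powr_le_power[OF ps_pos ps_le1] by simp
    also have "\<dots> \<le> (M / N) ^ Suc k"
    proof (rule power_mono)
      have "1 / N \<le> M / N" using M_bounds by (intro divide_right_mono) auto
      then show "ps n \<le> M / N" using ps_n rest(4) by linarith
    qed (use ps_pos[of n] in simp)
    also have "\<dots> \<le> 2 ^ Suc k * kap" unfolding kap_def[symmetric] using kap_pos one_le_power[of "2::real" "Suc k"]
      by (simp add: mult_le_cancel_right1)
    finally show ?thesis by blast
  qed
qed

end

section \<open>Gluing elementwise projections\<close>

context dg_mesh
begin

text \<open>A single competitor on each cell yields both estimates: the maximum norm with the
  stability constant, the weighted integral norm with constant 1 because the projection is the best
  approximation there.\<close>

lemma projection_dg: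
  assumes C: "projection_constant k \<rho>0 \<rho>1 C"
    and cont: "continuous_on sq (\<lambda>z. \<rho> (fst z) (snd z))" "continuous_on sq (\<lambda>z. u (fst z) (snd z))"
    and \<rho>: "\<And>x y. x \<in> {0..1} \<Longrightarrow> y \<in> {0..1} \<Longrightarrow> \<rho>0 \<le> \<rho> x y \<and> \<rho> x y \<le> \<rho>1"
    and approx: "\<And>i j. i \<in> {1..N} \<Longrightarrow> j \<in> {1..N} \<Longrightarrow> \<exists>w. Qk k w \<and>
      (\<forall>x y. (x, y) \<in> el i j \<longrightarrow> \<bar>u x y - w x y\<bar> \<le> \<delta>) \<and>
      integral (el i j) (\<lambda>z. \<rho> (fst z) (snd z) * (u (fst z) (snd z) - w (fst z) (snd z))\<^sup>2) \<le> L i j"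
  shows "\<exists>Pu. VN k N Pu \<and>
    (\<forall>g. VN k N g \<longrightarrow> ip N xs (\<lambda>i j x y. \<rho> x y * (u x y - Pu i j x y)) g = 0) \<and>
    (\<forall>i\<in>{1..N}. \<forall>j\<in>{1..N}. \<forall>x y. (x, y) \<in> el i j \<longrightarrow> \<bar>u x y - Pu i j x y\<bar> \<le> C * \<delta>) \<and>
    ip N xs (\<lambda>i j x y. \<rho> x y * (u x y - Pu i j x y)) (\<lambda>i j x y. u x y - Pu i j x y)
      \<le> (\<Sum>i\<in>{1..N}. \<Sum>j\<in>{1..N}. L i j)"
proof -
  define good :: "nat \<Rightarrow> nat \<Rightarrow> (real \<Rightarrow> real \<Rightarrow> real) \<Rightarrow> bool" where "good = (\<lambda>i j v. Qk k v \<and>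
     (\<forall>g. Qk k g \<longrightarrow> integral (el i j) (\<lambda>z. \<rho> (fst z) (snd z) * (u (fst z) (snd z) - v (fst z) (snd z)) * g (fst z) (snd z)) = 0) \<and>
     (\<forall>x y. (x, y) \<in> el i j \<longrightarrow> \<bar>u x y - v x y\<bar> \<le> C * \<delta>) \<and>
     integral (el i j) (\<lambda>z. \<rho> (fst z) (snd z) * (u (fst z) (snd z) - v (fst z) (snd z))\<^sup>2) \<le> L i j)"
  have ex: "\<exists>v. good i j v" if ij: "i \<in> {1..N}" "j \<in> {1..N}" for i j
  proof -
    obtain w where w: "Qk k w" "\<And>x y. (x, y) \<in> el i j \<Longrightarrow> \<bar>u x y - w x y\<bar> \<le> \<delta>"
      "integral (el i j) (\<lambda>z. \<rho> (fst z) (snd z) * (u (fst z) (snd z) - w (fst z) (snd z))\<^sup>2) \<le> L i j"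
      using approx[OF ij] by blast
    have c: "continuous_on (cbox (xs (i - 1), xs (j - 1)) (xs i, xs j)) (\<lambda>z. \<rho> (fst z) (snd z))"
      "continuous_on (cbox (xs (i - 1), xs (j - 1)) (xs i, xs j)) (\<lambda>z. u (fst z) (snd z))"
      using continuous_on_subset[OF cont(1) el_subset[OF ij]] continuous_on_subset[OF cont(2) el_subset[OF ij]]
      by (simp_all only: el_def)
    have r: "\<forall>x\<in>{xs (i - 1)..xs i}. \<forall>y\<in>{xs (j - 1)..xs j}. \<rho>0 \<le> \<rho> x y \<and> \<rho> x y \<le> \<rho>1"
    proof (intro ballI)
      fix x y assume "x \<in> {xs (i - 1)..xs i}" "y \<in> {xs (j - 1)..xs j}"
      then have "(x, y) \<in> sq" using el_subset[OF ij] mem_el[of x y i j] by blast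
      then show "\<rho>0 \<le> \<rho> x y \<and> \<rho> x y \<le> \<rho>1" by (intro \<rho>) (auto simp: cbox_Pair_eq)
    qed
    obtain v where v: "Qk k v"
      "\<And>g. Qk k g \<Longrightarrow> integral (el i j) (\<lambda>z. \<rho> (fst z) (snd z) * (u (fst z) (snd z) - v (fst z) (snd z)) * g (fst z) (snd z)) = 0"
      "integral (el i j) (\<lambda>z. \<rho> (fst z) (snd z) * (u (fst z) (snd z) - v (fst z) (snd z))\<^sup>2) \<le>
        integral (el i j) (\<lambda>z. \<rho> (fst z) (snd z) * (u (fst z) (snd z) - w (fst z) (snd z))\<^sup>2)"
      "\<And>\<delta>. \<forall>x\<in>{xs (i - 1)..xs i}. \<forall>y\<in>{xs (j - 1)..xs j}. \<bar>u x y - w x y\<bar> \<le> \<delta> \<Longrightarrow>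
        \<forall>x\<in>{xs (i - 1)..xs i}. \<forall>y\<in>{xs (j - 1)..xs j}. \<bar>u x y - v x y\<bar> \<le> C * \<delta>"
      using C[unfolded projection_constant_def, THEN conjunct2, rule_format,
          OF mono[OF ij(1)] mono[OF ij(2)] c r[rule_format]] w(1) unfolding el_def by blast
    have "\<bar>u x y - v x y\<bar> \<le> C * \<delta>" if "(x, y) \<in> el i j" for x y
      using v(4)[of \<delta>] w(2) that unfolding mem_el by blast
    then have "good i j v" unfolding good_def using v(1,2) order.trans[OF v(3) w(3)] by blast
    then show ?thesis by blast
  qed
  \<comment> \<open>With the index conditions inside the existential the choice of \<open>v\<close>
    is total in both indices.\<close>
  then have "\<forall>i j. \<exists>v. i \<in> {1..N} \<longrightarrow> j \<in> {1..N} \<longrightarrow> good i j v" by blast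
  then obtain Pu0 where Pu0: "\<And>i j. i \<in> {1..N} \<Longrightarrow> j \<in> {1..N} \<Longrightarrow> good i j (Pu0 i j)"
    by metis
  then obtain Pu where Pu: "\<And>i j. i \<in> {1..N} \<Longrightarrow> j \<in> {1..N} \<Longrightarrow> Qk k (Pu i j)"
     "\<And>i j g. i \<in> {1..N} \<Longrightarrow> j \<in> {1..N} \<Longrightarrow> Qk k g \<Longrightarrow> integral (el i j) (\<lambda>z. \<rho> (fst z) (snd z) * (u (fst z) (snd z) - Pu i j (fst z) (snd z)) * g (fst z) (snd z)) = 0"
     "\<And>i j x y. i \<in> {1..N} \<Longrightarrow> j \<in> {1..N} \<Longrightarrow> (x, y) \<in> el i j \<Longrightarrow> \<bar>u x y - Pu i j x y\<bar> \<le> C * \<delta>"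
     "\<And>i j. i \<in> {1..N} \<Longrightarrow> j \<in> {1..N} \<Longrightarrow> integral (el i j) (\<lambda>z. \<rho> (fst z) (snd z) * (u (fst z) (snd z) - Pu i j (fst z) (snd z))\<^sup>2) \<le> L i j"
    unfolding good_def by blast
  have "VN k N Pu" using Pu(1) unfolding VN_def by blast
  moreover have "ip N xs (\<lambda>i j x y. \<rho> x y * (u x y - Pu i j x y)) g = 0" if "VN k N g" for g
    unfolding ip_alt using Pu(2) that unfolding VN_def by (intro sum.neutral ballI) blast
  moreover have "ip N xs (\<lambda>i j x y. \<rho> x y * (u x y - Pu i j x y)) (\<lambda>i j x y. u x y - Pu i j x y)
      \<le> (\<Sum>i\<in>{1..N}. \<Sum>j\<in>{1..N}. L i j)"
    unfolding ip_alt using Pu(4) by (intro sum_mono) (simp add: power2_eq_square mult.assoc)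
  ultimately show ?thesis using Pu(3) by blast
qed

end

section \<open>Approximation of a single component of the decomposition\<close>

context layer_mesh
begin

text \<open>Weights and derivative growth rates per direction: the index 0 stands for a smooth factor,
  1 and 2 for a layer at the left and right end of the unit interval.\<close>

definition wt :: "nat \<Rightarrow> real \<Rightarrow> real" where
  "wt r x = (if r = 0 then 1 else if r = 1 then ew x else ew (1 - x))"

definition th :: "nat \<Rightarrow> real" where
  "th r = (if r = 0 then 1 else 1 / sqrt eps)"

text \<open>Collects the constants of all later cases as summands, so that each is bounded by it. It
  depends on \<open>sg\<close>, \<open>beta\<close> and \<open>k\<close> only, which lets the final
  constant be fixed before \<open>eps\<close> and \<open>N\<close>.\<close>

definition LD :: real where
  "LD = LC + 4 * hC + hC ^ Suc k + 2 ^ Suc k + 1 / (2 * beta) * (2 ^ Suc k)\<^sup>2"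

lemma LD: "1 \<le> LD" "LC \<le> LD" "4 * hC \<le> LD" "hC ^ Suc k \<le> LD" "2 ^ Suc k \<le> LD" "1 / (2 * beta) * (2 ^ Suc k)\<^sup>2 \<le> LD"
proof -
  have "hC \<ge> 1" by (simp add: hC_def)
  moreover have "LC \<ge> 0" by (simp add: LC_def)
  moreover have "1 / (2 * beta) * (2 ^ Suc k)\<^sup>2 \<ge> 0" using beta by simp
  moreover have "(2::real) ^ Suc k \<ge> 0" "hC ^ Suc k \<ge> 0" using \<open>hC \<ge> 1\<close> by simp_all
  ultimately show "1 \<le> LD" "LC \<le> LD" "4 * hC \<le> LD" "hC ^ Suc k \<le> LD" "2 ^ Suc k \<le> LD" "1 / (2 * beta) * (2 ^ Suc k)\<^sup>2 \<le> LD"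
    unfolding LD_def by linarith+
qed

lemma th_pos: "th r > 0"
  unfolding th_def using sqrt_eps by simp

text \<open>A component of \<open>p\<close> has amplitude \<open>eps * th r\<close>, and its squared
  error gains \<open>1 / th r\<close> from the extent of the layer; the result is at most
  \<open>eps * sqrt eps\<close>, for smooth factors by \<open>eps \<le> sqrt eps\<close>.\<close>

lemma eps_th: "eps * th r \<le> sqrt eps" "(eps * th r)\<^sup>2 / th r \<le> eps * sqrt eps"
proof -
  have s: "sqrt eps * sqrt eps = eps" using eps by simp
  have "sqrt eps * sqrt eps \<le> sqrt eps * 1" using sqrt_eps by (intro mult_left_mono) linarith+
  then have e: "eps \<le> sqrt eps" using s by linarith
  show "eps * th r \<le> sqrt eps"
    unfolding th_def using s e sqrt_eps(1) by (auto simp: field_simps)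
  have "eps * eps \<le> eps * sqrt eps" using e eps by (intro mult_left_mono) auto
  moreover have "(eps / sqrt eps)\<^sup>2 * sqrt eps = eps * sqrt eps" using s sqrt_eps(1) by (simp add: power2_eq_square field_simps)
  moreover have "(eps * th r)\<^sup>2 / th r = (if r = 0 then eps * eps else (eps / sqrt eps)\<^sup>2 * sqrt eps)"
  proof -
    have "(eps * (1 / s))\<^sup>2 / (1 / s) = (eps / s)\<^sup>2 * s" for s :: real by simp
    then show ?thesis unfolding th_def by (simp add: power2_eq_square[of eps])
  qed
  ultimately show "(eps * th r)\<^sup>2 / th r \<le> eps * sqrt eps" by (simp only: split: if_split) simp
qed

lemma wt_continuous: "continuous_on S (\<lambda>z::real \<times> real. wt r (fst z))"
proof -
  consider "wt r = (\<lambda>x. 1)" | "wt r = ew" | "wt r = (\<lambda>x. ew (1 - x))"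
    unfolding wt_def[abs_def] by (cases "r = 0"; cases "r = 1") auto
  then show ?thesis using sqrt_eps(1) by cases (auto simp: ew_def intro!: continuous_intros)
qed

lemma ew_pos: "0 < ew x"
  by (simp add: ew_def)

lemma ew_le1: "0 \<le> x \<Longrightarrow> ew x \<le> 1"
  using ew_antimono[of 0 x] by (simp add: ew_def)

lemma integral_ew_square_right:
  assumes "a \<le> b"
  shows "integral {a..b} (\<lambda>x. (ew (1 - x))\<^sup>2) \<le> sqrt eps / (2 * beta) * (ew (1 - b))\<^sup>2"
proof -
  have e: "(ew x)\<^sup>2 = exp (- 2 * beta * x / sqrt eps)" for x
    unfolding ew_def by (simp add: power2_eq_square exp_add[symmetric])
  define F where "F = (\<lambda>x. (sqrt eps / (2 * beta)) * exp (- 2 * beta * (1 - x) / sqrt eps))"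
  have "((\<lambda>x. (ew (1 - x))\<^sup>2) has_integral (F b - F a)) {a..b}"
    unfolding e F_def using assms sqrt_eps(1) beta
    by (intro fundamental_theorem_of_calculus)
      (auto intro!: derivative_eq_intros simp: has_real_derivative_iff_has_vector_derivative[symmetric])
  then have "integral {a..b} (\<lambda>x. (ew (1 - x))\<^sup>2) = F b - F a" by (rule integral_unique)
  also have "\<dots> \<le> F b" unfolding F_def using sqrt_eps(1) beta by simp
  finally show ?thesis unfolding F_def e by simp
qed

text \<open>\<open>\<omega>\<close> is an upper bound of the weight on the interval, taken at the
  end nearest to the layer. A smooth factor falls under the resolved alternative on every interval;
  the right layer is reflected onto the left one. The small alternative also records the integral of
  the squared weight, where the gain \<open>1 / th r\<close> shows.\<close>

lemma wt_dichotomy: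
  assumes i: "i \<in> {1..N}"
  shows "\<exists>\<omega>. 0 \<le> \<omega> \<and> \<omega> \<le> 1 \<and> (\<forall>x\<in>{xs (i - 1)..xs i}. 0 \<le> wt r x \<and> wt r x \<le> \<omega>) \<and>
    ((xs i - xs (i - 1)) * th r \<le> LD \<and> ((xs i - xs (i - 1)) * th r) ^ Suc k * \<omega> \<le> LD * kap
     \<or> \<omega> \<le> LD * kap \<and> integral {xs (i - 1)..xs i} (\<lambda>x. (wt r x)\<^sup>2) \<le> LD / th r * kap\<^sup>2)"
proof -
  have MN: "0 < M / N" "M / N \<le> 4" using M_bounds sqrt_eps(4) by (auto simp: pos_divide_le_eq)
  have le: "xs (i - 1) \<le> xs i" using mono[OF i] by simp
  have i': "i - 1 \<le> N" "i \<le> N" using i by auto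
  have u: "0 \<le> xs (i - 1)" "xs i \<le> 1" using xs_unit[OF i'(1)] xs_unit[OF i'(2)] by auto
  have near: "H \<le> LD \<and> H ^ Suc k * \<omega> \<le> LD * kap" if "H \<le> LC \<and> H ^ Suc k * \<omega> \<le> LC * kap" for H \<omega>
    using that LD(2) mult_right_mono[OF LD(2), of kap] kap_pos by linarith
  have far: "\<omega> \<le> LD * kap \<and> sqrt eps / (2 * beta) * \<omega>\<^sup>2 \<le> LD * sqrt eps * kap\<^sup>2"
    if e: "0 \<le> \<omega>" "\<omega> \<le> 2 ^ Suc k * kap" for \<omega>
  proof
    show "\<omega> \<le> LD * kap" using e kap_pos mult_right_mono[OF LD(5), of kap] by linarith
    have "\<omega>\<^sup>2 \<le> (2 ^ Suc k * kap)\<^sup>2" using e by (intro power_mono) auto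
    then have "sqrt eps / (2 * beta) * \<omega>\<^sup>2 \<le> sqrt eps / (2 * beta) * (2 ^ Suc k * kap)\<^sup>2"
      using sqrt_eps beta by (intro mult_left_mono) auto
    also have "\<dots> = (1 / (2 * beta) * (2 ^ Suc k)\<^sup>2) * (sqrt eps * kap\<^sup>2)" by (simp add: power_mult_distrib)
    also have "\<dots> \<le> LD * (sqrt eps * kap\<^sup>2)" using LD(6) sqrt_eps by (intro mult_right_mono) auto
    finally show "sqrt eps / (2 * beta) * \<omega>\<^sup>2 \<le> LD * sqrt eps * kap\<^sup>2" by simp
  qed
  consider "r = 0" | "r = 1" | "r \<noteq> 0" "r \<noteq> 1" by blast
  then show ?thesis
  proof cases
    case 1
    let ?h = "xs i - xs (i - 1)"
    have h: "0 \<le> ?h" "?h \<le> hC * (M / N)" using le width_bounds(2)[OF i] by auto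
    have hC1: "hC \<ge> 1" by (simp add: hC_def)
    have "hC * (M / N) \<le> hC * 4" using MN hC1 by (intro mult_left_mono) auto
    then have a: "?h * th r \<le> LD" using h LD(3) 1 by (simp add: th_def)
    have "(?h * th r) ^ Suc k \<le> (hC * (M / N)) ^ Suc k" using h 1 by (intro power_mono) (auto simp: th_def)
    also have "\<dots> = hC ^ Suc k * kap" unfolding kap_def by (rule power_mult_distrib)
    also have "\<dots> \<le> LD * kap" using LD(4) kap_pos by (intro mult_right_mono) auto
    finally have "(?h * th r) ^ Suc k * 1 \<le> LD * kap" by simp
    then show ?thesis using a 1 by (intro exI[of _ 1]) (auto simp: wt_def)
  next
    case 2
    have w: "wt r x = ew x" for x using 2 by (simp add: wt_def)
    have t: "th r = 1 / sqrt eps" using 2 by (simp add: th_def)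
    let ?\<omega> = "ew (xs (i - 1))"
    have "integral {xs (i - 1)..xs i} (\<lambda>x. (ew x)\<^sup>2) \<le> LD * sqrt eps * kap\<^sup>2" if "?\<omega> \<le> 2 ^ Suc k * kap"
      using integral_ew_square[OF le] far[OF less_imp_le[OF ew_pos] that] by linarith
    then show ?thesis
      using layer_dichotomy[OF i] near[of "(xs i - xs (i - 1)) / sqrt eps" ?\<omega>] far[OF less_imp_le[OF ew_pos], of "xs (i - 1)"]
        ew_le1[OF u(1)] ew_pos less_imp_le[OF ew_pos] ew_antimono
      unfolding w t by (intro exI[of _ ?\<omega>]) auto
  next
    case 3
    have w: "wt r x = ew (1 - x)" for x using 3 by (simp add: wt_def)
    have t: "th r = 1 / sqrt eps" using 3 by (simp add: th_def)
    let ?\<omega> = "ew (1 - xs i)"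
    \<comment> \<open>The mirror image of interval \<open>i\<close>: its left end corresponds to
      \<open>xs i\<close>, hence the shift by one.\<close>
    define l where "l = Suc (N - i)"
    have l: "l \<in> {1..N}" "l - 1 = N - i" "l = N - (i - 1)" using i by (auto simp: l_def)
    have lx: "xs (l - 1) = 1 - xs i" "xs l = 1 - xs (i - 1)"
      using xs_reflect[OF i'(2)] xs_reflect[OF i'(1)] l by auto
    have "integral {xs (i - 1)..xs i} (\<lambda>x. (ew (1 - x))\<^sup>2) \<le> LD * sqrt eps * kap\<^sup>2" if "?\<omega> \<le> 2 ^ Suc k * kap"
      using integral_ew_square_right[OF le] far[OF less_imp_le[OF ew_pos] that] by linarith
    moreover have "0 \<le> 1 - xs i" using u by simp
    ultimately show ?thesis
      using layer_dichotomy[OF l(1)] near[of "(xs i - xs (i - 1)) / sqrt eps" ?\<omega>] far[OF less_imp_le[OF ew_pos], of "1 - xs i"]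
        ew_le1[of "1 - xs i"] ew_pos less_imp_le[OF ew_pos] ew_antimono
      unfolding w t lx by (intro exI[of _ ?\<omega>]) auto
  qed
qed

text \<open>The first \<open>LD\<close> is the remainder in \<open>y\<close>. The product bounds the
  \<open>k + 1\<close> summands of the remainder in \<open>x\<close>, each carrying a power of the
  scaled height of at most \<open>LD ^ k\<close>.\<close>

definition CA :: real where "CA = LD + (real k + 1) * LD ^ k * LD"

lemma CA: "LD \<le> CA" "1 \<le> CA"
proof -
  have "0 \<le> (real k + 1) * LD ^ k * LD" using LD(1) by simp
  then show "LD \<le> CA" "1 \<le> CA" unfolding CA_def using LD(1) by linarith+
qed

text \<open>The zero function is used as soon as the layer is small in one direction, the Taylor
  polynomial when both directions are resolved. The integral bound carries \<open>1 / th r\<close>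
  in place of the width in \<open>x\<close>; this gain is needed for \<open>p\<close>, and its sum
  over the columns costs a factor \<open>N\<close>.\<close>

lemma component_approx:
  assumes D: "smooth_family (Suc k) D" and A: "A \<ge> 0"
    and bound: "\<And>a b x y. a \<le> Suc k \<Longrightarrow> b \<le> Suc k \<Longrightarrow> x \<in> {0..1} \<Longrightarrow> y \<in> {0..1} \<Longrightarrow>
      \<bar>D a b x y\<bar> \<le> A * th r ^ a * th s ^ b * (wt r x * wt s y)"
    and i: "i \<in> {1..N}" and j: "j \<in> {1..N}"
  shows "\<exists>v. Qk k v \<and> (\<forall>x y. (x, y) \<in> el i j \<longrightarrow> \<bar>D 0 0 x y - v x y\<bar> \<le> A * CA * kap) \<and>
    integral (el i j) (\<lambda>z. (D 0 0 (fst z) (snd z) - v (fst z) (snd z))\<^sup>2)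
      \<le> A\<^sup>2 * (CA\<^sup>2 * LD) / th r * kap\<^sup>2 * (xs j - xs (j - 1))"
proof -
  let ?h1 = "xs i - xs (i - 1)" and ?h2 = "xs j - xs (j - 1)"
  obtain \<omega>1 where w1: "0 \<le> \<omega>1" "\<omega>1 \<le> 1" "\<And>x. x \<in> {xs (i - 1)..xs i} \<Longrightarrow> 0 \<le> wt r x \<and> wt r x \<le> \<omega>1"
    and d1: "?h1 * th r \<le> LD \<and> (?h1 * th r) ^ Suc k * \<omega>1 \<le> LD * kap
     \<or> \<omega>1 \<le> LD * kap \<and> integral {xs (i - 1)..xs i} (\<lambda>x. (wt r x)\<^sup>2) \<le> LD / th r * kap\<^sup>2"
    using wt_dichotomy[OF i, of r] by blast
  obtain \<omega>2 where w2: "0 \<le> \<omega>2" "\<omega>2 \<le> 1" "\<And>y. y \<in> {xs (j - 1)..xs j} \<Longrightarrow> 0 \<le> wt s y \<and> wt s y \<le> \<omega>2"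
    and d2: "?h2 * th s \<le> LD \<and> (?h2 * th s) ^ Suc k * \<omega>2 \<le> LD * kap
     \<or> \<omega>2 \<le> LD * kap \<and> integral {xs (j - 1)..xs j} (\<lambda>x. (wt s x)\<^sup>2) \<le> LD / th s * kap\<^sup>2"
    using wt_dichotomy[OF j, of s] by blast
  have h: "0 < ?h1" "0 < ?h2" using mono[OF i] mono[OF j] by auto
  have ij': "i - 1 \<le> N" "i \<le> N" "j - 1 \<le> N" "j \<le> N" using i j by auto
  have unit: "0 \<le> xs (i - 1)" "xs i \<le> 1" "0 \<le> xs (j - 1)" "xs j \<le> 1"
    using xs_unit[OF ij'(1)] xs_unit[OF ij'(2)] xs_unit[OF ij'(3)] xs_unit[OF ij'(4)] by auto
  have elu: "x \<in> {0..1} \<and> y \<in> {0..1}" if "(x, y) \<in> el i j" for x y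
    using that unit unfolding mem_el by auto
  have bd: "\<bar>D a b x y\<bar> \<le> A * \<omega>1 * \<omega>2 * th r ^ a * th s ^ b"
    if "a \<le> Suc k" "b \<le> Suc k" "x \<in> {xs (i - 1)..xs i}" "y \<in> {xs (j - 1)..xs j}" for a b x y
  proof -
    have "(x, y) \<in> el i j" using that by (simp add: mem_el)
    then have "\<bar>D a b x y\<bar> \<le> A * th r ^ a * th s ^ b * (wt r x * wt s y)" using bound that elu by blast
    also have "\<dots> \<le> A * th r ^ a * th s ^ b * (\<omega>1 * \<omega>2)"
      using w1(1) w1(3)[OF that(3)] w2(3)[OF that(4)] A th_pos[of r] th_pos[of s]
      by (intro mult_left_mono mult_mono) auto
    finally show ?thesis by (simp add: mult_ac)
  qed
  have contD: "continuous_on (el i j) (\<lambda>z. D 0 0 (fst z) (snd z))"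
    using smooth_familyD(1)[OF D, of 0 0] el_subset[OF i j] continuous_on_subset by blast
  have sup_L2: "integral (el i j) (\<lambda>z. (D 0 0 (fst z) (snd z) - v (fst z) (snd z))\<^sup>2) \<le> A\<^sup>2 * (CA\<^sup>2 * LD) / th r * kap\<^sup>2 * ?h2"
    if v: "Qk k v" and sup: "\<And>x y. (x, y) \<in> el i j \<Longrightarrow> \<bar>D 0 0 x y - v x y\<bar> \<le> A * CA * kap" and near: "?h1 * th r \<le> LD" for v
  proof -
    have "integral (cbox (xs (i - 1), xs (j - 1)) (xs i, xs j)) (\<lambda>z. (D 0 0 (fst z) (snd z) - v (fst z) (snd z))\<^sup>2)
       \<le> (A * CA * kap)\<^sup>2 * (?h1 * ?h2)"
    proof (rule integral_pair_bounds)
      show "continuous_on (cbox (xs (i - 1), xs (j - 1)) (xs i, xs j)) (\<lambda>z. (D 0 0 (fst z) (snd z) - v (fst z) (snd z))\<^sup>2)"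
        using contD unfolding el_def by (intro continuous_intros Qk_continuous[OF v])
      fix x y assume "x \<in> {xs (i - 1)..xs i}" "y \<in> {xs (j - 1)..xs j}"
      then have "\<bar>D 0 0 x y - v x y\<bar> \<le> A * CA * kap" using sup by (simp add: mem_el)
      then show "(D 0 0 (fst (x, y)) (snd (x, y)) - v (fst (x, y)) (snd (x, y)))\<^sup>2 \<le> (A * CA * kap)\<^sup>2"
        by (simp add: abs_le_square_iff[symmetric])
    qed (use h in auto)
    \<comment> \<open>In the resolved case the gain \<open>1 / th r\<close> is nothing but the width
      of the cell, which is at most \<open>LD / th r\<close>.\<close>
    also have "\<dots> \<le> (A * CA * kap)\<^sup>2 * (LD / th r * ?h2)"
      using near h th_pos[of r] by (intro mult_left_mono mult_right_mono) (auto simp: pos_le_divide_eq)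
    finally show ?thesis unfolding el_def by (simp add: power_mult_distrib mult_ac)
  qed
  have zero_sup: "\<bar>D 0 0 x y - 0\<bar> \<le> A * CA * kap" if xy: "(x, y) \<in> el i j" and small: "\<omega>1 \<le> LD * kap \<or> \<omega>2 \<le> LD * kap" for x y
  proof -
    have "\<omega>1 * \<omega>2 \<le> LD * kap"
      using small w1(1,2) w2(1,2) mult_left_le[of \<omega>2 \<omega>1] mult_left_le[of \<omega>1 \<omega>2] by (auto simp: mult.commute)
    also have "\<dots> \<le> CA * kap" using CA kap_pos by (intro mult_right_mono) auto
    finally have "A * (\<omega>1 * \<omega>2) \<le> A * (CA * kap)" using A by (rule mult_left_mono)
    moreover have "\<bar>D 0 0 x y\<bar> \<le> A * \<omega>1 * \<omega>2" using bd[of 0 0 x y] xy by (simp add: mem_el)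
    ultimately show ?thesis by (simp add: mult.assoc)
  qed
  \<comment> \<open>Smallness in \<open>x\<close> is tested before that in \<open>y\<close>: it
    supplies the integral of the squared weight across the layer. In the two other cases the width
    in \<open>x\<close> is bounded instead.\<close>
  consider "\<omega>1 \<le> LD * kap" "integral {xs (i - 1)..xs i} (\<lambda>x. (wt r x)\<^sup>2) \<le> LD / th r * kap\<^sup>2"
    | "?h1 * th r \<le> LD" "\<omega>2 \<le> LD * kap"
    | "?h1 * th r \<le> LD" "(?h1 * th r) ^ Suc k * \<omega>1 \<le> LD * kap" "?h2 * th s \<le> LD" "(?h2 * th s) ^ Suc k * \<omega>2 \<le> LD * kap"
    using d1 d2 by blast
  then show ?thesis
  proof cases
    case 1
    have "integral (el i j) (\<lambda>z. (D 0 0 (fst z) (snd z))\<^sup>2) \<le> integral (el i j) (\<lambda>z. A\<^sup>2 * (wt r (fst z))\<^sup>2)"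
      unfolding el_def
    proof (intro integral_le integrable_continuous)
      show "continuous_on (cbox (xs (i - 1), xs (j - 1)) (xs i, xs j)) (\<lambda>z. (D 0 0 (fst z) (snd z))\<^sup>2)"
        using contD unfolding el_def by (intro continuous_intros)
      show "continuous_on (cbox (xs (i - 1), xs (j - 1)) (xs i, xs j)) (\<lambda>z. A\<^sup>2 * (wt r (fst z))\<^sup>2)"
        by (intro continuous_intros wt_continuous)
      fix z assume "z \<in> cbox (xs (i - 1), xs (j - 1)) (xs i, xs j)"
      then obtain x y where z: "z = (x, y)" "(x, y) \<in> el i j" by (cases z) (auto simp: el_def)
      then have xy: "x \<in> {xs (i - 1)..xs i}" "y \<in> {xs (j - 1)..xs j}" by (auto simp: mem_el)
      have "\<bar>D 0 0 x y\<bar> \<le> A * (wt r x * wt s y)" using bound[of 0 0 x y] elu[OF z(2)] by simp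
      also have "\<dots> \<le> A * (wt r x * 1)"
        using A w1(3)[OF xy(1)] w2(3)[OF xy(2)] w2(2) by (intro mult_left_mono) auto
      finally have "\<bar>D 0 0 x y\<bar>\<^sup>2 \<le> (A * wt r x)\<^sup>2" by (intro power_mono) auto
      then show "(D 0 0 (fst z) (snd z))\<^sup>2 \<le> A\<^sup>2 * (wt r (fst z))\<^sup>2" by (simp add: z power_mult_distrib)
    qed
    also have "\<dots> = A\<^sup>2 * integral {xs (i - 1)..xs i} (\<lambda>x. (wt r x)\<^sup>2) * ?h2"
    proof -
      have "continuous_on (cbox (xs (i - 1), xs (j - 1)) (xs i, xs j)) (\<lambda>z. A\<^sup>2 * (wt r (fst z))\<^sup>2)"
        by (intro continuous_intros wt_continuous)
      from integral_prod_continuous[OF this] show ?thesis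
        unfolding el_def using h by (simp add: mult_ac)
    qed
    also have "\<dots> \<le> A\<^sup>2 * (LD / th r * kap\<^sup>2) * ?h2"
      using 1(2) h by (intro mult_right_mono mult_left_mono) auto
    also have "\<dots> \<le> A\<^sup>2 * (CA\<^sup>2 * LD / th r * kap\<^sup>2) * ?h2"
    proof -
      have "LD / th r * kap\<^sup>2 * 1 \<le> LD / th r * kap\<^sup>2 * CA\<^sup>2"
        using CA(2) LD(1) th_pos[of r] by (intro mult_left_mono) (auto simp: one_le_power)
      then have *: "LD / th r * kap\<^sup>2 \<le> CA\<^sup>2 * LD / th r * kap\<^sup>2" by (simp add: mult_ac)
      show ?thesis using h by (intro mult_right_mono mult_left_mono *) auto
    qed
    finally show ?thesis using zero_sup 1(1) Qk_zero by (intro exI[of _ "\<lambda>x y. 0"]) (auto simp: mult_ac)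
  next
    case 2
    then show ?thesis using zero_sup sup_L2[OF Qk_zero] Qk_zero by (intro exI[of _ "\<lambda>x y. 0"]) auto
  next
    case 3
    obtain v where v: "Qk k v" and tay: "\<forall>x\<in>{xs (i - 1)..xs i}. \<forall>y\<in>{xs (j - 1)..xs j}. \<bar>D 0 0 x y - v x y\<bar> \<le>
      A * \<omega>1 * \<omega>2 * ((?h2 * th s) ^ Suc k + (\<Sum>b\<le>k. (?h2 * th s) ^ b) * (?h1 * th r) ^ Suc k)"
    proof -
      have "\<exists>v. Qk k v \<and> (\<forall>x\<in>{xs (i - 1)..xs i}. \<forall>y\<in>{xs (j - 1)..xs j}. \<bar>D 0 0 x y - v x y\<bar> \<le>
        A * \<omega>1 * \<omega>2 * ((?h2 * th s) ^ Suc k + (\<Sum>b\<le>k. (?h2 * th s) ^ b) * (?h1 * th r) ^ Suc k))"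
      proof (rule taylor_Qk[OF D])
        show "\<bar>D a b x y\<bar> \<le> A * \<omega>1 * \<omega>2 * th r ^ a * th s ^ b"
          if "a \<le> Suc k" "b \<le> Suc k" "x \<in> {xs (i - 1)..xs i}" "y \<in> {xs (j - 1)..xs j}" for a b x y
          using bd that .
        show "0 \<le> A * \<omega>1 * \<omega>2" using A w1(1) w2(1) by simp
      qed (use unit h th_pos[of r] th_pos[of s] in simp_all)
      then show ?thesis using that by blast
    qed
    have sup: "\<bar>D 0 0 x y - v x y\<bar> \<le> A * CA * kap" if xy: "(x, y) \<in> el i j" for x y
    proof -
      have pos: "0 \<le> ?h1 * th r" "0 \<le> ?h2 * th s" using h th_pos[of r] th_pos[of s] by auto
      have S: "(\<Sum>b\<le>k. (?h2 * th s) ^ b) \<le> (real k + 1) * LD ^ k"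
      proof -
        have "(?h2 * th s) ^ b \<le> LD ^ k" if "b \<le> k" for b
        proof -
          have "(?h2 * th s) ^ b \<le> LD ^ b" using 3(3) pos by (intro power_mono) auto
          also have "\<dots> \<le> LD ^ k" using that LD(1) by (intro power_increasing) auto
          finally show ?thesis .
        qed
        then have "(\<Sum>b\<le>k. (?h2 * th s) ^ b) \<le> (\<Sum>b\<le>k. LD ^ k)" by (intro sum_mono) auto
        then show ?thesis by (simp add: add.commute)
      qed
      have y: "\<omega>1 * ((?h2 * th s) ^ Suc k * \<omega>2) \<le> 1 * (LD * kap)"
        by (rule mult_mono[OF w1(2) 3(4)]) (use pos w2(1) in auto)
      have "((\<Sum>b\<le>k. (?h2 * th s) ^ b) * ((?h1 * th r) ^ Suc k * \<omega>1)) * \<omega>2 \<le> ((real k + 1) * LD ^ k * (LD * kap)) * 1"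
        by (rule mult_mono[OF mult_mono[OF S 3(2)] w2(2)])
          (use w1(1) w2(1) pos LD(1) kap_pos in \<open>auto intro!: sum_nonneg mult_nonneg_nonneg\<close>)
      then have "\<omega>1 * \<omega>2 * ((?h2 * th s) ^ Suc k + (\<Sum>b\<le>k. (?h2 * th s) ^ b) * (?h1 * th r) ^ Suc k)
        \<le> LD * kap + (real k + 1) * LD ^ k * (LD * kap)"
        using y by (simp add: distrib_left mult_ac)
      also have "\<dots> = CA * kap" unfolding CA_def by (simp add: algebra_simps)
      finally have "A * (\<omega>1 * \<omega>2 * ((?h2 * th s) ^ Suc k + (\<Sum>b\<le>k. (?h2 * th s) ^ b) * (?h1 * th r) ^ Suc k)) \<le> A * (CA * kap)"
        using A by (rule mult_left_mono)
      moreover have "\<bar>D 0 0 x y - v x y\<bar> \<le> A * \<omega>1 * \<omega>2 * ((?h2 * th s) ^ Suc k + (\<Sum>b\<le>k. (?h2 * th s) ^ b) * (?h1 * th r) ^ Suc k)"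
        using tay xy unfolding mem_el by blast
      ultimately show ?thesis by (simp only: mult.assoc)
    qed
    then show ?thesis using v sup_L2[OF v sup 3(1)] by blast
  qed
qed

end

section \<open>Superposition of the nine components and projection of the exact triple\<close>

context layer_mesh
begin

text \<open>Regular part, four edge layers and four corner layers are the nine combinations of
  smooth, left and right behaviour in the two directions. One derivative order beyond
  \<open>Suc k\<close> is kept, since \<open>p\<close> and \<open>q\<close> use up a
  derivative.\<close>

definition layered :: "real \<Rightarrow> (nat \<Rightarrow> nat \<Rightarrow> nat \<Rightarrow> nat \<Rightarrow> real \<Rightarrow> real \<Rightarrow> real) \<Rightarrow> bool" where
  "layered A D \<longleftrightarrow> 0 \<le> A \<and> (\<forall>r<3. \<forall>s<3. smooth_family (Suc (Suc k)) (D r s) \<and>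
     (\<forall>i\<le>Suc (Suc k). \<forall>j\<le>Suc (Suc k). \<forall>x\<in>{0..1}. \<forall>y\<in>{0..1}.
        \<bar>D r s i j x y\<bar> \<le> A * th r ^ i * th s ^ j * (wt r x * wt s y)))"

definition superpos :: "(nat \<Rightarrow> nat \<Rightarrow> nat \<Rightarrow> nat \<Rightarrow> real \<Rightarrow> real \<Rightarrow> real) \<Rightarrow> nat \<Rightarrow> nat \<Rightarrow> real \<Rightarrow> real \<Rightarrow> real" where
  "superpos D i j x y = (\<Sum>g\<in>{..<3} \<times> {..<3}. D (fst g) (snd g) i j x y)"

lemma layeredD:
  assumes "layered A D" "r < 3" "s < 3"
  shows "0 \<le> A" "smooth_family (Suc (Suc k)) (D r s)"
    "i \<le> Suc (Suc k) \<Longrightarrow> j \<le> Suc (Suc k) \<Longrightarrow> x \<in> {0..1} \<Longrightarrow> y \<in> {0..1} \<Longrightarrow>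
      \<bar>D r s i j x y\<bar> \<le> A * th r ^ i * th s ^ j * (wt r x * wt s y)"
  using assms unfolding layered_def by auto

lemma layered_swap: "layered A D \<Longrightarrow> layered A (\<lambda>r s i j x y. D s r j i y x)"
proof -
  assume L: "layered A D"
  show ?thesis unfolding layered_def
  proof (intro conjI allI impI ballI)
    show "0 \<le> A" using L unfolding layered_def by blast
    fix r s :: nat assume rs: "r < 3" "s < 3"
    show "smooth_family (Suc (Suc k)) (\<lambda>i j x y. D s r j i y x)"
      by (rule smooth_family_swap[OF layeredD(2)[OF L rs(2,1)]])
    fix i j and x y :: real
    assume "i \<le> Suc (Suc k)" "j \<le> Suc (Suc k)" "x \<in> {0..1}" "y \<in> {0..1}"
    then show "\<bar>D s r j i y x\<bar> \<le> A * th r ^ i * th s ^ j * (wt r x * wt s y)"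
      using layeredD(3)[OF L rs(2,1), of j i y x] by (simp only: mult_ac)
  qed
qed

lemma superpos_swap: "superpos (\<lambda>r s i j x y. D s r j i y x) i j x y = superpos D j i y x"
  unfolding superpos_def by (rule sum.reindex_bij_witness[of _ prod.swap prod.swap]) auto

lemma smooth_family_superpos: "layered A D \<Longrightarrow> smooth_family (Suc (Suc k)) (superpos D)"
  unfolding superpos_def[abs_def] by (rule smooth_family_sum) (auto intro: layeredD(2))

lemma solution_approx:
  assumes L: "layered A D" and i: "i \<in> {1..N}" and j: "j \<in> {1..N}"
  shows "\<exists>v. Qk k v \<and> (\<forall>x y. (x, y) \<in> el i j \<longrightarrow> \<bar>superpos D 0 0 x y - v x y\<bar> \<le> 9 * A * CA * kap)"
proof -
  let ?G = "{..<3::nat} \<times> {..<3::nat}"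
  have "\<exists>v. Qk k v \<and> (\<forall>x y. (x, y) \<in> el i j \<longrightarrow> \<bar>D (fst g) (snd g) 0 0 x y - v x y\<bar> \<le> A * CA * kap)"
    if g: "g \<in> ?G" for g
  proof -
    have rs: "fst g < 3" "snd g < 3" using g by auto
    have "smooth_family (Suc k) (D (fst g) (snd g))"
      using smooth_family_mono[OF layeredD(2)[OF L rs]] by simp
    from component_approx[OF this layeredD(1)[OF L rs] layeredD(3)[OF L rs] i j] show ?thesis by auto
  qed
  then obtain v where v: "\<And>g. g \<in> ?G \<Longrightarrow> Qk k (v g)"
    "\<And>g x y. g \<in> ?G \<Longrightarrow> (x, y) \<in> el i j \<Longrightarrow> \<bar>D (fst g) (snd g) 0 0 x y - v g x y\<bar> \<le> A * CA * kap"
    by metis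
  have "\<bar>superpos D 0 0 x y - (\<Sum>g\<in>?G. v g x y)\<bar> \<le> 9 * A * CA * kap" if "(x, y) \<in> el i j" for x y
  proof -
    have "\<bar>superpos D 0 0 x y - (\<Sum>g\<in>?G. v g x y)\<bar> \<le> (\<Sum>g\<in>?G. \<bar>D (fst g) (snd g) 0 0 x y - v g x y\<bar>)"
      unfolding superpos_def sum_subtractf[symmetric] by (rule sum_abs)
    also have "\<dots> \<le> (\<Sum>g\<in>?G. A * CA * kap)" using v(2) that by (intro sum_mono) blast
    finally show ?thesis by (simp add: mult.assoc)
  qed
  moreover have "Qk k (\<lambda>x y. \<Sum>g\<in>?G. v g x y)" using v(1) by (intro Qk_sum) auto
  ultimately show ?thesis by blast
qed

text \<open>The single-component estimate is applied to the shifted family of \<open>eps\<close>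
  times the \<open>x\<close>-derivative. Of the factor 81, one 9 is Cauchy-Schwarz for the sum of
  components, the other their number.\<close>

lemma gradient_approx:
  assumes L: "layered A D" and i: "i \<in> {1..N}" and j: "j \<in> {1..N}"
  shows "\<exists>v. Qk k v \<and> (\<forall>x y. (x, y) \<in> el i j \<longrightarrow> \<bar>eps * superpos D 1 0 x y - v x y\<bar> \<le> 9 * A * CA * (sqrt eps * kap)) \<and>
    integral (el i j) (\<lambda>z. 1 * (eps * superpos D 1 0 (fst z) (snd z) - v (fst z) (snd z))\<^sup>2)
      \<le> 81 * A\<^sup>2 * (CA\<^sup>2 * LD) * (eps * sqrt eps) * kap\<^sup>2 * (xs j - xs (j - 1))"
proof -
  let ?G = "{..<3::nat} \<times> {..<3::nat}"
  define L2 where "L2 = A\<^sup>2 * (CA\<^sup>2 * LD) * (eps * sqrt eps) * kap\<^sup>2 * (xs j - xs (j - 1))"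
  have h: "0 < xs j - xs (j - 1)" using mono[OF j] by simp
  have "\<exists>v. Qk k v \<and> (\<forall>x y. (x, y) \<in> el i j \<longrightarrow> \<bar>eps * D (fst g) (snd g) 1 0 x y - v x y\<bar> \<le> A * CA * (sqrt eps * kap)) \<and>
      integral (el i j) (\<lambda>z. (eps * D (fst g) (snd g) 1 0 (fst z) (snd z) - v (fst z) (snd z))\<^sup>2) \<le> L2"
    if g: "g \<in> ?G" for g
  proof -
    define r s where "r = fst g" and "s = snd g"
    have rs: "r < 3" "s < 3" using g by (auto simp: r_def s_def)
    \<comment> \<open>One derivative contributes a factor \<open>th r\<close> to the amplitude,
      which \<open>eps\<close> compensates down to at most \<open>sqrt eps\<close>.\<close>
    define B where "B = A * (eps * th r)"
    have A: "A \<ge> 0" using layeredD(1)[OF L rs] .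
    have B: "0 \<le> B" using A eps th_pos[of r] by (simp add: B_def)
    have bd: "\<bar>eps * D r s (Suc a) b x y\<bar> \<le> B * th r ^ a * th s ^ b * (wt r x * wt s y)"
      if "a \<le> Suc k" "b \<le> Suc k" "x \<in> {0..1}" "y \<in> {0..1}" for a b x y
    proof -
      have "\<bar>D r s (Suc a) b x y\<bar> \<le> A * th r ^ Suc a * th s ^ b * (wt r x * wt s y)"
        using that by (intro layeredD(3)[OF L rs]) auto
      then have "eps * \<bar>D r s (Suc a) b x y\<bar> \<le> eps * (A * th r ^ Suc a * th s ^ b * (wt r x * wt s y))"
        using eps by (intro mult_left_mono) auto
      then show ?thesis using eps by (simp add: B_def abs_mult mult_ac)
    qed
    obtain v where v: "Qk k v" "\<And>x y. (x, y) \<in> el i j \<Longrightarrow> \<bar>eps * D r s (Suc 0) 0 x y - v x y\<bar> \<le> B * CA * kap"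
      "integral (el i j) (\<lambda>z. (eps * D r s (Suc 0) 0 (fst z) (snd z) - v (fst z) (snd z))\<^sup>2)
      \<le> B\<^sup>2 * (CA\<^sup>2 * LD) / th r * kap\<^sup>2 * (xs j - xs (j - 1))"
      using component_approx[OF smooth_family_shift[OF layeredD(2)[OF L rs], of eps] B bd i j] by blast
    have CAk: "0 \<le> CA * kap" using CA kap_pos by simp
    have "B * (CA * kap) \<le> A * sqrt eps * (CA * kap)"
      unfolding B_def using eps_th(1)[of r] A by (intro mult_right_mono[OF _ CAk] mult_left_mono) auto
    then have 1: "B * CA * kap \<le> A * CA * (sqrt eps * kap)" by (simp add: mult_ac)
    have "B\<^sup>2 * (CA\<^sup>2 * LD) / th r * kap\<^sup>2 * (xs j - xs (j - 1)) =
      ((eps * th r)\<^sup>2 / th r) * (A\<^sup>2 * (CA\<^sup>2 * LD) * kap\<^sup>2 * (xs j - xs (j - 1)))"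
      unfolding B_def by (simp add: power_mult_distrib)
    also have "\<dots> \<le> (eps * sqrt eps) * (A\<^sup>2 * (CA\<^sup>2 * LD) * kap\<^sup>2 * (xs j - xs (j - 1)))"
      using LD(1) h by (intro mult_right_mono[OF eps_th(2)]) auto
    also have "\<dots> = L2" unfolding L2_def by (simp add: mult_ac)
    finally have 2: "B\<^sup>2 * (CA\<^sup>2 * LD) / th r * kap\<^sup>2 * (xs j - xs (j - 1)) \<le> L2" .
    have "\<forall>x y. (x, y) \<in> el i j \<longrightarrow> \<bar>eps * D r s 1 0 x y - v x y\<bar> \<le> A * CA * (sqrt eps * kap)"
      using v(2) 1 by (auto intro: order.trans)
    moreover have "integral (el i j) (\<lambda>z. (eps * D r s 1 0 (fst z) (snd z) - v (fst z) (snd z))\<^sup>2) \<le> L2"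
      using v(3) 2 by simp
    ultimately show ?thesis using v(1) unfolding r_def s_def by blast
  qed
  then have "\<forall>g\<in>?G. \<exists>v. Qk k v \<and> (\<forall>x y. (x, y) \<in> el i j \<longrightarrow> \<bar>eps * D (fst g) (snd g) 1 0 x y - v x y\<bar> \<le> A * CA * (sqrt eps * kap)) \<and>
      integral (el i j) (\<lambda>z. (eps * D (fst g) (snd g) 1 0 (fst z) (snd z) - v (fst z) (snd z))\<^sup>2) \<le> L2"
    by (rule ballI)
  from bchoice[OF this] obtain v where v0: "\<forall>g\<in>?G. Qk k (v g) \<and> (\<forall>x y. (x, y) \<in> el i j \<longrightarrow> \<bar>eps * D (fst g) (snd g) 1 0 x y - v g x y\<bar> \<le> A * CA * (sqrt eps * kap)) \<and>
      integral (el i j) (\<lambda>z. (eps * D (fst g) (snd g) 1 0 (fst z) (snd z) - v g (fst z) (snd z))\<^sup>2) \<le> L2" ..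
  have v: "Qk k (v g)"
    "(x, y) \<in> el i j \<Longrightarrow> \<bar>eps * D (fst g) (snd g) 1 0 x y - v g x y\<bar> \<le> A * CA * (sqrt eps * kap)"
    "integral (el i j) (\<lambda>z. (eps * D (fst g) (snd g) 1 0 (fst z) (snd z) - v g (fst z) (snd z))\<^sup>2) \<le> L2"
    if "g \<in> ?G" for g x y
    using bspec[OF v0 that] by simp_all
  have eq: "eps * superpos D 1 0 x y - (\<Sum>g\<in>?G. v g x y) = (\<Sum>g\<in>?G. eps * D (fst g) (snd g) 1 0 x y - v g x y)" for x y
    unfolding superpos_def by (simp add: sum_subtractf sum_distrib_left)
  have "\<bar>eps * superpos D 1 0 x y - (\<Sum>g\<in>?G. v g x y)\<bar> \<le> 9 * A * CA * (sqrt eps * kap)" if "(x, y) \<in> el i j" for x y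
  proof -
    have "\<bar>eps * superpos D 1 0 x y - (\<Sum>g\<in>?G. v g x y)\<bar> \<le> (\<Sum>g\<in>?G. \<bar>eps * D (fst g) (snd g) 1 0 x y - v g x y\<bar>)"
      unfolding eq by (rule sum_abs)
    also have "\<dots> \<le> (\<Sum>g\<in>?G. A * CA * (sqrt eps * kap))" using v(2) that by (intro sum_mono) blast
    finally show ?thesis by (simp add: mult.assoc)
  qed
  moreover have "integral (el i j) (\<lambda>z. 1 * (eps * superpos D 1 0 (fst z) (snd z) - (\<Sum>g\<in>?G. v g (fst z) (snd z)))\<^sup>2) \<le> 81 * L2"
  proof -
    have int: "(\<lambda>z. (eps * D (fst g) (snd g) 1 0 (fst z) (snd z) - v g (fst z) (snd z))\<^sup>2) integrable_on el i j" if g: "g \<in> ?G" for g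
    proof -
      have rs: "fst g < 3" "snd g < 3" using g by auto
      have "continuous_on (el i j) (\<lambda>z. D (fst g) (snd g) 1 0 (fst z) (snd z))"
        using smooth_familyD(1)[OF layeredD(2)[OF L rs], of 1 0] el_subset[OF i j] continuous_on_subset by force
      then show ?thesis unfolding el_def by (intro integrable_continuous continuous_intros Qk_continuous[OF v(1)[OF g]])
    qed
    \<comment> \<open>Squares of the nine component errors are added by Cauchy-Schwarz before
      integrating, so each keeps its own gain across its layer.\<close>
    have "integral (el i j) (\<lambda>z. 1 * (eps * superpos D 1 0 (fst z) (snd z) - (\<Sum>g\<in>?G. v g (fst z) (snd z)))\<^sup>2)
      \<le> integral (el i j) (\<lambda>z. 9 * (\<Sum>g\<in>?G. (eps * D (fst g) (snd g) 1 0 (fst z) (snd z) - v g (fst z) (snd z))\<^sup>2))"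
    proof (rule integral_le)
      have "continuous_on (el i j) (\<lambda>z. superpos D 1 0 (fst z) (snd z))"
        using smooth_familyD(1)[OF smooth_family_superpos[OF L], of 1 0] el_subset[OF i j] continuous_on_subset by force
      moreover have "continuous_on (el i j) (\<lambda>z. \<Sum>g\<in>?G. v g (fst z) (snd z))"
        by (intro continuous_on_sum Qk_continuous[OF v(1)])
      ultimately show "(\<lambda>z. 1 * (eps * superpos D 1 0 (fst z) (snd z) - (\<Sum>g\<in>?G. v g (fst z) (snd z)))\<^sup>2) integrable_on el i j"
        unfolding el_def
        by (intro integrable_continuous continuous_on_mult continuous_on_power continuous_on_diff continuous_on_const) simp_all
      show "(\<lambda>z. 9 * (\<Sum>g\<in>?G. (eps * D (fst g) (snd g) 1 0 (fst z) (snd z) - v g (fst z) (snd z))\<^sup>2)) integrable_on el i j"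
        by (intro integrable_on_mult_right integrable_sum int) auto
      fix z
      show "1 * (eps * superpos D 1 0 (fst z) (snd z) - (\<Sum>g\<in>?G. v g (fst z) (snd z)))\<^sup>2
        \<le> 9 * (\<Sum>g\<in>?G. (eps * D (fst g) (snd g) 1 0 (fst z) (snd z) - v g (fst z) (snd z))\<^sup>2)"
        unfolding eq using sum_squared_le_sum_of_squares[of "\<lambda>g. eps * D (fst g) (snd g) 1 0 (fst z) (snd z) - v g (fst z) (snd z)" ?G]
        by (simp add: mult.commute)
    qed
    also have "\<dots> = 9 * (\<Sum>g\<in>?G. integral (el i j) (\<lambda>z. (eps * D (fst g) (snd g) 1 0 (fst z) (snd z) - v g (fst z) (snd z))\<^sup>2))"
      using int by (subst integral_mult_right, subst integral_sum) auto
    also have "\<dots> \<le> 9 * (\<Sum>g\<in>?G. L2)" using v(3) by (intro mult_left_mono sum_mono) auto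
    finally show ?thesis by simp
  qed
  moreover have "Qk k (\<lambda>x y. \<Sum>g\<in>?G. v g x y)" using v(1) by (intro Qk_sum) auto
  ultimately show ?thesis unfolding L2_def
    by (intro exI[of _ "\<lambda>x y. \<Sum>g\<in>?G. v g x y"]) (simp add: mult.assoc)
qed

text \<open>For \<open>u\<close> the maximum-norm error suffices also for the integral norm: the
  areas of the cells add up to 1 and \<open>b\<close> is bounded by \<open>b1\<close>.\<close>

lemma solution_projection:
  assumes C: "projection_constant k b0 b1 Cp" and b0: "0 \<le> b0" and b: "continuous_on sq (\<lambda>z. b (fst z) (snd z))"
    "\<And>x y. x \<in> {0..1} \<Longrightarrow> y \<in> {0..1} \<Longrightarrow> b0 \<le> b x y \<and> b x y \<le> b1" and L: "layered A D"
  shows "\<exists>Pu. VN k N Pu \<and> (\<forall>g. VN k N g \<longrightarrow> ip N xs (\<lambda>i j x y. b x y * (superpos D 0 0 x y - Pu i j x y)) g = 0) \<and>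
    (\<forall>i\<in>{1..N}. \<forall>j\<in>{1..N}. \<forall>x y. (x, y) \<in> el i j \<longrightarrow> \<bar>superpos D 0 0 x y - Pu i j x y\<bar> \<le> Cp * (9 * A * CA * kap)) \<and>
    ip N xs (\<lambda>i j x y. b x y * (superpos D 0 0 x y - Pu i j x y)) (\<lambda>i j x y. superpos D 0 0 x y - Pu i j x y)
      \<le> b1 * (9 * A * CA * kap)\<^sup>2"
proof -
  let ?\<delta> = "9 * A * CA * kap"
  let ?a = "\<lambda>i j. (xs i - xs (i - 1)) * (xs j - xs (j - 1))"
  have c: "continuous_on sq (\<lambda>z. superpos D 0 0 (fst z) (snd z))"
    using smooth_familyD(1)[OF smooth_family_superpos[OF L], of 0 0] by simp
  have ap: "\<exists>w. Qk k w \<and> (\<forall>x y. (x, y) \<in> el i j \<longrightarrow> \<bar>superpos D 0 0 x y - w x y\<bar> \<le> ?\<delta>) \<and>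
      integral (el i j) (\<lambda>z. b (fst z) (snd z) * (superpos D 0 0 (fst z) (snd z) - w (fst z) (snd z))\<^sup>2) \<le> b1 * ?\<delta>\<^sup>2 * ?a i j"
    if ij: "i \<in> {1..N}" "j \<in> {1..N}" for i j
  proof -
    obtain w where w: "Qk k w" "\<And>x y. (x, y) \<in> el i j \<Longrightarrow> \<bar>superpos D 0 0 x y - w x y\<bar> \<le> ?\<delta>"
      using solution_approx[OF L ij] by blast
    have "integral (cbox (xs (i - 1), xs (j - 1)) (xs i, xs j))
      (\<lambda>z. b (fst z) (snd z) * (superpos D 0 0 (fst z) (snd z) - w (fst z) (snd z))\<^sup>2) \<le> b1 * ?\<delta>\<^sup>2 * ?a i j"
    proof (rule integral_pair_bounds)
      show "continuous_on (cbox (xs (i - 1), xs (j - 1)) (xs i, xs j))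
        (\<lambda>z. b (fst z) (snd z) * (superpos D 0 0 (fst z) (snd z) - w (fst z) (snd z))\<^sup>2)"
        using continuous_on_subset[OF b(1) el_subset[OF ij]] continuous_on_subset[OF c el_subset[OF ij]]
        unfolding el_def by (intro continuous_intros Qk_continuous[OF w(1)])
      fix x y assume "x \<in> {xs (i - 1)..xs i}" "y \<in> {xs (j - 1)..xs j}"
      then have e: "(x, y) \<in> el i j" by (simp add: mem_el)
      then have "(x, y) \<in> sq" using el_subset[OF ij] by blast
      then have bb: "b0 \<le> b x y" "b x y \<le> b1" using b(2)[of x y] by (auto simp: cbox_Pair_eq)
      have "(superpos D 0 0 x y - w x y)\<^sup>2 \<le> ?\<delta>\<^sup>2" using power_mono[OF w(2)[OF e], of 2] by simp
      then show "b (fst (x, y)) (snd (x, y)) * (superpos D 0 0 (fst (x, y)) (snd (x, y)) - w (fst (x, y)) (snd (x, y)))\<^sup>2 \<le> b1 * ?\<delta>\<^sup>2"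
        using bb b0 by (simp add: mult_mono)
    qed (use mono[OF ij(1)] mono[OF ij(2)] in auto)
    then show ?thesis using w unfolding el_def by blast
  qed
  have "(\<Sum>i\<in>{1..N}. \<Sum>j\<in>{1..N}. b1 * ?\<delta>\<^sup>2 * ?a i j) = b1 * ?\<delta>\<^sup>2 * ((\<Sum>i\<in>{1..N}. xs i - xs (i - 1)) * (\<Sum>j\<in>{1..N}. xs j - xs (j - 1)))"
    by (subst sum_product) (simp only: sum_distrib_left)
  also have "\<dots> = b1 * ?\<delta>\<^sup>2" unfolding sum_mesh_widths by simp
  finally have S: "(\<Sum>i\<in>{1..N}. \<Sum>j\<in>{1..N}. b1 * ?\<delta>\<^sup>2 * ?a i j) = b1 * ?\<delta>\<^sup>2" .
  show ?thesis using projection_dg[OF C b(1) c b(2) ap] unfolding S by blast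
qed

text \<open>The cell bound contains the height but not the width of the cell, so the heights add up
  to 1 while the columns contribute the factor \<open>N\<close>.\<close>

lemma gradient_projection:
  assumes C: "projection_constant k 1 1 Cp" and L: "layered A D"
  shows "\<exists>Pp. VN k N Pp \<and> (\<forall>g. VN k N g \<longrightarrow> ip N xs (\<lambda>i j x y. eps * superpos D 1 0 x y - Pp i j x y) g = 0) \<and>
    (\<forall>i\<in>{1..N}. \<forall>j\<in>{1..N}. \<forall>x y. (x, y) \<in> el i j \<longrightarrow> \<bar>eps * superpos D 1 0 x y - Pp i j x y\<bar> \<le> Cp * (9 * A * CA * (sqrt eps * kap))) \<and>
    ip N xs (\<lambda>i j x y. eps * superpos D 1 0 x y - Pp i j x y) (\<lambda>i j x y. eps * superpos D 1 0 x y - Pp i j x y)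
      \<le> 81 * A\<^sup>2 * (CA\<^sup>2 * LD) * (eps * sqrt eps) * kap\<^sup>2 * N"
proof -
  let ?L = "81 * A\<^sup>2 * (CA\<^sup>2 * LD) * (eps * sqrt eps) * kap\<^sup>2"
  have c: "continuous_on sq (\<lambda>z. eps * superpos D 1 0 (fst z) (snd z))"
    using smooth_familyD(1)[OF smooth_family_superpos[OF L], of 1 0] by (intro continuous_intros) simp
  have c1: "continuous_on sq (\<lambda>z. 1)" by simp
  have S: "(\<Sum>i\<in>{1..N}. \<Sum>j\<in>{1..N}. ?L * (xs j - xs (j - 1))) = ?L * N"
    unfolding sum_distrib_left[symmetric] sum_mesh_widths by simp
  show ?thesis
    using projection_dg[of k 1 1 Cp "\<lambda>x y. 1", OF C c1 c _ gradient_approx[OF L]] unfolding S by simp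
qed

end

section \<open>Energy estimate\<close>

context dg_mesh
begin

lemma tr_tr [simp]: "tr (tr v) = v"
  by (simp add: tr_def)

lemma tr_diff: "tr (\<lambda>i j x y. v i j x y - w i j x y) = (\<lambda>i j x y. tr v i j x y - tr w i j x y)"
  by (simp add: tr_def)

lemma mem_el_swap: "(x, y) \<in> el i j \<longleftrightarrow> (y, x) \<in> el j i"
  unfolding mem_el by auto

text \<open>The form \<open>ldgB\<close> with its \<open>y\<close>-terms rewritten through \<open>tr\<close>.\<close>

definition BB :: "real \<Rightarrow> real \<Rightarrow> (real \<Rightarrow> real \<Rightarrow> real) \<Rightarrow> dgfun \<Rightarrow> dgfun \<Rightarrow> dgfun \<Rightarrow> dgfun \<Rightarrow> dgfun \<Rightarrow> dgfun \<Rightarrow> real" where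
  "BB eps lam b U P Q v s r = ip N xs P s / eps + ip N xs Q r / eps + ip N xs (\<lambda>i j x y. b x y * U i j x y) v
     + FU U s (dx s) + FU (tr U) (tr r) (dx (tr r)) + FP P v (dx v) + FP (tr Q) (tr v) (dx (tr v))
     + lam * (JJ U v + JJ (tr U) (tr v))"

lemma BB_diff:
  assumes "cdg U" "cdg U'" "cdg P" "cdg P'" "cdg Q" "cdg Q'" "continuous_on sq (\<lambda>z. b (fst z) (snd z))"
    and V: "VN k N v" "VN k N s" "VN k N r"
  shows "BB eps lam b (\<lambda>i j x y. U i j x y - U' i j x y) (\<lambda>i j x y. P i j x y - P' i j x y) (\<lambda>i j x y. Q i j x y - Q' i j x y) v s r
    = BB eps lam b U P Q v s r - BB eps lam b U' P' Q' v s r"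
proof -
  note bc = cdg_fun[OF assms(7)]
  have bu: "ip N xs (\<lambda>i j x y. b x y * (U i j x y - U' i j x y)) v =
     ip N xs (\<lambda>i j x y. b x y * U i j x y) v - ip N xs (\<lambda>i j x y. b x y * U' i j x y) v"
    unfolding right_diff_distrib
    by (rule ip_diff_left[OF cdg_mult[OF bc assms(1)] cdg_mult[OF bc assms(2)] cdg_VN[OF V(1)]])
  note c = cdg_VN[OF V(1)] cdg_VN[OF V(2)] cdg_VN[OF V(3)] cdg_VN[OF VN_tr[OF V(1)]] cdg_VN[OF VN_tr[OF V(3)]]
    cdg_VN[OF VN_dx[OF V(1)]] cdg_VN[OF VN_dx[OF V(2)]] cdg_VN[OF VN_dx[OF VN_tr[OF V(1)]]] cdg_VN[OF VN_dx[OF VN_tr[OF V(3)]]]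
  show ?thesis
    unfolding BB_def tr_diff bu ip_diff_left[OF assms(3,4) c(2)] ip_diff_left[OF assms(5,6) c(3)]
      FU_diff[OF assms(1,2) c(2,7)] FU_diff[OF cdg_tr[OF assms(1)] cdg_tr[OF assms(2)] c(5,9)]
      FP_diff[OF assms(3,4) c(1,6)] FP_diff[OF cdg_tr[OF assms(5)] cdg_tr[OF assms(6)] c(4,8)]
      JJ_diff[OF assms(1,2) c(1)] JJ_diff[OF cdg_tr[OF assms(1)] cdg_tr[OF assms(2)] c(4)]
    by (simp add: diff_divide_distrib algebra_simps)
qed

text \<open>The two fluxes cancel in each direction, by adjointness, so only the squares of the
  energy remain.\<close>

lemma BB_self:
  assumes "VN k N U" "VN k N P" "VN k N Q"
  shows "BB eps lam b U P Q U P Q = (ip N xs P P + ip N xs Q Q) / eps + ip N xs (\<lambda>i j x y. b x y * U i j x y) U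
     + lam * (JJ U U + JJ (tr U) (tr U))"
proof -
  have "FU U P (dx P) + FP P U (dx U) = 0" "FU (tr U) (tr Q) (dx (tr Q)) + FP (tr Q) (tr U) (dx (tr U)) = 0"
    using assms by (auto intro!: flux_adjoint cdg_VN VN_dx has_dx_VN VN_tr)
  then show ?thesis unfolding BB_def by (simp add: add_divide_distrib)
qed

lemma eint_zero: "(\<And>y. y \<in> {xs (j - 1)..xs j} \<Longrightarrow> f y = 0) \<Longrightarrow> eint xs j f = 0"
  unfolding eint_def by (subst integral_cong[of _ f "\<lambda>y. 0"]) auto

lemma el_unit: "i \<in> {1..N} \<Longrightarrow> j \<in> {1..N} \<Longrightarrow> (x, y) \<in> el i j \<Longrightarrow> x \<in> {0..1} \<and> y \<in> {0..1}"
  using el_subset[of i j] by (auto simp: cbox_Pair_eq)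

lemma edge_unit: "j \<in> {1..N} \<Longrightarrow> y \<in> {xs (j - 1)..xs j} \<Longrightarrow> y \<in> {0..1}"
proof -
  assume j: "j \<in> {1..N}" "y \<in> {xs (j - 1)..xs j}"
  then have "j - 1 \<le> N" "j \<le> N" by auto
  then show ?thesis using xs_unit[of "j - 1"] xs_unit[of j] j by auto
qed

lemma has_dx_fun:
  assumes "\<And>x y. x \<in> {0..1} \<Longrightarrow> y \<in> {0..1} \<Longrightarrow> ((\<lambda>s. g s y) has_real_derivative g' x y) (at x within {0..1})"
  shows "has_dx (\<lambda>i j. g) (\<lambda>i j. g')"
  unfolding has_dx_def
proof (intro ballI)
  fix i j x y assume "i \<in> {1..N}" "j \<in> {1..N}" "x \<in> {xs (i - 1)..xs i}" "y \<in> {xs (j - 1)..xs j}"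
  moreover have "{xs (i - 1)..xs i} \<subseteq> {0..1}" using edge_unit[of i] calculation(1) by blast
  ultimately show "((\<lambda>s. g s y) has_real_derivative g' x y) (at x within {xs (i - 1)..xs i})"
    using edge_unit by (intro has_field_derivative_subset[OF assms]) auto
qed

lemma jumpV_fun:
  assumes "i \<le> N" "i = 0 \<Longrightarrow> g 0 y = 0" "i = N \<Longrightarrow> g 1 y = (0::real)"
  shows "jumpV N xs (\<lambda>i j. g) i j y = 0"
  using assms xs0 xsN unfolding jumpV_def by auto

text \<open>Read off from \<open>flux_adjoint\<close> with the exact function in the second slot.
  All its jumps vanish, at the two boundary lines by the boundary condition, so \<open>FP\<close>
  reduces to its volume term.\<close>

lemma FU_consistent:
  assumes g: "continuous_on sq (\<lambda>z. g (fst z) (snd z))" "continuous_on sq (\<lambda>z. g' (fst z) (snd z))"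
    "\<And>x y. x \<in> {0..1} \<Longrightarrow> y \<in> {0..1} \<Longrightarrow> ((\<lambda>s. g s y) has_real_derivative g' x y) (at x within {0..1})"
    and bc: "\<And>y. y \<in> {0..1} \<Longrightarrow> g 0 y = 0" "\<And>y. y \<in> {0..1} \<Longrightarrow> g 1 y = 0" and s: "VN k N s"
  shows "FU (\<lambda>i j. g) s (dx s) = - ip N xs (\<lambda>i j. g') s"
proof -
  have "FU (\<lambda>i j. g) s (dx s) + FP s (\<lambda>i j. g) (\<lambda>i j. g') = 0"
    by (rule flux_adjoint[OF cdg_fun[OF g(1)] cdg_fun[OF g(2)] has_dx_fun[OF g(3)] cdg_VN[OF s] cdg_VN[OF VN_dx[OF s]] has_dx_VN[OF s]])
  moreover have "eint xs j (\<lambda>y. s (Suc i) j (xs i) y * jumpV N xs (\<lambda>i j. g) i j y) = 0" if "j \<in> {1..N}" "i \<in> {0..N-1}" for i j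
    using that edge_unit bc N1 by (intro eint_zero) (auto simp: jumpV_fun)
  moreover have "eint xs j (\<lambda>y. s N j (xs N) y * g (xs N) y) = 0" if "j \<in> {1..N}" for j
    using that edge_unit bc xsN by (intro eint_zero) auto
  ultimately have "FU (\<lambda>i j. g) s (dx s) + ip N xs s (\<lambda>i j. g') = 0" unfolding FP_def by simp
  then show ?thesis by (simp add: ip_commute)
qed

text \<open>The adjoint flux \<open>FU\<close> runs over interior edges only, where the common
  function \<open>g\<close> of all cells has no jump.\<close>

lemma FP_consistent:
  assumes g: "continuous_on sq (\<lambda>z. g (fst z) (snd z))" "continuous_on sq (\<lambda>z. g' (fst z) (snd z))"
    "\<And>x y. x \<in> {0..1} \<Longrightarrow> y \<in> {0..1} \<Longrightarrow> ((\<lambda>s. g s y) has_real_derivative g' x y) (at x within {0..1})"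
    and v: "VN k N v"
  shows "FP (\<lambda>i j. g) v (dx v) = - ip N xs (\<lambda>i j. g') v"
proof -
  have "FU v (\<lambda>i j. g) (\<lambda>i j. g') + FP (\<lambda>i j. g) v (dx v) = 0"
    by (rule flux_adjoint[OF cdg_VN[OF v] cdg_VN[OF VN_dx[OF v]] has_dx_VN[OF v] cdg_fun[OF g(1)] cdg_fun[OF g(2)] has_dx_fun[OF g(3)]])
  moreover have "eint xs j (\<lambda>y. v i j (xs i) y * jumpV N xs (\<lambda>i j. g) i j y) = 0" if "j \<in> {1..N}" "i \<in> {1..N-1}" for i j
  proof (rule eint_zero)
    fix y
    have "i \<le> N" "i \<noteq> 0" "i \<noteq> N" using that by auto
    then show "v i j (xs i) y * jumpV N xs (\<lambda>i j. g) i j y = 0" by (simp add: jumpV_fun)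
  qed
  ultimately have "ip N xs v (\<lambda>i j. g') + FP (\<lambda>i j. g) v (dx v) = 0" unfolding FU_def by simp
  then show ?thesis by (simp add: ip_commute)
qed

lemma JJ_consistent:
  assumes bc: "\<And>y. y \<in> {0..1} \<Longrightarrow> g 0 y = 0" "\<And>y. y \<in> {0..1} \<Longrightarrow> g 1 y = 0"
  shows "JJ (\<lambda>i j. g) v = 0"
proof -
  have "eint xs j (\<lambda>y. jumpV N xs (\<lambda>i j. g) i j y * jumpV N xs v i j y) = 0" if "j \<in> {1..N}" "i \<in> {0..N}" for i j
    using that edge_unit bc by (intro eint_zero) (auto simp: jumpV_fun)
  then show ?thesis unfolding JJ_def by simp
qed

text \<open>The differential equation holds in the open square only; the cell boundaries that may
  touch its boundary are negligible.\<close>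

lemma ip_cong_open:
  assumes "\<And>x y. x \<in> {0<..<1} \<Longrightarrow> y \<in> {0<..<1} \<Longrightarrow> f x y = g x y"
  shows "ip N xs (\<lambda>i j. f) v = ip N xs (\<lambda>i j. g) v"
  unfolding ip_alt
proof (intro sum.cong refl)
  fix i j assume ij: "i \<in> {1..N}" "j \<in> {1..N}"
  then have "i - 1 \<le> N" "i \<le> N" "j - 1 \<le> N" "j \<le> N" by auto
  then have un: "0 \<le> xs (i - 1)" "xs i \<le> 1" "0 \<le> xs (j - 1)" "xs j \<le> 1"
    using xs_unit by auto
  show "integral (el i j) (\<lambda>z. f (fst z) (snd z) * v i j (fst z) (snd z)) = integral (el i j) (\<lambda>z. g (fst z) (snd z) * v i j (fst z) (snd z))"
  proof (rule integral_spike)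
    show "negligible (el i j - box (xs (i - 1), xs (j - 1)) (xs i, xs j))"
      unfolding el_def by (rule negligible_frontier_interval)
    fix z assume "z \<in> el i j - (el i j - box (xs (i - 1), xs (j - 1)) (xs i, xs j))"
    then have "z \<in> box (xs (i - 1), xs (j - 1)) (xs i, xs j)" by blast
    then have "fst z \<in> {0<..<1}" "snd z \<in> {0<..<1}"
      using un by (cases z; auto simp: mem_box Basis_prod_def)+
    then show "g (fst z) (snd z) * v i j (fst z) (snd z) = f (fst z) (snd z) * v i j (fst z) (snd z)"
      using assms by simp
  qed
qed

text \<open>The error is defined through \<open>u\<close>, the analysis uses the superposition; they
  agree on the closed cells, which contain all traces.\<close>

lemma JJ_cong:
  assumes "\<And>i j x y. i \<in> {1..N} \<Longrightarrow> j \<in> {1..N} \<Longrightarrow> (x, y) \<in> el i j \<Longrightarrow> v i j x y = w i j x y"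
  shows "JJ v v = JJ w w"
proof -
  have "jumpV N xs v i j y = jumpV N xs w i j y" if ij: "j \<in> {1..N}" "i \<in> {0..N}" and y: "y \<in> {xs (j - 1)..xs j}" for i j y
  proof -
    have "v i j (xs i) y = w i j (xs i) y" if "0 < i"
      using that ij y mono[of i] by (intro assms) (auto simp: mem_el)
    moreover have "v (Suc i) j (xs i) y = w (Suc i) j (xs i) y" if "i < N"
      using that ij y mono[of "Suc i"] by (intro assms) (auto simp: mem_el)
    ultimately show ?thesis using ij N1 unfolding jumpV_def by auto
  qed
  then show ?thesis unfolding JJ_def eint_def by (intro sum.cong refl integral_cong) simp
qed

end

text \<open>The Young weights are such that half of \<open>X / eps\<close> and half of
  \<open>s * J\<close> reappear on the right; absorbing them doubles the remaining terms. The
  quotient \<open>N\<^sup>2 / M\<close> arises in the first flux from dividing \<open>N\<close> by a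
  multiple of \<open>s * (M / N)\<close>.\<close>

lemma energy_arithmetic:
  fixes s eps N M kap c Ci Eu Ep X Y J F1 F2 F3 :: real
  assumes s: "0 < s" "s * s = eps" and N: "1 \<le> N" and M: "0 < M" "M \<le> 4 * N" and c: "0 < c" and J: "0 \<le> J"
    and F1: "F1 \<le> 2 * (9 * Ci * (Eu * kap)\<^sup>2 * N / (4 * (1 / (2 * eps)) * (c * (s * (M / N))))) + 1 / (2 * eps) * X"
    and F2: "F2 \<le> 2 * ((N + 1) * (Ep * (s * kap))\<^sup>2 / (4 * (s / 4))) + s / 4 * J"
    and F3: "F3 \<le> 2 * ((N + 1) * (Eu * kap)\<^sup>2 / (1 / 4)) + 1 / 4 * J"
    and E: "X / eps + Y + s * J = F1 + F2 + s * F3" and Y: "0 \<le> Y"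
  shows "X / eps + Y + s * J \<le> 2 * (9 * Ci * Eu\<^sup>2 / c + 16 * Ep\<^sup>2 + 64 * Eu\<^sup>2) * (s * (kap\<^sup>2 * N\<^sup>2 / M))"
proof -
  define R where "R = kap\<^sup>2 * N\<^sup>2 / M"
  \<comment> \<open>\<open>M \<le> 4 * N\<close> brings the remaining terms, of size
    \<open>N * kap\<^sup>2\<close>, to the same form.\<close>
  have kR: "N * kap\<^sup>2 \<le> 4 * R"
  proof -
    have "N * kap\<^sup>2 * M \<le> N * kap\<^sup>2 * (4 * N)" using M N by (intro mult_left_mono) auto
    then show ?thesis unfolding R_def using M by (simp add: field_simps power2_eq_square)
  qed
  have kR': "(N + 1) * kap\<^sup>2 \<le> 8 * R"
    using kR mult_right_mono[OF N, of "kap\<^sup>2"] by (simp add: algebra_simps)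
  have eps: "eps = s * s" using s by simp
  have a: "2 * (9 * Ci * (Eu * kap)\<^sup>2 * N / (4 * (1 / (2 * eps)) * (c * (s * (M / N))))) = 9 * Ci * Eu\<^sup>2 / c * (s * R)"
    unfolding R_def eps using s N M c by (simp add: field_simps power2_eq_square)
  have "2 * ((N + 1) * (Ep * (s * kap))\<^sup>2 / (4 * (s / 4))) = 2 * Ep\<^sup>2 * s * ((N + 1) * kap\<^sup>2)"
    using s(1) by (simp add: field_simps power2_eq_square)
  also have "\<dots> \<le> 2 * Ep\<^sup>2 * s * (8 * R)" using kR' s by (intro mult_left_mono) auto
  finally have b: "2 * ((N + 1) * (Ep * (s * kap))\<^sup>2 / (4 * (s / 4))) \<le> 16 * Ep\<^sup>2 * (s * R)" by simp
  have "s * (2 * ((N + 1) * (Eu * kap)\<^sup>2 / (1 / 4))) = 8 * Eu\<^sup>2 * s * ((N + 1) * kap\<^sup>2)"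
    by (simp add: field_simps power2_eq_square)
  also have "\<dots> \<le> 8 * Eu\<^sup>2 * s * (8 * R)" using kR' s by (intro mult_left_mono) auto
  finally have d: "s * (2 * ((N + 1) * (Eu * kap)\<^sup>2 / (1 / 4))) \<le> 64 * Eu\<^sup>2 * (s * R)" by simp
  have "s * F3 \<le> s * (2 * ((N + 1) * (Eu * kap)\<^sup>2 / (1 / 4)) + 1 / 4 * J)"
    using F3 s by (intro mult_left_mono) auto
  moreover have "s * (2 * ((N + 1) * (Eu * kap)\<^sup>2 / (1 / 4)) + 1 / 4 * J) = s * (2 * ((N + 1) * (Eu * kap)\<^sup>2 / (1 / 4))) + s * J / 4"
    by (simp add: distrib_left)
  ultimately have f3: "s * F3 \<le> 64 * Eu\<^sup>2 * (s * R) + s * J / 4" using d by linarith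
  have "X / eps + Y + s * J \<le> 9 * Ci * Eu\<^sup>2 / c * (s * R) + 16 * Ep\<^sup>2 * (s * R) + 64 * Eu\<^sup>2 * (s * R) + X / eps / 2 + s * J / 2"
    unfolding E using F1[unfolded a] F2 b f3 by simp
  then have "X / eps + Y + s * J \<le> 2 * (9 * Ci * Eu\<^sup>2 / c * (s * R) + 16 * Ep\<^sup>2 * (s * R) + 64 * Eu\<^sup>2 * (s * R))"
  proof -
    have "a + Y + j \<le> 2 * z" if "a + Y + j \<le> z + a / 2 + j / 2" for a j z :: real
      using that Y by linarith
    then show ?thesis using \<open>X / eps + Y + s * J \<le> _\<close> .
  qed
  then show ?thesis unfolding R_def[symmetric] by (simp add: algebra_simps)
qed

text \<open>Plain letters stand for the discrete error, primed ones for the projection error,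
  \<open>S\<close> for the squared balanced norm. Dividing the energy bound by \<open>s\<close>
  produces the weight \<open>1 / (eps * s)\<close>, that is \<open>eps^(-3/2)\<close>, and unit
  weight on the jumps; the factor \<open>s\<close> in the energy bound pays for it.\<close>

lemma balanced_arithmetic:
  fixes s eps N M kap Lp Lb Eu X Y J X' Y' J' S K :: real
  assumes s: "0 < s" "s * s = eps" "s \<le> 1" and N: "1 \<le> N" and M: "0 < M" "M \<le> 4 * N"
    and nonneg: "0 \<le> X" "0 \<le> Y" "0 \<le> J" "0 \<le> Lp" "0 \<le> Lb"
    and E: "X / eps + Y + s * J \<le> 2 * K * (s * (kap\<^sup>2 * N\<^sup>2 / M))"
    and X': "X' \<le> 2 * (Lp * (eps * s) * kap\<^sup>2 * N)" and Y': "Y' \<le> Lb * kap\<^sup>2" and J': "J' \<le> 2 * (4 * (N + 1) * (Eu * kap)\<^sup>2)"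
    and S: "S \<le> 1 / (eps * s) * (2 * X' + 2 * X) + (2 * Y' + 2 * Y) + (2 * J' + 2 * J)"
  shows "S \<le> (16 * Lp + 8 * Lb + 128 * Eu\<^sup>2 + 4 * K) * (kap\<^sup>2 * N\<^sup>2 / M)"
proof -
  define R where "R = kap\<^sup>2 * N\<^sup>2 / M"
  have kR: "N * kap\<^sup>2 \<le> 4 * R"
  proof -
    have "N * kap\<^sup>2 * M \<le> N * kap\<^sup>2 * (4 * N)" using M N by (intro mult_left_mono) auto
    then show ?thesis unfolding R_def using M by (simp add: field_simps power2_eq_square)
  qed
  have kN: "1 * kap\<^sup>2 \<le> N * kap\<^sup>2" using N by (intro mult_right_mono) auto
  have eps: "0 < eps * s" using s by auto
  have "1 / (eps * s) * X' \<le> 1 / (eps * s) * (2 * (Lp * (eps * s) * kap\<^sup>2 * N))"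
    using X' eps by (intro mult_left_mono) auto
  also have "\<dots> = 2 * Lp * (N * kap\<^sup>2)" using s by auto
  also have "\<dots> \<le> 2 * Lp * (4 * R)" using kR nonneg by (intro mult_left_mono) auto
  finally have x: "1 / (eps * s) * X' \<le> 8 * (Lp * R)" by simp
  have "Lb * kap\<^sup>2 \<le> Lb * (4 * R)" using kR kN nonneg by (intro mult_left_mono) auto
  then have y: "Y' \<le> 4 * (Lb * R)" using Y' by simp
  have "8 * Eu\<^sup>2 * ((N + 1) * kap\<^sup>2) \<le> 8 * Eu\<^sup>2 * (8 * R)"
    using kR kN by (intro mult_left_mono) (auto simp: algebra_simps)
  moreover have "2 * (4 * (N + 1) * (Eu * kap)\<^sup>2) = 8 * Eu\<^sup>2 * ((N + 1) * kap\<^sup>2)"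
    by (simp add: power_mult_distrib algebra_simps)
  ultimately have j: "J' \<le> 64 * (Eu\<^sup>2 * R)" using J' by linarith
  have "1 / (eps * s) * X + Y + J \<le> 1 / s * (X / eps + Y + s * J)"
  proof -
    \<comment> \<open>The reaction term keeps unit weight in the balanced norm, so the division by
      \<open>s \<le> 1\<close> is harmless for it.\<close>
    have "Y \<le> Y / s" using s nonneg by (simp add: pos_le_divide_eq mult_left_le)
    then show ?thesis using s by (simp add: distrib_left mult.commute)
  qed
  also have "\<dots> \<le> 1 / s * (2 * K * (s * R))" using E s unfolding R_def by (intro mult_left_mono) auto
  also have "\<dots> = 2 * (K * R)" using s by simp
  finally have z: "1 / (eps * s) * X + Y + J \<le> 2 * (K * R)" .
  have "S \<le> 16 * (Lp * R) + 8 * (Lb * R) + 128 * (Eu\<^sup>2 * R) + 4 * (K * R)"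
    using S x y j z by (simp only: distrib_left mult.left_commute[of _ 2])
  then show ?thesis unfolding R_def[symmetric] by (simp add: algebra_simps)
qed

lemma add_le_twice:
  fixes a b c p q :: real
  shows "p \<le> a + b \<Longrightarrow> q \<le> a + c \<Longrightarrow> p + q \<le> 2 * a + (b + c)"
  by simp

lemma add_le_double:
  fixes a b c d p q :: real
  shows "p \<le> 2 * a + 2 * b \<Longrightarrow> q \<le> 2 * c + 2 * d \<Longrightarrow> p + q \<le> 2 * (a + c) + 2 * (b + d)"
  by simp

section \<open>The error of the LDG solution\<close>

context layer_mesh
begin

text \<open>The constants enter as equations between parameters, so that the caller can fix them
  outside the locale, before \<open>eps\<close> and \<open>N\<close> are given.\<close>

lemma error_estimate:
  assumes b: "continuous_on sq (\<lambda>z. b (fst z) (snd z))"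
    and bnd: "\<And>x y. x \<in> {0..1} \<Longrightarrow> y \<in> {0..1} \<Longrightarrow> b0 \<le> b x y \<and> b x y \<le> b1" and b0: "0 < b0"
    and L: "layered A D" and u: "\<And>x y. x \<in> {0..1} \<Longrightarrow> y \<in> {0..1} \<Longrightarrow> u x y = superpos D 0 0 x y"
    and sol: "solves eps b f u" and ldg: "ldg_solution k eps (sqrt eps) b f N xs U P Q"
    and Ci: "inverse_constant k Ci" and Cb: "projection_constant k b0 b1 Cb" and C1: "projection_constant k 1 1 C1"
    and Eu: "Eu = Cb * (9 * A * CA)" and Ep: "Ep = C1 * (9 * A * CA)"
    and Lp: "Lp = 81 * A\<^sup>2 * (CA\<^sup>2 * LD)" and Lb: "Lb = b1 * (9 * A * CA)\<^sup>2"
    and K: "K = 9 * Ci * Eu\<^sup>2 / min (sg / beta) (1/4) + 16 * Ep\<^sup>2 + 64 * Eu\<^sup>2"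
  shows "bal_err eps b N xs u U P Q \<le> sqrt ((16 * Lp + 8 * Lb + 128 * Eu\<^sup>2 + 4 * K) * (kap\<^sup>2 * (real N)\<^sup>2 / M))"
proof -
  define T where "T = superpos D"
  \<comment> \<open>The transposed decomposition, in which \<open>eps * u_y\<close> becomes an
    \<open>x\<close>-derivative and the estimates for \<open>p\<close> apply to
    \<open>q\<close>.\<close>
  define D' where "D' = (\<lambda>r s i j x y. D s r j i y x)"
  define T' where "T' = superpos D'"
  have L': "layered A D'" unfolding D'_def by (rule layered_swap[OF L])
  have T': "T' i j x y = T j i y x" for i j x y unfolding T'_def D'_def T_def by (rule superpos_swap)
  have fam: "smooth_family (Suc (Suc k)) T" unfolding T_def by (rule smooth_family_superpos[OF L])
  have fam': "smooth_family (Suc (Suc k)) T'" unfolding T'_def by (rule smooth_family_superpos[OF L'])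
  have uT: "u x y = T 0 0 x y" if "x \<in> {0..1}" "y \<in> {0..1}" for x y using u[OF that] by (simp add: T_def)
  have pdT: "pd i j u x y = T i j x y" if "i \<le> Suc (Suc k)" "j \<le> Suc (Suc k)" "x \<in> {0..1}" "y \<in> {0..1}" for i j x y
    using pd_eq_smooth_family[OF fam uT that] .
  note cT = smooth_familyD(1)[OF fam] and cT' = smooth_familyD(1)[OF fam']
  have bc: "T 0 0 0 y = 0" "T 0 0 1 y = 0" "T' 0 0 0 y = 0" "T' 0 0 1 y = 0" if "y \<in> {0..1}" for y
  proof -
    have ub: "u x y = 0" if "x \<in> {0..1}" "y \<in> {0..1}" "x = 0 \<or> x = 1 \<or> y = 0 \<or> y = 1" for x y
      using sol that unfolding solves_def by blast
    show "T 0 0 0 y = 0" "T 0 0 1 y = 0" "T' 0 0 0 y = 0" "T' 0 0 1 y = 0"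
      using that uT[of 0 y] uT[of 1 y] uT[of y 0] uT[of y 1] ub[of 0 y] ub[of 1 y] ub[of y 0] ub[of y 1]
      by (simp_all add: T')
  qed
  have pde: "b x y * T 0 0 x y - eps * T 2 0 x y - eps * T 0 2 x y = f x y" if "x \<in> {0<..<1}" "y \<in> {0<..<1}" for x y
  proof -
    have xy: "x \<in> {0..1}" "y \<in> {0..1}" using that by auto
    have "- eps * (pd 2 0 u x y + pd 0 2 u x y) + b x y * u x y = f x y" using sol that unfolding solves_def by blast
    then show ?thesis using pdT[of 2 0 x y] pdT[of 0 2 x y] uT[OF xy] xy by (simp add: algebra_simps)
  qed
  define uw pw qw :: dgfun where "uw = (\<lambda>i j. T 0 0)" and "pw = (\<lambda>i j x y. eps * T 1 0 x y)" and "qw = (\<lambda>i j x y. eps * T 0 1 x y)"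
  have truw: "tr uw = (\<lambda>i j. T' 0 0)" unfolding uw_def tr_def T' ..
  have trqw: "tr qw = (\<lambda>i j x y. eps * T' 1 0 x y)" unfolding qw_def tr_def T' ..
  have cw: "cdg uw" "cdg pw" "cdg qw" unfolding uw_def pw_def qw_def
    using cT[of 0 0] cT[of 1 0] cT[of 0 1] by (auto intro!: cdg_fun continuous_intros)
  \<comment> \<open>Consistency of the method. The traces of the exact triple are single-valued and
    \<open>u\<close> vanishes on the boundary, so the form reduces to the differential equation
    tested with \<open>v\<close>.\<close>
  have exact: "BB eps (sqrt eps) b uw pw qw v s r = ip N xs (\<lambda>i j. f) v"
    if V: "VN k N v" "VN k N s" "VN k N r" for v s r
  proof -
    have 1: "FU uw s (dx s) = - ip N xs (\<lambda>i j. T 1 0) s"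
      unfolding uw_def by (rule FU_consistent[OF cT cT _ _ _ V(2)])
        (use bc smooth_familyD(3)[OF fam, of 0 0] in simp_all)
    have 2: "FU (tr uw) (tr r) (dx (tr r)) = - ip N xs (\<lambda>i j. T' 1 0) (tr r)"
      unfolding truw by (rule FU_consistent[OF cT' cT' _ _ _ VN_tr[OF V(3)]])
        (use bc smooth_familyD(3)[OF fam', of 0 0] in simp_all)
    have 3: "FP pw v (dx v) = - ip N xs (\<lambda>i j x y. eps * T 2 0 x y) v"
      unfolding pw_def by (rule FP_consistent[OF _ _ _ V(1)])
        (use cT[of 1 0] cT[of 2 0] smooth_familyD(3)[OF fam, of 1 0] in \<open>auto intro!: continuous_intros DERIV_cmult simp: numeral_2_eq_2\<close>)
    have 4: "FP (tr qw) (tr v) (dx (tr v)) = - ip N xs (\<lambda>i j x y. eps * T' 2 0 x y) (tr v)"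
      unfolding trqw by (rule FP_consistent[OF _ _ _ VN_tr[OF V(1)]])
        (use cT'[of 1 0] cT'[of 2 0] smooth_familyD(3)[OF fam', of 1 0] in \<open>auto intro!: continuous_intros DERIV_cmult simp: numeral_2_eq_2\<close>)
    have c01: "cdg (\<lambda>i j. T 0 1)" using cT[of 0 1] by (intro cdg_fun) simp
    have c20: "cdg (\<lambda>i j x y. eps * T 2 0 x y)" using cT[of 2 0] by (intro cdg_fun continuous_intros) simp
    have c02: "cdg (\<lambda>i j x y. eps * T 0 2 x y)" using cT[of 0 2] by (intro cdg_fun continuous_intros) simp
    have "ip N xs (tr (\<lambda>i j. T 0 1)) (tr r) = ip N xs (\<lambda>i j. T 0 1) r" by (rule ip_tr[OF c01 cdg_VN[OF V(3)]])
    then have sw2: "ip N xs (\<lambda>i j. T' 1 0) (tr r) = ip N xs (\<lambda>i j. T 0 1) r" by (simp add: tr_def T'[abs_def])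
    have "ip N xs (tr (\<lambda>i j x y. eps * T 0 2 x y)) (tr v) = ip N xs (\<lambda>i j x y. eps * T 0 2 x y) v" by (rule ip_tr[OF c02 cdg_VN[OF V(1)]])
    then have sw4: "ip N xs (\<lambda>i j x y. eps * T' 2 0 x y) (tr v) = ip N xs (\<lambda>i j x y. eps * T 0 2 x y) v" by (simp add: tr_def T')
    have 5: "ip N xs pw s / eps = ip N xs (\<lambda>i j. T 1 0) s" "ip N xs qw r / eps = ip N xs (\<lambda>i j. T 0 1) r"
      unfolding pw_def qw_def ip_cmult_left using eps by simp_all
    have 6: "JJ uw v = 0" "JJ (tr uw) (tr v) = 0"
      unfolding truw unfolding uw_def by (rule JJ_consistent; use bc in blast)+
    have cb: "cdg (\<lambda>i j x y. b x y * uw i j x y)" using cdg_mult[OF cdg_fun[OF b] cw(1)] .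
    have "ip N xs (\<lambda>i j. f) v = ip N xs (\<lambda>i j x y. b x y * T 0 0 x y - eps * T 2 0 x y - eps * T 0 2 x y) v"
      using pde by (intro ip_cong_open) simp
    also have "\<dots> = ip N xs (\<lambda>i j x y. b x y * uw i j x y) v - ip N xs (\<lambda>i j x y. eps * T 2 0 x y) v - ip N xs (\<lambda>i j x y. eps * T 0 2 x y) v"
      using ip_diff_left[OF cdg_diff[OF cb c20] c02 cdg_VN[OF V(1)]] ip_diff_left[OF cb c20 cdg_VN[OF V(1)]]
      unfolding uw_def by simp
    finally show ?thesis unfolding BB_def 1 2 3 4 sw2 sw4 5 6 by simp
  qed
  have V: "VN k N U" "VN k N P" "VN k N Q" using ldg unfolding ldg_solution_def by auto
  have discrete: "BB eps (sqrt eps) b U P Q v s r = ip N xs (\<lambda>i j. f) v"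
    if "VN k N v" "VN k N s" "VN k N r" for v s r
    using ldg that ldgB_eq[OF cdg_VN[OF V(1)] cdg_VN[OF V(3)] that(1,3), of eps "sqrt eps" b P s]
    unfolding ldg_solution_def BB_def by simp
  obtain Pu where Pu: "VN k N Pu" "\<And>g. VN k N g \<Longrightarrow> ip N xs (\<lambda>i j x y. b x y * (T 0 0 x y - Pu i j x y)) g = 0"
    "\<And>i j x y. i \<in> {1..N} \<Longrightarrow> j \<in> {1..N} \<Longrightarrow> (x, y) \<in> el i j \<Longrightarrow> \<bar>T 0 0 x y - Pu i j x y\<bar> \<le> Cb * (9 * A * CA * kap)"
    "ip N xs (\<lambda>i j x y. b x y * (T 0 0 x y - Pu i j x y)) (\<lambda>i j x y. T 0 0 x y - Pu i j x y) \<le> b1 * (9 * A * CA * kap)\<^sup>2"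
    using solution_projection[OF Cb less_imp_le[OF b0] b bnd L] unfolding T_def by blast
  obtain Pp where Pp: "VN k N Pp" "\<And>g. VN k N g \<Longrightarrow> ip N xs (\<lambda>i j x y. eps * T 1 0 x y - Pp i j x y) g = 0"
    "\<And>i j x y. i \<in> {1..N} \<Longrightarrow> j \<in> {1..N} \<Longrightarrow> (x, y) \<in> el i j \<Longrightarrow> \<bar>eps * T 1 0 x y - Pp i j x y\<bar> \<le> C1 * (9 * A * CA * (sqrt eps * kap))"
    "ip N xs (\<lambda>i j x y. eps * T 1 0 x y - Pp i j x y) (\<lambda>i j x y. eps * T 1 0 x y - Pp i j x y)
      \<le> 81 * A\<^sup>2 * (CA\<^sup>2 * LD) * (eps * sqrt eps) * kap\<^sup>2 * N"
    using gradient_projection[OF C1 L] unfolding T_def by blast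
  obtain Pr where Pr: "VN k N Pr" "\<And>g. VN k N g \<Longrightarrow> ip N xs (\<lambda>i j x y. eps * T' 1 0 x y - Pr i j x y) g = 0"
    "\<And>i j x y. i \<in> {1..N} \<Longrightarrow> j \<in> {1..N} \<Longrightarrow> (x, y) \<in> el i j \<Longrightarrow> \<bar>eps * T' 1 0 x y - Pr i j x y\<bar> \<le> C1 * (9 * A * CA * (sqrt eps * kap))"
    "ip N xs (\<lambda>i j x y. eps * T' 1 0 x y - Pr i j x y) (\<lambda>i j x y. eps * T' 1 0 x y - Pr i j x y)
      \<le> 81 * A\<^sup>2 * (CA\<^sup>2 * LD) * (eps * sqrt eps) * kap\<^sup>2 * N"
    using gradient_projection[OF C1 L'] unfolding T'_def by blast
  \<comment> \<open>\<open>Pr\<close> projects the transposed function, so it has to be transposed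
    back.\<close>
  define Pq where "Pq = tr Pr"
  have VP: "VN k N Pu" "VN k N Pp" "VN k N Pq" using Pu Pp VN_tr[OF Pr(1)] by (auto simp: Pq_def)
  define eu ep eq :: dgfun where "eu = (\<lambda>i j x y. uw i j x y - Pu i j x y)" and "ep = (\<lambda>i j x y. pw i j x y - Pp i j x y)"
    and "eq = (\<lambda>i j x y. qw i j x y - Pq i j x y)"
  \<comment> \<open>Discrete error \<open>W - \<pi> w\<close>, while \<open>eu\<close>,
    \<open>ep\<close>, \<open>eq\<close> are the errors of the projection; the full error is the
    latter minus the former.\<close>
  define zu zp zq :: dgfun where "zu = (\<lambda>i j x y. U i j x y - Pu i j x y)" and "zp = (\<lambda>i j x y. P i j x y - Pp i j x y)"
    and "zq = (\<lambda>i j x y. Q i j x y - Pq i j x y)"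
  have Vz: "VN k N zu" "VN k N zp" "VN k N zq" unfolding zu_def zp_def zq_def by (intro VN_diff V VP)+
  note cz = cdg_VN[OF Vz(1)] cdg_VN[OF Vz(2)] cdg_VN[OF Vz(3)]
  have ce: "cdg eu" "cdg ep" "cdg eq" unfolding eu_def ep_def eq_def by (intro cdg_diff cw cdg_VN[OF VP(1)] cdg_VN[OF VP(2)] cdg_VN[OF VP(3)])+
  have treq: "tr eq = (\<lambda>i j x y. eps * T' 1 0 x y - Pr i j x y)"
    unfolding eq_def Pq_def tr_diff trqw by simp
  \<comment> \<open>Galerkin orthogonality: exact and discrete triples give the same functional, so
    both differences of \<open>BB\<close> from the projected triple coincide.\<close>
  have "BB eps (sqrt eps) b zu zp zq zu zp zq = BB eps (sqrt eps) b eu ep eq zu zp zq"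
    unfolding eu_def ep_def eq_def
      BB_diff[OF cw(1) cdg_VN[OF VP(1)] cw(2) cdg_VN[OF VP(2)] cw(3) cdg_VN[OF VP(3)] b Vz] exact[OF Vz]
    unfolding discrete[OF Vz, symmetric] unfolding zu_def[symmetric] zp_def[symmetric] zq_def[symmetric]
    using BB_diff[OF cdg_VN[OF V(1)] cdg_VN[OF VP(1)] cdg_VN[OF V(2)] cdg_VN[OF VP(2)] cdg_VN[OF V(3)] cdg_VN[OF VP(3)] b Vz]
    unfolding zu_def[symmetric] zp_def[symmetric] zq_def[symmetric] .
  moreover have "ip N xs ep zp = 0" using Pp(2)[OF Vz(2)] by (simp add: ep_def pw_def)
  moreover have "ip N xs eq zq = 0"
    using Pr(2)[OF VN_tr[OF Vz(3)]] unfolding treq[symmetric] by (simp add: ip_tr[OF ce(3) cz(3)])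
  moreover have "ip N xs (\<lambda>i j x y. b x y * eu i j x y) zu = 0"
    using Pu(2)[OF Vz(1)] by (simp add: eu_def uw_def)
  ultimately have energy: "(ip N xs zp zp + ip N xs zq zq) / eps + ip N xs (\<lambda>i j x y. b x y * zu i j x y) zu
      + sqrt eps * (JJ zu zu + JJ (tr zu) (tr zu)) =
      (FU eu zp (dx zp) + FU (tr eu) (tr zq) (dx (tr zq))) + (FP ep zu (dx zu) + FP (tr eq) (tr zu) (dx (tr zu)))
      + sqrt eps * (JJ eu zu + JJ (tr eu) (tr zu))"
    unfolding BB_self[OF Vz] by (simp add: BB_def)
  have "sqrt eps \<le> 1" using sqrt_eps(2) by linarith
  moreover have "sqrt eps * sqrt eps = eps" using eps by simp
  ultimately have se: "0 < sqrt eps" "sqrt eps * sqrt eps = eps" "sqrt eps \<le> 1" using sqrt_eps(1) by blast+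
  have dU: "\<bar>eu i j x y\<bar> \<le> Eu * kap" if "i \<in> {1..N}" "j \<in> {1..N}" "(x, y) \<in> el i j" for i j x y
    using Pu(3)[OF that] unfolding eu_def uw_def Eu by (simp add: mult.assoc)
  have dU': "\<bar>tr eu i j x y\<bar> \<le> Eu * kap" if "i \<in> {1..N}" "j \<in> {1..N}" "(x, y) \<in> el i j" for i j x y
    using dU[OF that(2,1)] that(3) mem_el_swap[of x y i j] unfolding tr_def by blast
  have dP: "\<bar>ep i j x y\<bar> \<le> Ep * (sqrt eps * kap)" if "i \<in> {1..N}" "j \<in> {1..N}" "(x, y) \<in> el i j" for i j x y
    using Pp(3)[OF that] unfolding ep_def pw_def Ep by (simp add: mult.assoc)
  have dQ: "\<bar>tr eq i j x y\<bar> \<le> Ep * (sqrt eps * kap)" if "i \<in> {1..N}" "j \<in> {1..N}" "(x, y) \<in> el i j" for i j x y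
    using Pr(3)[OF that] unfolding treq Ep by (simp add: mult.assoc)
  have hm: "hmin \<le> xs i - xs (i - 1)" if "i \<in> {1..N}" for i using width_bounds(1)[OF that] .
  \<comment> \<open>Young weights: half of the \<open>1 / eps\<close> term goes to the flux of
    \<open>u\<close>; the flux of \<open>p\<close>, \<open>q\<close> and the stabilisation, which is
    multiplied by \<open>sqrt eps\<close>, each take a quarter of the jump term.\<close>
  have g1: "0 < 1 / (2 * eps)" and g2: "0 < sqrt eps / 4" and g3: "(0::real) < 1 / 4" using eps by auto
  have F1: "FU eu zp (dx zp) + FU (tr eu) (tr zq) (dx (tr zq)) \<le>
     2 * (9 * Ci * (Eu * kap)\<^sup>2 * N / (4 * (1 / (2 * eps)) * hmin)) + 1 / (2 * eps) * (ip N xs zp zp + ip N xs zq zq)"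
  proof -
    have "FU eu zp (dx zp) \<le> 9 * Ci * (Eu * kap)\<^sup>2 * N / (4 * (1 / (2 * eps)) * hmin) + 1 / (2 * eps) * ip N xs zp zp"
      by (rule FU_bound[OF Ci ce(1) Vz(2) hmin_pos hm g1 dU])
    moreover have "FU (tr eu) (tr zq) (dx (tr zq)) \<le>
        9 * Ci * (Eu * kap)\<^sup>2 * N / (4 * (1 / (2 * eps)) * hmin) + 1 / (2 * eps) * ip N xs (tr zq) (tr zq)"
      by (rule FU_bound[OF Ci cdg_tr[OF ce(1)] VN_tr[OF Vz(3)] hmin_pos hm g1 dU'])
    ultimately show ?thesis unfolding ip_tr[OF cz(3) cz(3)] distrib_left by (rule add_le_twice)
  qed
  \<comment> \<open>The elementwise derivative of a discrete function is again discrete, hence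
    orthogonal to the projection error of \<open>p\<close>.\<close>
  have oP: "ip N xs ep (dx zu) = 0" using Pp(2)[OF VN_dx[OF Vz(1)]] by (simp add: ep_def pw_def)
  have oQ: "ip N xs (tr eq) (dx (tr zu)) = 0" unfolding treq by (rule Pr(2)[OF VN_dx[OF VN_tr[OF Vz(1)]]])
  have F2: "FP ep zu (dx zu) + FP (tr eq) (tr zu) (dx (tr zu)) \<le>
     2 * ((real N + 1) * (Ep * (sqrt eps * kap))\<^sup>2 / (4 * (sqrt eps / 4))) + sqrt eps / 4 * (JJ zu zu + JJ (tr zu) (tr zu))"
  proof -
    have "FP ep zu (dx zu) \<le> (real N + 1) * (Ep * (sqrt eps * kap))\<^sup>2 / (4 * (sqrt eps / 4)) + sqrt eps / 4 * JJ zu zu"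
      by (rule FP_bound[OF ce(2) cz(1) oP g2 dP])
    moreover have "FP (tr eq) (tr zu) (dx (tr zu)) \<le>
        (real N + 1) * (Ep * (sqrt eps * kap))\<^sup>2 / (4 * (sqrt eps / 4)) + sqrt eps / 4 * JJ (tr zu) (tr zu)"
      by (rule FP_bound[OF cdg_tr[OF ce(3)] cdg_tr[OF cz(1)] oQ g2 dQ])
    ultimately show ?thesis unfolding distrib_left by (rule add_le_twice)
  qed
  have F3: "JJ eu zu + JJ (tr eu) (tr zu) \<le>
     2 * ((real N + 1) * (Eu * kap)\<^sup>2 / (1 / 4)) + 1 / 4 * (JJ zu zu + JJ (tr zu) (tr zu))"
  proof -
    have "JJ eu zu \<le> (real N + 1) * (Eu * kap)\<^sup>2 / (1 / 4) + 1 / 4 * JJ zu zu"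
      by (rule JJ_bound[OF ce(1) cz(1) g3 dU])
    moreover have "JJ (tr eu) (tr zu) \<le> (real N + 1) * (Eu * kap)\<^sup>2 / (1 / 4) + 1 / 4 * JJ (tr zu) (tr zu)"
      by (rule JJ_bound[OF cdg_tr[OF ce(1)] cdg_tr[OF cz(1)] g3 dU'])
    ultimately show ?thesis unfolding distrib_left by (rule add_le_twice)
  qed
  have bpos: "0 \<le> b x y" if "i \<in> {1..N}" "j \<in> {1..N}" "(x, y) \<in> el i j" for i j x y
    using bnd[of x y] el_unit[OF that] b0 by force
  have cbz: "cdg (\<lambda>i j x y. b x y * zu i j x y)" by (rule cdg_mult[OF cdg_fun[OF b] cz(1)])
  have X0: "0 \<le> ip N xs zp zp + ip N xs zq zq"
    using ip_nonneg[OF cz(2) cz(2)] ip_nonneg[OF cz(3) cz(3)] by simp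
  have Y0: "0 \<le> ip N xs (\<lambda>i j x y. b x y * zu i j x y) zu"
    by (rule ip_nonneg[OF cbz cz(1)]) (use bpos in \<open>simp add: mult.assoc\<close>)
  have J0: "0 \<le> JJ zu zu + JJ (tr zu) (tr zu)"
    using JJ_nonneg[OF cz(1)] JJ_nonneg[OF cdg_tr[OF cz(1)]] by simp
  have c: "0 < min (sg / beta) (1 / 4)" using sg_pos beta by simp
  have N1': "1 \<le> real N" and Mpos: "0 < M" and M4: "M \<le> 4 * real N" using N1 M_bounds by auto
  have E: "(ip N xs zp zp + ip N xs zq zq) / eps + ip N xs (\<lambda>i j x y. b x y * zu i j x y) zu
      + sqrt eps * (JJ zu zu + JJ (tr zu) (tr zu)) \<le> 2 * K * (sqrt eps * (kap\<^sup>2 * (real N)\<^sup>2 / M))"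
    unfolding K by (rule energy_arithmetic[OF se(1,2) N1' Mpos M4 c J0 F1[unfolded hmin_def] F2 F3 energy Y0])
  have X': "ip N xs ep ep + ip N xs eq eq \<le> 2 * (Lp * (eps * sqrt eps) * kap\<^sup>2 * N)"
    using Pp(4) Pr(4) ip_tr[OF ce(3) ce(3)] unfolding treq Lp by (simp add: ep_def pw_def)
  have Y': "ip N xs (\<lambda>i j x y. b x y * eu i j x y) eu \<le> Lb * kap\<^sup>2"
    using Pu(4) unfolding Lb eu_def uw_def by (simp add: power_mult_distrib)
  have J': "JJ eu eu + JJ (tr eu) (tr eu) \<le> 2 * (4 * (real N + 1) * (Eu * kap)\<^sup>2)"
  proof -
    have "JJ eu eu \<le> 4 * (real N + 1) * (Eu * kap)\<^sup>2" by (rule JJ_bound_self[OF ce(1) dU])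
    moreover have "JJ (tr eu) (tr eu) \<le> 4 * (real N + 1) * (Eu * kap)\<^sup>2"
      by (rule JJ_bound_self[OF cdg_tr[OF ce(1)] dU'])
    ultimately show ?thesis by linarith
  qed
  have "eps powr (3/2) = eps powr (1 + 1/2)" by simp
  also have "\<dots> = eps * sqrt eps" using eps by (subst powr_add) (simp add: powr_half_sqrt)
  finally have pw32: "eps powr (-3/2) = 1 / (eps * sqrt eps)" using eps by (simp add: powr_minus_divide)
  let ?eu = "\<lambda>(i::nat) (j::nat) x y. u x y - U i j x y"
  let ?ep = "\<lambda>i j x y. eps * pd 1 0 u x y - P i j x y"
  let ?eq = "\<lambda>i j x y. eps * pd 0 1 u x y - Q i j x y"
  \<comment> \<open>The splitting of the error holds only on the cells, because \<open>u\<close> and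
    its derivatives are known through the decomposition only on the closed square.\<close>
  have ru: "u x y - U i j x y = eu i j x y - zu i j x y" if "i \<in> {1..N}" "j \<in> {1..N}" "(x, y) \<in> el i j" for i j x y
    using el_unit[OF that] by (simp add: eu_def zu_def uw_def uT)
  have rp: "eps * pd 1 0 u x y - P i j x y = ep i j x y - zp i j x y" if "i \<in> {1..N}" "j \<in> {1..N}" "(x, y) \<in> el i j" for i j x y
    using el_unit[OF that] by (simp add: ep_def zp_def pw_def pdT)
  have rq: "eps * pd 0 1 u x y - Q i j x y = eq i j x y - zq i j x y" if "i \<in> {1..N}" "j \<in> {1..N}" "(x, y) \<in> el i j" for i j x y
    using el_unit[OF that] by (simp add: eq_def zq_def qw_def pdT)
  have "ip N xs ?ep ?ep = ip N xs (\<lambda>i j x y. ep i j x y - zp i j x y) (\<lambda>i j x y. ep i j x y - zp i j x y)"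
    using rp by (intro ip_cong) simp
  then have Sp: "ip N xs ?ep ?ep \<le> 2 * ip N xs ep ep + 2 * ip N xs zp zp"
    using ip_diff_square[OF ce(2) cz(2) cdg_const, of 1] by simp
  have "ip N xs ?eq ?eq = ip N xs (\<lambda>i j x y. eq i j x y - zq i j x y) (\<lambda>i j x y. eq i j x y - zq i j x y)"
    using rq by (intro ip_cong) simp
  then have Sq: "ip N xs ?eq ?eq \<le> 2 * ip N xs eq eq + 2 * ip N xs zq zq"
    using ip_diff_square[OF ce(3) cz(3) cdg_const, of 1] by simp
  have "ip N xs (\<lambda>i j x y. b x y * ?eu i j x y) ?eu =
     ip N xs (\<lambda>i j x y. b x y * (eu i j x y - zu i j x y)) (\<lambda>i j x y. eu i j x y - zu i j x y)"
    using ru by (intro ip_cong) simp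
  then have Su: "ip N xs (\<lambda>i j x y. b x y * ?eu i j x y) ?eu \<le>
     2 * ip N xs (\<lambda>i j x y. b x y * eu i j x y) eu + 2 * ip N xs (\<lambda>i j x y. b x y * zu i j x y) zu"
    using ip_diff_square[OF ce(1) cz(1) cdg_fun[OF b] bpos] by simp
  have "JJ ?eu ?eu = JJ (\<lambda>i j x y. eu i j x y - zu i j x y) (\<lambda>i j x y. eu i j x y - zu i j x y)"
    using ru by (intro JJ_cong) simp
  then have Sj: "JJ ?eu ?eu \<le> 2 * JJ eu eu + 2 * JJ zu zu"
    using JJ_diff_square[OF ce(1) cz(1)] by simp
  have "JJ (tr ?eu) (tr ?eu) = JJ (\<lambda>i j x y. tr eu i j x y - tr zu i j x y) (\<lambda>i j x y. tr eu i j x y - tr zu i j x y)"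
  proof (rule JJ_cong)
    fix i j x y assume ij: "i \<in> {1..N}" "j \<in> {1..N}" "(x, y) \<in> el i j"
    then have "(y, x) \<in> el j i" using mem_el_swap[of x y i j] by blast
    then show "tr ?eu i j x y = tr eu i j x y - tr zu i j x y"
      using ru[OF ij(2,1)] unfolding tr_def by simp
  qed
  then have Sj': "JJ (tr ?eu) (tr ?eu) \<le> 2 * JJ (tr eu) (tr eu) + 2 * JJ (tr zu) (tr zu)"
    using JJ_diff_square[OF cdg_tr[OF ce(1)] cdg_tr[OF cz(1)]] by simp
  have e0: "0 < 1 / (eps * sqrt eps)" using eps by simp
  have SJ: "JJ ?eu ?eu + JJ (tr ?eu) (tr ?eu) \<le> 2 * (JJ eu eu + JJ (tr eu) (tr eu)) + 2 * (JJ zu zu + JJ (tr zu) (tr zu))"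
    by (rule add_le_double[OF Sj Sj'])
  have S1: "1 / (eps * sqrt eps) * (ip N xs ?ep ?ep + ip N xs ?eq ?eq) \<le>
      1 / (eps * sqrt eps) * (2 * (ip N xs ep ep + ip N xs eq eq) + 2 * (ip N xs zp zp + ip N xs zq zq))"
    using Sp Sq e0 by (intro mult_left_mono) auto
  have S: "1 / (eps * sqrt eps) * (ip N xs ?ep ?ep + ip N xs ?eq ?eq) + ip N xs (\<lambda>i j x y. b x y * ?eu i j x y) ?eu
      + (JJ ?eu ?eu + JJ (tr ?eu) (tr ?eu)) \<le>
      1 / (eps * sqrt eps) * (2 * (ip N xs ep ep + ip N xs eq eq) + 2 * (ip N xs zp zp + ip N xs zq zq)) +
      (2 * ip N xs (\<lambda>i j x y. b x y * eu i j x y) eu + 2 * ip N xs (\<lambda>i j x y. b x y * zu i j x y) zu) +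
      (2 * (JJ eu eu + JJ (tr eu) (tr eu)) + 2 * (JJ zu zu + JJ (tr zu) (tr zu)))"
    by (intro add_mono S1 Su SJ)
  have "b1 \<ge> 0" using bnd[of 0 0] b0 by force
  then have Lb0: "0 \<le> Lb" unfolding Lb by simp
  have Lp0: "0 \<le> Lp" unfolding Lp using LD(1) by simp
  note final = balanced_arithmetic[OF se N1' Mpos M4 X0 Y0 J0 Lp0 Lb0 E X' Y' J' S]
  have "bal_err eps b N xs u U P Q = sqrt (1 / (eps * sqrt eps) * (ip N xs ?ep ?ep + ip N xs ?eq ?eq)
      + ip N xs (\<lambda>i j x y. b x y * ?eu i j x y) ?eu + (JJ ?eu ?eu + JJ (tr ?eu) (tr ?eu)))"
    unfolding bal_err_def Let_def JJ_def jumpH_eq pw32 power2_eq_square by (simp add: distrib_left add.assoc)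
  then show ?thesis using final by simp
qed

end

text \<open>The powers collect to \<open>N^(-2k) * M^(2k+1)\<close>, whose root is the claimed
  rate.\<close>

lemma rate_arithmetic:
  fixes M N :: real
  assumes "0 < M" "0 < N" "0 \<le> C"
  shows "sqrt (C * (((M / N) ^ Suc k)\<^sup>2 * N\<^sup>2 / M)) = sqrt C * N powr (- real k) * M powr (real k + 1/2)"
proof -
  have "((M / N) ^ Suc k)\<^sup>2 * N\<^sup>2 / M = (N powr (- real k) * M powr (real k + 1/2))\<^sup>2"
  proof -
    have "(M powr (real k + 1/2))\<^sup>2 = M powr (real (2 * k + 1))"
      using assms by (simp add: power2_eq_square powr_add[symmetric] add.commute)
    also have "\<dots> = M ^ (2 * k + 1)" using assms by (simp only: powr_realpow)
    finally have m: "(M powr (real k + 1/2))\<^sup>2 = M ^ (2 * k + 1)" .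
    have n: "(N powr (- real k))\<^sup>2 = 1 / N ^ (2 * k)"
      using assms by (simp add: powr_minus_divide powr_realpow power_divide power_mult[symmetric] mult.commute)
    show ?thesis unfolding power_mult_distrib m n using assms
      by (simp add: power_divide power2_eq_square power_add power_mult power_mult_distrib field_simps)
  qed
  then show ?thesis using assms by (simp add: real_sqrt_mult mult.assoc)
qed

section \<open>From the regularity assumption to the layered form\<close>

context layer_mesh
begin

lemma powr_th:
  assumes "r \<noteq> 0"
  shows "eps powr (- real i / 2) = th r ^ i"
proof -
  have "eps powr (- real i / 2) = (eps powr (- 1 / 2)) powr real i" by (simp add: powr_powr)
  also have "eps powr (- 1 / 2) = th r"
    using assms eps by (simp add: th_def powr_minus_divide powr_half_sqrt)
  finally show ?thesis using th_pos[of r] by (simp add: powr_realpow)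
qed

text \<open>Each bound of the decomposition factorises into one weight and one growth rate per
  direction, since a corner exponential is a product of two edge exponentials.\<close>

lemma reg_decomp_layered:
  assumes "reg_decomp k beta Cr eps u"
  shows "\<exists>D. layered Cr D \<and> (\<forall>x\<in>{0..1}. \<forall>y\<in>{0..1}. u x y = superpos D 0 0 x y)"
proof -
  obtain S W1 W2 W3 W4 Z1 Z2 Z3 Z4 where
      Ck: "\<forall>g\<in>{S, W1, W2, W3, W4, Z1, Z2, Z3, Z4}. Ck_sq (k + 2) g"
    and u: "\<forall>x\<in>{0..1}. \<forall>y\<in>{0..1}.
          u x y = S x y + W1 x y + W2 x y + W3 x y + W4 x y + Z1 x y + Z2 x y + Z3 x y + Z4 x y"
    and bd: "\<forall>i j. i \<le> k + 2 \<longrightarrow> j \<le> k + 2 \<longrightarrow> (\<forall>x\<in>{0..1}. \<forall>y\<in>{0..1}.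
          \<bar>pd i j S x y\<bar> \<le> Cr \<and>
          \<bar>pd i j W1 x y\<bar> \<le> Cr * eps powr (- real i / 2) * exp (- beta * x / sqrt eps) \<and>
          \<bar>pd i j W2 x y\<bar> \<le> Cr * eps powr (- real j / 2) * exp (- beta * y / sqrt eps) \<and>
          \<bar>pd i j W3 x y\<bar> \<le> Cr * eps powr (- real i / 2) * exp (- beta * (1 - x) / sqrt eps) \<and>
          \<bar>pd i j W4 x y\<bar> \<le> Cr * eps powr (- real j / 2) * exp (- beta * (1 - y) / sqrt eps) \<and>
          \<bar>pd i j Z1 x y\<bar> \<le> Cr * eps powr (- real (i + j) / 2) * exp (- beta * (x + y) / sqrt eps) \<and>
          \<bar>pd i j Z2 x y\<bar> \<le> Cr * eps powr (- real (i + j) / 2) * exp (- beta * ((1 - x) + y) / sqrt eps) \<and>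
          \<bar>pd i j Z3 x y\<bar> \<le> Cr * eps powr (- real (i + j) / 2) * exp (- beta * ((1 - x) + (1 - y)) / sqrt eps) \<and>
          \<bar>pd i j Z4 x y\<bar> \<le> Cr * eps powr (- real (i + j) / 2) * exp (- beta * (x + (1 - y)) / sqrt eps))"
    using assms unfolding reg_decomp_def by (elim exE conjE)
  \<comment> \<open>The row index \<open>r\<close> describes the behaviour in \<open>x\<close>, the
    column index \<open>s\<close> that in \<open>y\<close>; corners are numbered counterclockwise
    from the origin.\<close>
  define comp where "comp = (\<lambda>(r :: nat) (s :: nat).
    if r = 0 then (if s = 0 then S else if s = 1 then W2 else W4)
    else if r = 1 then (if s = 0 then W1 else if s = 1 then Z1 else Z4)
    else (if s = 0 then W3 else if s = 1 then Z2 else Z3))"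
  define D where "D = (\<lambda>r s i j. pd i j (comp r s))"
  \<comment> \<open>The sign of \<open>Cr\<close> follows from the bound on the regular part at a
    single point.\<close>
  have "\<bar>pd 0 0 S 0 0\<bar> \<le> Cr" using bd by force
  then have Cr: "0 \<le> Cr" by linarith
  have fam: "smooth_family (Suc (Suc k)) (D r s)" for r s
  proof -
    have "comp r s \<in> {S, W1, W2, W3, W4, Z1, Z2, Z3, Z4}" by (simp add: comp_def)
    then have "Ck_sq (k + 2) (comp r s)" using Ck by blast
    then show ?thesis unfolding D_def using Ck_sq_smooth_family[of "Suc (Suc k)"] by simp
  qed
  have th0: "th 0 = 1" by (simp add: th_def)
  have th12: "th 2 = th 1" by (simp add: th_def)
  have p: "eps powr (- real i / 2) = th 1 ^ i" for i by (rule powr_th) simp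
  have ew_add: "exp (- beta * (x + y) / sqrt eps) = ew x * ew y" for x y
    unfolding ew_def exp_add[symmetric] by (simp add: add_divide_distrib diff_divide_distrib algebra_simps)
  have ws: "wt 0 x = 1" "wt 1 x = ew x" "wt 2 x = ew (1 - x)" for x by (simp_all add: wt_def)
  have bound: "\<bar>D r s i j x y\<bar> \<le> Cr * th r ^ i * th s ^ j * (wt r x * wt s y)"
    if rs: "r < 3" "s < 3" and ij: "i \<le> Suc (Suc k)" "j \<le> Suc (Suc k)" and xy: "x \<in> {0..1}" "y \<in> {0..1}" for r s i j x y
  proof -
    have ij': "i \<le> k + 2" "j \<le> k + 2" using ij by auto
    note B = bd[rule_format, OF ij' xy, unfolded p ew_add power_add, folded ew_def]
    have r: "r = 0 \<or> r = 1 \<or> r = 2" and s: "s = 0 \<or> s = 1 \<or> s = 2" using rs by linarith+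
    show ?thesis using r s B unfolding D_def comp_def
      by (elim disjE; simp add: th0 th12 ws mult_ac del: One_nat_def)
  qed
  have "layered Cr D" unfolding layered_def using Cr fam bound by blast
  moreover have "u x y = superpos D 0 0 x y" if "x \<in> {0..1}" "y \<in> {0..1}" for x y
  proof -
    have "superpos D 0 0 x y = (\<Sum>r<3. \<Sum>s<3. comp r s x y)"
      unfolding superpos_def D_def by (simp add: sum.cartesian_product split_beta pd_def pdy_def)
    also have "\<dots> = S x y + W1 x y + W2 x y + W3 x y + W4 x y + Z1 x y + Z2 x y + Z3 x y + Z4 x y"
      by (simp add: comp_def numeral_3_eq_3 lessThan_Suc)
    finally show ?thesis using u that by simp
  qed
  ultimately show ?thesis by blast
qed

end

theorem theorem4p3:
  fixes k :: nat and sg beta Cr :: real and b f :: "real \<Rightarrow> real \<Rightarrow> real" and kind :: mesh_kind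
  assumes "sg \<ge> real k + 3/2"
    and "beta > 0"
    and "\<forall>x\<in>{0..1}. \<forall>y\<in>{0..1}. b x y \<ge> 2 * beta\<^sup>2"
    and "smooth_sq b"
  shows "\<exists>C>0. \<forall>eps N u U P Q.
           0 < eps \<and> 4 \<le> N \<and> 4 dvd N \<and> sqrt eps \<le> 1 / real N \<and>
           tau kind sg beta eps N \<le> 1/4 \<and>
           solves eps b f u \<and> reg_decomp k beta Cr eps u \<and>
           ldg_solution k eps (sqrt eps) b f N (mesh_pt kind sg beta eps N) U P Q
           \<longrightarrow> bal_err eps b N (mesh_pt kind sg beta eps N) u U P Q
                 \<le> C * real N powr (- real k) * max_dpsi kind N eps powr (real k + 1/2)"
proof -
  have "Ck_sq 0 b" using assms(4) unfolding smooth_sq_def by blast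
  then have b: "continuous_on sq (\<lambda>z. b (fst z) (snd z))"
    unfolding Ck_sq_def by (auto simp: pd_def pdy_def)
  have "bounded ((\<lambda>z. b (fst z) (snd z)) ` sq)"
    using compact_continuous_image[OF b compact_cbox] by (rule compact_imp_bounded)
  then obtain b1 where b1: "\<And>z. z \<in> sq \<Longrightarrow> \<bar>b (fst z) (snd z)\<bar> \<le> b1"
    unfolding bounded_iff by auto
  have bnd: "2 * beta\<^sup>2 \<le> b x y \<and> b x y \<le> b1" if "x \<in> {0..1}" "y \<in> {0..1}" for x y
    using assms(3) b1[of "(x, y)"] that by (auto simp: cbox_Pair_eq)
  have b0: "0 < 2 * beta\<^sup>2" using assms(2) by simp
  obtain Ci where Ci: "inverse_constant k Ci" using inverse_constant_exists by blast
  obtain Cb where Cb: "projection_constant k (2 * beta\<^sup>2) b1 Cb" using projection_constant_exists[OF b0] by blast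
  obtain C1 where C1: "projection_constant k 1 1 C1" using projection_constant_exists[of 1] by auto
  \<comment> \<open>The locale constants exported with their parameters: neither \<open>eps\<close>
    nor \<open>N\<close> occurs among them, so they may be fixed at this point.\<close>
  define cA where "cA = layer_mesh.CA sg beta k"
  define lD where "lD = layer_mesh.LD sg beta k"
  define Eu where "Eu = Cb * (9 * Cr * cA)"
  define Ep where "Ep = C1 * (9 * Cr * cA)"
  define Lp where "Lp = 81 * Cr\<^sup>2 * (cA\<^sup>2 * lD)"
  define Lb where "Lb = b1 * (9 * Cr * cA)\<^sup>2"
  define K where "K = 9 * Ci * Eu\<^sup>2 / min (sg / beta) (1/4) + 16 * Ep\<^sup>2 + 64 * Eu\<^sup>2"
  \<comment> \<open>The absolute value makes the root non-negative without tracking signs; adding 1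
    to the root afterwards makes the constant strictly positive.\<close>
  define C where "C = \<bar>16 * Lp + 8 * Lb + 128 * Eu\<^sup>2 + 4 * K\<bar>"
  have "bal_err eps b N (mesh_pt kind sg beta eps N) u U P Q
      \<le> (sqrt C + 1) * real N powr (- real k) * max_dpsi kind N eps powr (real k + 1/2)"
    if H: "0 < eps" "4 \<le> N" "4 dvd N" "sqrt eps \<le> 1 / real N" "tau kind sg beta eps N \<le> 1/4"
      and sol: "solves eps b f u" and reg: "reg_decomp k beta Cr eps u"
      and ldg: "ldg_solution k eps (sqrt eps) b f N (mesh_pt kind sg beta eps N) U P Q" for eps N u U P Q
  proof -
    interpret layer_mesh kind sg beta eps N k
      using assms(1,2) H by unfold_locales auto
    obtain D where L: "layered Cr D" and u: "\<And>x y. x \<in> {0..1} \<Longrightarrow> y \<in> {0..1} \<Longrightarrow> u x y = superpos D 0 0 x y"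
      using reg_decomp_layered[OF reg] by blast
    have MN: "0 < M" "0 < real N" using M_bounds H by auto
    have "bal_err eps b N xs u U P Q \<le> sqrt ((16 * Lp + 8 * Lb + 128 * Eu\<^sup>2 + 4 * K) * (kap\<^sup>2 * (real N)\<^sup>2 / M))"
      by (rule error_estimate[OF b bnd b0 L u sol ldg Ci Cb C1 Eu_def[unfolded cA_def] Ep_def[unfolded cA_def]
            Lp_def[unfolded cA_def lD_def] Lb_def[unfolded cA_def] K_def])
    also have "\<dots> \<le> sqrt (C * (kap\<^sup>2 * (real N)\<^sup>2 / M))"
      unfolding C_def using MN by (intro real_sqrt_le_mono mult_right_mono) auto
    also have "\<dots> = sqrt C * real N powr (- real k) * M powr (real k + 1/2)"
      unfolding kap_def using MN by (intro rate_arithmetic) (auto simp: C_def)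
    also have "\<dots> \<le> (sqrt C + 1) * real N powr (- real k) * M powr (real k + 1/2)"
      by (intro mult_right_mono) auto
    finally show ?thesis .
  qed
  moreover have "0 < sqrt C + 1" by (intro add_nonneg_pos) (auto simp: C_def)
  ultimately show ?thesis by blast
qed

end
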